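(* Let $K\in\mathcal{S}_0$ be a star body about the origin in $\mathbb{R}^n$. (i) If $\phi\in\widetilde{\Phi}_1$, then for every $K\in\mathcal{S}_0$ $$\widetilde{G}_{\phi}^{orlicz}(K)\ \geq\ \widetilde{\Omega}_{\phi}^{orlicz}(K)\ \geq\ \widetilde{\Omega}_{\phi}^{orlicz}(B_K)=\widetilde{G}_{\phi}^{orlicz}(B_K),$$ while if $\phi\in\widetilde{\Psi}$, the inequalities are reversed, i.e. $\widetilde{G}_{\phi}^{orlicz}(K)\leq\widetilde{\Omega}_{\phi}^{orlicz}(K)\leq\widetilde{\Omega}_{\phi}^{orlicz}(B_K)=\widetilde{G}_{\phi}^{orlicz}(B_K)$. (ii) If $\phi\in\widetilde{\Phi}_1$, then $$\widetilde{\Omega}_{\phi}^{orlicz}(K)\leq\widetilde{\Omega}_{\phi}^{orlicz}\big((B_{K^\circ})^\circ\big)\quad\text{for } K\in\widetilde{\mathcal{S}},$$ $$\widetilde{\Omega}_{\phi}^{orlicz}(K)\leq\widetilde{G}_{\phi}^{orlicz}(K)\leq\widetilde{G}_{\phi}^{orlicz}\big((B_{K^\circ})^\circ\big)\quad\text{for } K\in\widetilde{\mathcal{K}}.$$ Equality holds (in $\widetilde{\Omega}_{\phi}^{orlicz}(K)\leq\widetilde{\Omega}_{\phi}^{orlicz}((B_{K^\circ})^\circ)$ for $K\in\widetilde{\mathcal S}$, respectively in $\widetilde{G}_{\phi}^{orlicz}(K)\leq\widetilde{G}_{\phi}^{orlicz}((B_{K^\circ})^\circ)$ for $K\in\widetilde{\mathcal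 K}$) if and only if $K$ is an origin-symmetric ellipsoid.
   Context: $B_2^n$ is the closed unit Euclidean ball of $\mathbb{R}^n$, $S^{n-1}$ the unit sphere, $\sigma$ the spherical measure on $S^{n-1}$, $|\cdot|$ volume, $\omega_n=|B_2^n|$. A compact set $K$ that contains the closed segment from the origin to each of its points has radial function $\rho_K(u)=\max\{\lambda:\lambda u\in K\}$, $u\in S^{n-1}$; $K$ is a star body (about the origin) if $\rho_K$ is continuous and positive on $S^{n-1}$. $\mathcal{S}_0$ is the set of star bodies and $\mathcal{K}_0\subset\mathcal{S}_0$ the set of convex bodies with the origin in their interiors. For $K\in\mathcal{S}_0$ the polar body is $K^\circ=\{y:\langle x,y\rangle\leq1\ \forall x\in K\}$. $\mathcal{K}_c$ is the set of $K\in\mathcal{K}_0$ with centroid at the origin, $\mathcal{K}_s$ the set of $K\in\mathcal{K}_0$ with $K^\circ\in\mathcal{K}_c$; $\widetilde{\mathcal{K}}=\mathcal{K}_c\cup\mathcal{K}_s$ and $\widetilde{\mathcal{S}}=\{L\in\mathcal{S}_0: L^\circ\in\widetilde{\mathcal{K}}\}$. The volume radius is $\mathrm{vrad}(K)=(|K|/\omega_n)^{1/n}$, and $B_K=\mathrm{vrad}(K)B_2^n$. An origin-symmetric ellipsoid is $TB_2^n$ with $T$ an invertible linear map. Throughout $\phi:(0,\infty)\to(0,\infty)$ is continuous and $F(t)=\phi(t^{1/n})$. $\widetilde{\Phi}$ is the set of $\phi$ for which $F$ is either constant or strictly convex; $\widetilde{\Phi}_1\subset\widetilde\Phi$ the set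 of $\phi$ for which $F$ is either constant or decreasing and strictly convex; $\widetilde{\Psi}$ the set of $\phi$ for which $F$ is either constant or increasing and strictly concave. For $K,L\in\mathcal{S}_0$, $\widetilde{V}_\phi(K,L)=\frac1n\int_{S^{n-1}}\phi\!\left(\frac{\rho_L(u)}{\rho_K(u)}\right)\rho_K(u)^n\,d\sigma(u)$. For $\phi\in\widetilde{\Phi}$, the dual Orlicz $L_\phi$ affine and geominimal surface areas of $K\in\mathcal{S}_0$ are $\widetilde{\Omega}_{\phi}^{orlicz}(K)=\inf_{L\in\widetilde{\mathcal{S}}}\{n\widetilde{V}_\phi(K,\mathrm{vrad}(L^\circ)L)\}$ and $\widetilde{G}_{\phi}^{orlicz}(K)=\inf_{L\in\widetilde{\mathcal{K}}}\{n\widetilde{V}_\phi(K,\mathrm{vrad}(L^\circ)L)\}$. For $\phi\in\widetilde{\Psi}$ they are defined by the same formulas with $\sup$ in place of $\inf$. *)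

theory Defs
  imports "HOL-Analysis.Analysis"
begin

text \<open>
  The ambient space \<open>\<real>\<^sup>n\<close> is \<^typ>\<open>real ^ 'n\<close>, with \<open>n = CARD('n)\<close>; thus \<open>n \<ge> 1\<close> is arbitrary.
\<close>

section \<open>The spherical measure\<close>

text \<open>
  The spherical measure is \<open>n\<close> times the image of Lebesgue measure on the punctured unit ball under
  the radial projection \<^term>\<open>sgn\<close> \<open>: x \<mapsto> x / \<parallel>x\<parallel>\<close>: the surface area of \<open>A\<close> is \<open>n\<close> times the volume
  of the cone over \<open>A\<close> with apex at the origin (see \<open>emeasure_spherical_measure\<close>).  For \<open>n = 1\<close> it
  is the counting measure on \<open>{-1, 1}\<close>.
\<close>

definition spherical_measure :: "(real ^ 'n) measure" where
  "spherical_measure =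
     scale_measure (of_nat CARD('n))
       (distr (restrict_space lborel (cball 0 1 - {0})) (restrict_space borel (sphere 0 1)) sgn)"

lemma space_spherical_measure: "space (spherical_measure :: (real ^ 'n) measure) = sphere 0 1"
  by (simp add: spherical_measure_def space_scale_measure space_restrict_space)

lemma sets_spherical_measure:
  "sets (spherical_measure :: (real ^ 'n) measure) = sets (restrict_space borel (sphere 0 1))"
  by (simp add: spherical_measure_def)

lemma measurable_sgn_sphere:
  "sgn \<in> measurable (restrict_space lborel (cball 0 1 - {0}))
                    (restrict_space borel (sphere (0 :: real ^ 'n) 1))"
proof (rule measurable_restrict_space2)
  show "sgn \<in> space (restrict_space lborel (cball 0 1 - {0})) \<rightarrow> sphere (0 :: real ^ 'n) 1"
    by (auto simp: space_restrict_space norm_sgn)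
  have "(sgn :: real ^ 'n \<Rightarrow> _) \<in> borel_measurable borel"
    unfolding sgn_div_norm[abs_def] by measurable
  then show "(sgn :: real ^ 'n \<Rightarrow> _) \<in> borel_measurable (restrict_space lborel (cball 0 1 - {0}))"
    by (intro measurable_restrict_space1) simp
qed

lemma emeasure_spherical_measure:
  fixes A :: "(real ^ 'n) set"
  assumes "A \<in> sets borel" "A \<subseteq> sphere 0 1"
  shows "emeasure spherical_measure A =
           of_nat CARD('n) * emeasure lborel {x. x \<noteq> 0 \<and> norm x \<le> 1 \<and> x /\<^sub>R norm x \<in> A}"
proof -
  have A: "A \<in> sets (restrict_space borel (sphere 0 1))"
    using assms by (subst sets_restrict_space_iff) auto
  have eq: "sgn -` A \<inter> space (restrict_space lborel (cball 0 1 - {0}))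
        = {x. x \<noteq> 0 \<and> norm x \<le> 1 \<and> x /\<^sub>R norm x \<in> A}"
    by (auto simp: space_restrict_space sgn_div_norm)
  show ?thesis
    unfolding spherical_measure_def
    by (subst emeasure_scale_measure, subst emeasure_distr[OF measurable_sgn_sphere A], subst eq,
        subst emeasure_restrict_space) auto
qed

section \<open>Star bodies, polar bodies and volume radius\<close>

text \<open>
  For the sets \<open>K\<close> of interest \<open>{r. r u \<in> K}\<close> is nonempty and compact, so that the supremum is a
  maximum.
\<close>

definition radial :: "(real ^ 'n) set \<Rightarrow> real ^ 'n \<Rightarrow> real" where
  "radial K u = Sup {r. r *\<^sub>R u \<in> K}"

text \<open>
  \<open>K \<noteq> {}\<close> has to be required because \<^term>\<open>Sup {} :: real\<close> is an unspecified number; together with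
  the condition on segments it gives \<open>0 \<in> K\<close>.
\<close>

definition star_bodies :: "(real ^ 'n) set set" where
  "star_bodies = {K. K \<noteq> {} \<and> compact K \<and> (\<forall>x\<in>K. closed_segment 0 x \<subseteq> K) \<and>
                     continuous_on (sphere 0 1) (radial K) \<and> (\<forall>u\<in>sphere 0 1. 0 < radial K u)}"

definition convex_bodies :: "(real ^ 'n) set set" where
  "convex_bodies = {K. compact K \<and> convex K \<and> 0 \<in> interior K}"

definition polar_body :: "(real ^ 'n) set \<Rightarrow> (real ^ 'n) set" where
  "polar_body K = {y. \<forall>x\<in>K. x \<bullet> y \<le> 1}"

definition centroid :: "(real ^ 'n) set \<Rightarrow> real ^ 'n" where
  "centroid K = (LINT x:K|lebesgue. x) /\<^sub>R measure lebesgue K"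

definition convex_bodies_c :: "(real ^ 'n) set set" where
  "convex_bodies_c = {K \<in> convex_bodies. centroid K = 0}"

definition convex_bodies_s :: "(real ^ 'n) set set" where
  "convex_bodies_s = {K \<in> convex_bodies. polar_body K \<in> convex_bodies_c}"

definition K_tilde :: "(real ^ 'n) set set" where
  "K_tilde = convex_bodies_c \<union> convex_bodies_s"

definition S_tilde :: "(real ^ 'n) set set" where
  "S_tilde = {L \<in> star_bodies. polar_body L \<in> K_tilde}"

definition vrad :: "(real ^ 'n) set \<Rightarrow> real" where
  "vrad K = root CARD('n) (measure lebesgue K / measure lebesgue (cball (0 :: real ^ 'n) 1))"

definition ball_vrad :: "(real ^ 'n) set \<Rightarrow> (real ^ 'n) set" where
  "ball_vrad K = (*\<^sub>R) (vrad K) ` cball 0 1"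

definition origin_symmetric_ellipsoid :: "(real ^ 'n) set \<Rightarrow> bool" where
  "origin_symmetric_ellipsoid E \<longleftrightarrow> (\<exists>T :: real ^ 'n \<Rightarrow> real ^ 'n. linear T \<and> bij T \<and> E = T ` cball 0 1)"

section \<open>Classes of functions\<close>

definition strictly_convex_on :: "real set \<Rightarrow> (real \<Rightarrow> real) \<Rightarrow> bool" where
  "strictly_convex_on S f \<longleftrightarrow> convex S \<and>
     (\<forall>x\<in>S. \<forall>y\<in>S. \<forall>t. x \<noteq> y \<longrightarrow> 0 < t \<longrightarrow> t < 1 \<longrightarrow>
        f ((1 - t) * x + t * y) < (1 - t) * f x + t * f y)"

definition strictly_concave_on :: "real set \<Rightarrow> (real \<Rightarrow> real) \<Rightarrow> bool" where
  "strictly_concave_on S f \<longleftrightarrow> strictly_convex_on S (\<lambda>x. - f x)"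

text \<open>
  A function on \<open>(0, \<infinity>)\<close> is a total function on \<^typ>\<open>real\<close> of which only the restriction to
  \<^term>\<open>{0 :: real <..}\<close> matters.  The argument \<open>n\<close> below is the dimension of the space.
\<close>

definition admissible :: "(real \<Rightarrow> real) \<Rightarrow> bool" where
  "admissible \<phi> \<longleftrightarrow> continuous_on {0<..} \<phi> \<and> (\<forall>t>0. 0 < \<phi> t)"

definition F_of :: "nat \<Rightarrow> (real \<Rightarrow> real) \<Rightarrow> real \<Rightarrow> real" where
  "F_of n \<phi> t = \<phi> (root n t)"

definition Phi_tilde :: "nat \<Rightarrow> (real \<Rightarrow> real) set" where
  "Phi_tilde n = {\<phi>. admissible \<phi> \<and>
     (F_of n \<phi> constant_on {0<..} \<or> strictly_convex_on {0<..} (F_of n \<phi>))}"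

definition Phi_tilde_1 :: "nat \<Rightarrow> (real \<Rightarrow> real) set" where
  "Phi_tilde_1 n = {\<phi> \<in> Phi_tilde n.
     F_of n \<phi> constant_on {0<..} \<or>
     antimono_on {0<..} (F_of n \<phi>) \<and> strictly_convex_on {0<..} (F_of n \<phi>)}"

definition Psi_tilde :: "nat \<Rightarrow> (real \<Rightarrow> real) set" where
  "Psi_tilde n = {\<phi>. admissible \<phi> \<and>
     (F_of n \<phi> constant_on {0<..} \<or>
      mono_on {0<..} (F_of n \<phi>) \<and> strictly_concave_on {0<..} (F_of n \<phi>))}"

section \<open>Dual Orlicz affine and geominimal surface areas\<close>

definition dual_mixed_volume ::
    "(real \<Rightarrow> real) \<Rightarrow> (real ^ 'n) set \<Rightarrow> (real ^ 'n) set \<Rightarrow> real" where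
  "dual_mixed_volume \<phi> K L =
     1 / real CARD('n) *
       (LINT u|spherical_measure. \<phi> (radial L u / radial K u) * radial K u ^ CARD('n))"

definition surface_functional ::
    "(real \<Rightarrow> real) \<Rightarrow> (real ^ 'n) set \<Rightarrow> (real ^ 'n) set \<Rightarrow> real" where
  "surface_functional \<phi> K L =
     real CARD('n) * dual_mixed_volume \<phi> K ((*\<^sub>R) (vrad (polar_body L)) ` L)"

text \<open>
  The surface areas are infima for \<open>\<phi>\<close> in \<^const>\<open>Phi_tilde\<close> and suprema for \<open>\<phi>\<close> in \<^const>\<open>Psi_tilde\<close>;
  each case has its own constant.  They are taken in \<^typ>\<open>ereal\<close>, so that finiteness of the suprema
  is not presupposed.
\<close>

definition Omega_inf :: "(real \<Rightarrow> real) \<Rightarrow> (real ^ 'n) set \<Rightarrow> ereal" where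
  "Omega_inf \<phi> K = (INF L\<in>S_tilde. ereal (surface_functional \<phi> K L))"

definition G_inf :: "(real \<Rightarrow> real) \<Rightarrow> (real ^ 'n) set \<Rightarrow> ereal" where
  "G_inf \<phi> K = (INF L\<in>K_tilde. ereal (surface_functional \<phi> K L))"

definition Omega_sup :: "(real \<Rightarrow> real) \<Rightarrow> (real ^ 'n) set \<Rightarrow> ereal" where
  "Omega_sup \<phi> K = (SUP L\<in>S_tilde. ereal (surface_functional \<phi> K L))"

definition G_sup :: "(real \<Rightarrow> real) \<Rightarrow> (real ^ 'n) set \<Rightarrow> ereal" where
  "G_sup \<phi> K = (SUP L\<in>K_tilde. ereal (surface_functional \<phi> K L))"

end

theory Submission
  imports Defs "HOL-Probability.Distributions"
begin

text \<open>
  By Jensen's inequality and the monotonicity of \<open>F\<close>, everything reduces to the Blaschke--Santalo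
  inequality \<open>|K| |K\<degree>| \<le> \<omega>\<^sub>n\<^sup>2\<close>, with its equality case, for bodies \<open>K\<close> with centroid or
  Santalo point at the origin.  That inequality is obtained from Lehec's functional version: if \<open>f\<close> is centred and
  \<open>f x g y \<le> exp (- x \<bullet> y)\<close>, then \<open>\<integral>f \<integral>g \<le> (2 \<pi>)\<^sup>n\<close>.  One bisects \<open>g\<close> by a hyperplane,
  shears so that both halves have their barycentre on the normal axis, and replaces each half by a centred Gaussian along
  that axis, using the one-dimensional inequality on half-lines.  After \<open>n\<close> steps both functions are Gaussian.
  All functions stay continuous and positive on \<open>\<real>\<^sup>n\<close>, so equality can be traced back pointwise: it forces
  \<open>f\<close> and \<open>g\<close> to be Gaussian already before each step.
\<close>

section \<open>The inequality on half-lines\<close>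

text \<open>Gaussians of gauges link bodies to functions: \<open>x \<bullet> y\<close> is at most
  the gauge of K at x times the gauge of its polar at y, hence at most half the sum of their
  squares, and the integrals of \<open>exp (- p\<^sup>2 / 2)\<close> for the two gauges are the same
  constant times the two volumes. A centroid at the origin makes the Gaussian centred. The obstacle
  in the induction is that centring the halves of \<open>g\<close> requires a translation by some
  \<open>z\<close>, which spoils the bound unless \<open>f\<close> is multiplied by
  \<open>exp (z \<bullet> x)\<close>. As \<open>f\<close> is centred,
  \<open>exp u \<ge> 1 + u\<close> shows that this cannot lower its integral, and raises it unless
  \<open>z = 0\<close>. Afterwards the centred function is the one obtained from \<open>g\<close>,
  so the two roles alternate. That ellipsoids attain the bound is deduced from the inequality itself
  together with a product of shears, without determinants. For the surface areas, Jensen's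
  inequality bounds the functional for every L, while the test body \<open>L = K\<close> gives the
  comparison in the opposite direction.\<close>

lemma primitive_from_zero:
  fixes f :: "real \<Rightarrow> real"
  assumes cont: "continuous_on UNIV f" and pos: "\<And>s. 0 < f s"
    and int: "set_integrable lborel {0..} f"
  obtains F where "\<And>s. 0 < s \<Longrightarrow> (F has_real_derivative f s) (at s)"
    and "(F \<longlongrightarrow> 0) (at_right 0)" and "(F \<longlongrightarrow> (LINT s:{0..}|lborel. f s)) at_top"
    and "\<And>s t. 0 < s \<Longrightarrow> s < t \<Longrightarrow> F s < F t"
    and "\<And>s. 0 < s \<Longrightarrow> 0 < F s" and "\<And>s. 0 < s \<Longrightarrow> F s < (LINT s:{0..}|lborel. f s)"
proof -
  define F where "F s = integral {0..s} f" for s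
  have cont': "continuous_on {a..b} f" for a b
    using cont continuous_on_subset by blast
  have D: "(F has_real_derivative f s) (at s)" if "0 < s" for s
  proof -
    have "(F has_real_derivative f s) (at s within {0..s + 1})"
      unfolding F_def using that by (intro integral_has_real_derivative cont') auto
    then show ?thesis using that by (simp add: at_within_Icc_at)
  qed
  have "continuous_on {0..1} F"
    unfolding F_def by (intro indefinite_integral_continuous_1 integrable_continuous_real cont')
  then have "(F \<longlongrightarrow> F 0) (at 0 within {0..1})"
    by (auto simp: continuous_on_def)
  then have L0: "(F \<longlongrightarrow> 0) (at_right 0)"
    by (simp add: F_def at_within_Icc_at_right)
  have "set_integrable lborel {0..b} f" for b
    by (rule set_integrable_subset[OF int]) auto
  then have "(LINT s:{0..b}|lborel. f s) = F b" for b
    unfolding F_def by (rule set_borel_integral_eq_integral)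
  then have Linf: "(F \<longlongrightarrow> (LINT s:{0..}|lborel. f s)) at_top"
    using tendsto_set_lebesgue_integral_at_top[OF _ int] by simp
  have mono: "F s < F t" if "0 < s" "s < t" for s t
    by (rule DERIV_pos_imp_increasing[OF that(2)]) (use that D pos in \<open>meson less_le_trans\<close>)
  have mono': "F s \<le> F t" if "0 < s" "s \<le> t" for s t
    using mono[of s t] that by (cases "s = t") auto
  have pos': "0 < F s" if "0 < s" for s
  proof -
    have "0 \<le> F (s / 2)"
      by (rule tendsto_upperbound[OF L0 eventually_at_rightI[of 0 "s / 2"]])
        (use that in \<open>auto intro: mono'\<close>)
    with mono[of "s / 2" s] that show ?thesis by simp
  qed
  have less: "F s < (LINT s:{0..}|lborel. f s)" if "0 < s" for s
  proof -
    have "F (s + 1) \<le> (LINT s:{0..}|lborel. f s)"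
      by (rule tendsto_lowerbound[OF Linf eventually_at_top_linorderI[of "s + 1"]])
        (use that in \<open>auto intro: mono'\<close>)
    with mono[of s "s + 1"] that show ?thesis by simp
  qed
  show thesis by (rule that[OF D L0 Linf mono pos' less])
qed

text \<open>AM-GM for \<open>a\<close> and \<open>s * b\<close>. With \<open>a = T s\<close> and
  \<open>b = T' s\<close> the right-hand side is the derivative of \<open>sqrt (s * T s)\<close>,
  and the equality case becomes the differential equation \<open>T s = s * T' s\<close>.\<close>

lemma sqrt_le_mean_quotient:
  fixes a b s :: real
  assumes "0 < a" "0 < b" "0 < s"
  shows sqrt_le_mean_quotient_le: "sqrt b \<le> (a + s * b) / (2 * sqrt (s * a))"
    and sqrt_le_mean_quotient_eq: "sqrt b = (a + s * b) / (2 * sqrt (s * a)) \<Longrightarrow> a = s * b"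
proof -
  have *: "(sqrt a - sqrt (s * b))\<^sup>2 = (a + s * b) - sqrt b * (2 * sqrt (s * a))"
    using assms by (simp add: power2_diff real_sqrt_mult algebra_simps)
  have p: "0 < 2 * sqrt (s * a)" using assms by simp
  have "0 \<le> (sqrt a - sqrt (s * b))\<^sup>2" by simp
  then show "sqrt b \<le> (a + s * b) / (2 * sqrt (s * a))"
    using p unfolding * by (simp add: pos_le_divide_eq)
  assume "sqrt b = (a + s * b) / (2 * sqrt (s * a))"
  then have "(sqrt a - sqrt (s * b))\<^sup>2 = 0" unfolding * using p assms by (simp add: eq_divide_eq)
  then show "a = s * b" using assms by simp
qed

text \<open>Equals \<open>sqrt (pi / 2)\<close>. It is kept as an integral, since every estimate
  compares with this same integral.\<close>

definition gauss_half :: real where "gauss_half = (LINT s:{0..}|lborel. exp (- s\<^sup>2 / 2))"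

lemma integrable_exp_square:
  fixes c :: real
  assumes "0 < c"
  shows "integrable lborel (\<lambda>s. exp (- (c * s\<^sup>2)))"
proof -
  have "integrable lborel (\<lambda>s. sqrt (2 * pi * (sqrt (1 / (2 * c)))\<^sup>2) * normal_density 0 (sqrt (1 / (2 * c))) s)"
    using assms by (intro integrable_mult_right integrable_normal_density) simp
  then show ?thesis using assms by (simp add: normal_density_def field_simps)
qed

lemma integrable_exp_square_half: "integrable lborel (\<lambda>s::real. exp (- s\<^sup>2 / 2))"
  using integrable_exp_square[of "1/2"] by simp

text \<open>Transport with geometric means. The increasing map \<open>T\<close> carries
  \<open>f\<close>, rescaled to the mass of \<open>g\<close>, to \<open>g\<close>, and
  \<open>u s = sqrt (s * T s)\<close> is the geometric mean of a point and its image. Then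
  \<open>sqrt (B / A) * f s = sqrt (f s * g (T s)) * sqrt (T' s) \<le> exp (- (u s)\<^sup>2 / 2) *
  u' s\<close>, by the hypothesis at \<open>(s, T s)\<close> and by AM-GM; integration gives
  \<open>sqrt (A * B) \<le> gauss_half\<close>. Equality makes both estimates equalities at every
  point.\<close>

lemma half_line_santalo:
  fixes f g :: "real \<Rightarrow> real"
  assumes cf: "continuous_on UNIV f" and pf: "\<And>s. 0 < f s" and intf: "set_integrable lborel {0..} f"
    and cg: "continuous_on UNIV g" and pg: "\<And>s. 0 < g s" and intg: "set_integrable lborel {0..} g"
    and fg: "\<And>s t. 0 \<le> s \<Longrightarrow> 0 \<le> t \<Longrightarrow> f s * g t \<le> exp (- (s * t))"
  shows half_line_santalo_le:
      "(LINT s:{0..}|lborel. f s) * (LINT s:{0..}|lborel. g s) \<le> gauss_half\<^sup>2" (is ?le)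
    and half_line_santalo_eq:
      "(LINT s:{0..}|lborel. f s) * (LINT s:{0..}|lborel. g s) = gauss_half\<^sup>2 \<Longrightarrow>
       \<exists>a>0. \<exists>c>0. \<forall>s\<ge>0. f s = a * exp (- (c * s\<^sup>2) / 2) \<and> g s = exp (- s\<^sup>2 / (2 * c)) / a"
      (is "?eq \<Longrightarrow> ?conc")
proof -
  define A where "A = (LINT s:{0..}|lborel. f s)"
  define B where "B = (LINT s:{0..}|lborel. g s)"
  obtain F where F: "\<And>s. 0 < s \<Longrightarrow> (F has_real_derivative f s) (at s)"
    "(F \<longlongrightarrow> 0) (at_right 0)" "(F \<longlongrightarrow> A) at_top" "\<And>s t. 0 < s \<Longrightarrow> s < t \<Longrightarrow> F s < F t"
    "\<And>s. 0 < s \<Longrightarrow> 0 < F s" "\<And>s. 0 < s \<Longrightarrow> F s < A"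
    using primitive_from_zero[OF cf pf intf] unfolding A_def by blast
  obtain G where G: "\<And>s. 0 < s \<Longrightarrow> (G has_real_derivative g s) (at s)"
    "(G \<longlongrightarrow> 0) (at_right 0)" "(G \<longlongrightarrow> B) at_top" "\<And>s t. 0 < s \<Longrightarrow> s < t \<Longrightarrow> G s < G t"
    "\<And>s. 0 < s \<Longrightarrow> 0 < G s" "\<And>s. 0 < s \<Longrightarrow> G s < B"
    using primitive_from_zero[OF cg pg intg] unfolding B_def by blast
  have int_e: "set_integrable lborel {0..} (\<lambda>s::real. exp (- s\<^sup>2 / 2))"
    using integrable_mult_indicator[OF _ integrable_exp_square_half, of "{0..}"] by (simp add: set_integrable_def)
  have cont_e: "continuous_on UNIV (\<lambda>s::real. exp (- s\<^sup>2 / 2))" by (intro continuous_intros) auto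
  obtain E where E: "\<And>s. 0 < s \<Longrightarrow> (E has_real_derivative exp (- s\<^sup>2 / 2)) (at s)"
    "(E \<longlongrightarrow> 0) (at_right 0)" "(E \<longlongrightarrow> gauss_half) at_top" "\<And>s t. 0 < s \<Longrightarrow> s < t \<Longrightarrow> E s < E t"
    "\<And>s. 0 < s \<Longrightarrow> 0 < E s" "\<And>s. 0 < s \<Longrightarrow> E s < gauss_half"
    using primitive_from_zero[OF cont_e exp_gt_zero int_e] unfolding gauss_half_def by blast
  have Apos: "0 < A" using F(5,6)[of 1] by simp
  have Bpos: "0 < B" using G(5,6)[of 1] by simp
  have gpos: "0 < gauss_half" using E(5,6)[of 1] by simp
  \<comment> \<open>\<open>G\<close> maps the open half-line onto \<open>(0, B)\<close>; this
    provides the inverse \<open>H\<close> through which the transport map is defined.\<close>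
  have "\<exists>t>0. G t = p" if "0 < p" "p < B" for p
  proof -
    have "eventually (\<lambda>t. G t < p \<and> 0 < t) (at_right 0)"
      using order_tendstoD(2)[OF G(2) that(1)] by (simp add: eventually_conj eventually_at_right_less)
    then obtain a where a: "0 < a" "G a < p" by (metis (no_types, lifting) eventually_happens trivial_limit_at_right_real)
    have "eventually (\<lambda>t. p < G t \<and> a < t) at_top"
      using order_tendstoD(1)[OF G(3) that(2)] by (simp add: eventually_conj eventually_gt_at_top)
    then obtain b where b: "a < b" "p < G b" by (metis (no_types, lifting) eventually_happens trivial_limit_at_top_linorder)
    have "\<exists>t\<ge>a. t \<le> b \<and> G t = p"
      by (rule IVT) (use a b in \<open>auto intro!: DERIV_isCont[OF G(1)]\<close>)
    then obtain t where "a \<le> t" "G t = p" by blast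
    then show ?thesis using a(1) by (intro exI[of _ t]) auto
  qed
  then obtain H where H: "\<And>p. 0 < p \<Longrightarrow> p < B \<Longrightarrow> 0 < H p \<and> G (H p) = p" by metis
  have HG: "H (G t) = t" if "0 < t" for t
    using H[of "G t"] G(4)[of t "H (G t)"] G(4)[of "H (G t)" t] G(5,6)[OF that] that
    by (metis less_irrefl linorder_neqE_linordered_idom)
  have contH: "isCont H p" if "0 < p" "p < B" for p
  proof -
    have "isCont H (G (H p))"
      by (rule isCont_inverse_function2[of "H p / 2" _ "H p + 1"])
        (use H[OF that] in \<open>auto intro!: HG DERIV_isCont[OF G(1)]\<close>)
    then show ?thesis using H[OF that] by simp
  qed
  have derH: "(H has_real_derivative inverse (g (H p))) (at p)" if "0 < p" "p < B" for p
    by (rule DERIV_inverse_function[where f=G and a=0 and b=B])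
      (use that H G(1) pg contH in \<open>auto simp: less_imp_neq[symmetric]\<close>)
  define T where "T s = H (B / A * F s)" for s
  have BF: "0 < B / A * F s" "B / A * F s < B" if "0 < s" for s
    using F(5,6)[OF that] Apos Bpos by (auto simp: field_simps)
  have Tpos: "0 < T s" and GT: "G (T s) = B / A * F s" if "0 < s" for s
    using H[OF BF[OF that]] by (auto simp: T_def)
  have Tmono: "T s < T t" if "0 < s" "s < t" for s t
  proof -
    have "G (T s) < G (T t)" using GT[of s] GT[of t] F(4)[OF that] that Apos Bpos by (simp add: divide_strict_right_mono)
    then show ?thesis using G(4)[of "T t" "T s"] Tpos[of t] Tpos[of s] that
      by (metis less_asym' linorder_neqE_linordered_idom order_less_trans)
  qed
  define T' where "T' s = B / A * f s / g (T s)" for s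
  have derT: "(T has_real_derivative T' s) (at s)" if "0 < s" for s
  proof -
    have "((\<lambda>s. H (B / A * F s)) has_real_derivative inverse (g (H (B / A * F s))) * (B / A * f s)) (at s)"
      by (rule DERIV_chain2[where f=H, OF derH[OF BF[OF that]] DERIV_cmult[OF F(1)[OF that]]])
    then show ?thesis by (simp add: T_def[abs_def] T'_def field_simps)
  qed
  have T'pos: "0 < T' s" for s using pf pg Apos Bpos by (simp add: T'_def)
  define u where "u s = sqrt (s * T s)" for s
  define u' where "u' s = (T s + s * T' s) / (2 * sqrt (s * T s))" for s
  have upos: "0 < u s" if "0 < s" for s using Tpos[OF that] that by (simp add: u_def)
  have deru: "(u has_real_derivative u' s) (at s)" if "0 < s" for s
  proof -
    have 1: "((\<lambda>s. s * T s) has_real_derivative 1 * T s + T' s * s) (at s)"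
      by (rule DERIV_mult[OF DERIV_ident derT[OF that]])
    have 2: "(sqrt has_real_derivative inverse (sqrt (s * T s)) / 2) (at (s * T s))"
      using that Tpos[OF that] by (intro DERIV_real_sqrt) simp
    show ?thesis
      using DERIV_chain2[OF 2 1] by (simp add: u_def[abs_def] u'_def field_simps)
  qed
  \<comment> \<open>\<open>D\<close> is nondecreasing, with limit 0 at the origin and
    \<open>gauss_half - sqrt (A * B)\<close> at infinity. Comparing the two limits replaces a
    substitution in an improper integral.\<close>
  define D where "D s = E (u s) - sqrt (B / A) * F s" for s
  define D' where "D' s = exp (- (s * T s) / 2) * u' s - sqrt (B / A) * f s" for s
  have derD: "(D has_real_derivative D' s) (at s)" if "0 < s" for s
  proof -
    have "((\<lambda>s. E (u s)) has_real_derivative exp (- (u s)\<^sup>2 / 2) * u' s) (at s)"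
      by (rule DERIV_chain2[where f=E, OF E(1)[OF upos[OF that]] deru[OF that]])
    moreover have "(u s)\<^sup>2 = s * T s" using that Tpos[OF that] by (simp add: u_def)
    ultimately show ?thesis unfolding D_def[abs_def] D'_def
      by (auto intro!: DERIV_diff DERIV_cmult F that)
  qed
  have split: "sqrt (B / A) * f s = sqrt (f s * g (T s)) * sqrt (T' s)" for s
  proof -
    have "f s * g (T s) * T' s = (B / A) * (f s)\<^sup>2" using pg[of "T s"] by (simp add: T'_def power2_eq_square)
    then have "sqrt (f s * g (T s) * T' s) = sqrt (B / A) * f s"
      by (simp only: real_sqrt_mult real_sqrt_abs abs_of_pos[OF pf])
    then show ?thesis by (simp only: real_sqrt_mult)
  qed
  have s1: "sqrt (f s * g (T s)) \<le> exp (- (s * T s) / 2)" if "0 < s" for s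
  proof -
    have "f s * g (T s) \<le> (exp (- (s * T s) / 2))\<^sup>2"
      using fg[of s "T s"] that Tpos[OF that] by (simp add: exp_double[symmetric])
    then show ?thesis by (simp add: real_le_lsqrt pf pg less_imp_le)
  qed
  have s2: "sqrt (T' s) \<le> u' s" if "0 < s" for s
    unfolding u'_def by (rule sqrt_le_mean_quotient_le) (use that Tpos T'pos in auto)
  have D'nn: "0 \<le> D' s" if "0 < s" for s
    unfolding D'_def split using mult_mono[OF s1[OF that] s2[OF that]] T'pos[of s] by (simp add: less_imp_le)
  have Dmono: "D s \<le> D t" if "0 < s" "s \<le> t" for s t
    by (rule DERIV_nonneg_imp_nondecreasing[OF that(2)])
      (use that derD D'nn in \<open>meson less_le_trans\<close>)
  \<comment> \<open>Since \<open>T\<close> increases, \<open>u s\<close> is at most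
    \<open>sqrt (s * T 1)\<close> for \<open>s < 1\<close> and at least that for
    \<open>s > 1\<close>; this yields both limits of \<open>u\<close>.\<close>
  have u0: "(u \<longlongrightarrow> 0) (at_right 0)"
  proof (rule tendsto_sandwich[where f="\<lambda>_. 0" and h="\<lambda>s. sqrt (s * T 1)"])
    have "((\<lambda>s. sqrt (s * T 1)) \<longlongrightarrow> sqrt (0 * T 1)) (at_right 0)" by (intro tendsto_intros)
    then show "((\<lambda>s. sqrt (s * T 1)) \<longlongrightarrow> 0) (at_right 0)" by simp
    show "eventually (\<lambda>s. 0 \<le> u s) (at_right 0)"
      by (rule eventually_at_rightI[of 0 1]) (auto intro: less_imp_le upos)
    show "eventually (\<lambda>s. u s \<le> sqrt (s * T 1)) (at_right 0)"
      by (rule eventually_at_rightI[of 0 1]) (auto simp: u_def intro!: mult_left_mono less_imp_le[OF Tmono])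
  qed simp
  have "filterlim u (at_right 0) (at_right 0)"
    using u0 by (auto simp: filterlim_at intro!: eventually_at_rightI[of 0 1] upos less_imp_neq[symmetric])
  then have Eu0: "((\<lambda>s. E (u s)) \<longlongrightarrow> 0) (at_right 0)" by (rule filterlim_compose[OF E(2)])
  have uinf: "filterlim u at_top at_top"
  proof (rule filterlim_at_top_mono)
    have "filterlim (\<lambda>s. s * T 1) at_top at_top"
      using Tpos[of 1] by (intro filterlim_at_top_mult_tendsto_pos[where c="T 1"] filterlim_ident tendsto_const) auto
    then show "filterlim (\<lambda>s. sqrt (s * T 1)) at_top at_top" by (rule filterlim_compose[OF sqrt_at_top])
    show "eventually (\<lambda>s. sqrt (s * T 1) \<le> u s) at_top"
      by (rule eventually_at_top_linorderI[of 2]) (auto simp: u_def intro!: mult_left_mono less_imp_le[OF Tmono])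
  qed
  have Euinf: "((\<lambda>s. E (u s)) \<longlongrightarrow> gauss_half) at_top" by (rule filterlim_compose[OF E(3) uinf])
  have D0: "(D \<longlongrightarrow> 0 - sqrt (B / A) * 0) (at_right 0)"
    unfolding D_def by (intro tendsto_intros Eu0 F)
  have "sqrt (B / A) * A = sqrt (A * B)"
    using Apos Bpos by (intro real_sqrt_unique[symmetric]) (auto simp: power_mult_distrib, simp add: power2_eq_square)
  then have Dinf: "(D \<longlongrightarrow> gauss_half - sqrt (A * B)) at_top"
    using tendsto_diff[OF Euinf tendsto_mult[OF tendsto_const[of "sqrt (B / A)"] F(3)]] by (simp add: D_def[abs_def])
  have Dnn: "0 \<le> D s" if "0 < s" for s
    using tendsto_upperbound[OF D0 eventually_at_rightI[of 0 s]] that Dmono by auto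
  have Dle: "D s \<le> gauss_half - sqrt (A * B)" if "0 < s" for s
    using tendsto_lowerbound[OF Dinf eventually_at_top_linorderI[of s]] that Dmono by auto
  have le: "sqrt (A * B) \<le> gauss_half" using Dnn[of 1] Dle[of 1] by simp
  then show ?le
    unfolding A_def[symmetric] B_def[symmetric] using Apos Bpos
    by (metis mult_pos_pos sqrt_le_D)
  assume ?eq
  then have "sqrt (A * B) = gauss_half" unfolding A_def B_def using gpos by simp
  then have "D s = 0" if "0 < s" for s using Dnn Dle that by force
  then have D'0: "D' s = 0" if "0 < s" for s
  proof -
    have "(D has_real_derivative 0) (at s)"
      by (rule has_field_derivative_transform_within_open[of "\<lambda>_. 0" _ _ "{0<..}"])
        (use \<open>\<And>s. 0 < s \<Longrightarrow> D s = 0\<close> that in auto)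
    then show ?thesis using derD[OF that] DERIV_unique by blast
  qed
  have e2: "sqrt (T' s) = u' s" and e1: "sqrt (f s * g (T s)) = exp (- (s * T s) / 2)" if "0 < s" for s
  proof -
    have *: "sqrt (f s * g (T s)) * sqrt (T' s) = exp (- (s * T s) / 2) * u' s"
      using D'0[OF that] unfolding D'_def split by simp
    have p: "0 < sqrt (f s * g (T s))" "0 < sqrt (T' s)" using pf pg T'pos by auto
    show "sqrt (T' s) = u' s"
    proof (rule ccontr)
      assume "\<not> ?thesis"
      then have "sqrt (T' s) < u' s" using s2[OF that] by simp
      then have "sqrt (f s * g (T s)) * sqrt (T' s) < exp (- (s * T s) / 2) * u' s"
        using s1[OF that] p by (intro mult_le_less_imp_less) auto
      with * show False by simp
    qed
    then show "sqrt (f s * g (T s)) = exp (- (s * T s) / 2)" using * p by simp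
  qed
  have Teq: "T s = s * T' s" if "0 < s" for s
    by (rule sqrt_le_mean_quotient_eq) (use that Tpos T'pos e2[OF that] in \<open>auto simp: u'_def\<close>)
  define c where "c = T 1"
  have c: "0 < c" using Tpos[of 1] by (simp add: c_def)
  \<comment> \<open>Equality in AM-GM says exactly that the derivative of \<open>T s / s\<close>
    vanishes, so \<open>T\<close> is linear.\<close>
  have "(\<lambda>s. T s / s) constant_on {0<..}"
  proof (rule has_field_derivative_0_imp_constant_on)
    fix s :: real assume "s \<in> {0<..}"
    then have "((\<lambda>s. T s / s) has_real_derivative (T' s * s - T s * 1) / (s * s)) (at s)"
      by (intro DERIV_divide derT DERIV_ident) auto
    then show "((\<lambda>s. T s / s) has_real_derivative 0) (at s)" using Teq[of s] \<open>s \<in> _\<close> by (simp add: mult.commute)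
  qed auto
  then obtain k where "\<And>s. 0 < s \<Longrightarrow> T s / s = k" by (auto simp: constant_on_def)
  from this[of 1] this have Tc: "T s = c * s" if "0 < s" for s using that unfolding c_def by (simp add: field_simps)
  have T'c: "T' s = c" if "0 < s" for s using Teq[OF that] Tc[OF that] that by (simp add: mult.commute)
  \<comment> \<open>With \<open>T s = c * s\<close>, the two equalities read
    \<open>f s * g (c * s) = exp (- c * s\<^sup>2)\<close> and
    \<open>B * f s = c * A * g (c * s)\<close>. Eliminating \<open>g\<close> leaves
    \<open>(f s)\<^sup>2 = c * A / B * exp (- c * s\<^sup>2)\<close>, whence this constant.\<close>
  define a where "a = sqrt (c * A / B)"
  have a: "0 < a" using c Apos Bpos by (simp add: a_def)
  have fs: "f s = a * exp (- (c * s\<^sup>2) / 2)" and gs: "g (c * s) = exp (- (c * s\<^sup>2) / 2) / a" if "0 < s" for s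
  proof -
    have "sqrt (f s * g (T s)) = exp (- (c * s\<^sup>2) / 2)" using e1[OF that] Tc[OF that] by (simp add: power2_eq_square mult_ac)
    then have 1: "f s * g (c * s) = (exp (- (c * s\<^sup>2) / 2))\<^sup>2"
      using Tc[OF that] pf pg by (metis less_imp_le mult_pos_pos real_sqrt_pow2)
    have 2: "B * f s = c * A * g (c * s)"
      using T'c[OF that] pg[of "c * s"] Apos unfolding T'_def Tc[OF that] by (simp add: field_simps)
    have "(f s)\<^sup>2 = f s * g (c * s) * (c * A / B)" using 2 Bpos by (simp add: power2_eq_square field_simps)
    also have "\<dots> = (a * exp (- (c * s\<^sup>2) / 2))\<^sup>2"
      unfolding 1 using c Apos Bpos by (simp add: a_def power_mult_distrib)
    finally show *: "f s = a * exp (- (c * s\<^sup>2) / 2)"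
      using pf[of s] a by (metis less_imp_le mult_pos_pos exp_gt_zero power2_eq_iff_nonneg)
    show "g (c * s) = exp (- (c * s\<^sup>2) / 2) / a"
      using 1 a unfolding * by (simp add: power2_eq_square field_simps)
  qed
  have gs': "g t = exp (- t\<^sup>2 / (2 * c)) / a" if "0 < t" for t
    using gs[of "t / c"] that c by (simp add: power2_eq_square)
  \<comment> \<open>The transport lives on the open half-line; the endpoint 0 is reached by
    continuity.\<close>
  have ext: "h 0 = k 0" if "continuous_on UNIV h" "continuous_on UNIV k" "\<And>s. 0 < s \<Longrightarrow> h s = k s"
    for h k :: "real \<Rightarrow> real"
  proof -
    have "(h \<longlongrightarrow> h 0) (at_right 0)" "(k \<longlongrightarrow> k 0) (at_right 0)"
      using that(1,2) by (auto simp: continuous_on_def intro: filterlim_mono[OF _ order_refl at_le])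
    moreover have "eventually (\<lambda>s. h s = k s) (at_right 0)"
      by (rule eventually_at_rightI[of 0 1]) (auto intro: that)
    ultimately have "(k \<longlongrightarrow> h 0) (at_right 0)" "(k \<longlongrightarrow> k 0) (at_right 0)"
      by (auto simp: tendsto_cong)
    then show ?thesis by (rule tendsto_unique[OF trivial_limit_at_right_real])
  qed
  have "f 0 = a * exp (- (c * 0\<^sup>2) / 2)" by (rule ext[OF cf _ fs]) (auto intro!: continuous_intros)
  moreover have "g 0 = exp (- 0\<^sup>2 / (2 * c)) / a"
    by (rule ext[OF cg _ gs']) (use a c in \<open>auto intro!: continuous_intros\<close>)
  ultimately have "\<forall>s\<ge>0. f s = a * exp (- (c * s\<^sup>2) / 2) \<and> g s = exp (- s\<^sup>2 / (2 * c)) / a"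
    using fs gs' by (auto simp: le_less)
  then show ?conc using a c by blast
qed

section \<open>Resampling one coordinate\<close>

text \<open>The lines parallel to an axis are handled inside the same space, as
  \<open>s \<mapsto> upd i x s\<close>; any point \<open>x\<close> of the line may serve as its
  label, so no space of dimension one less is introduced.\<close>

definition upd :: "'n \<Rightarrow> real ^ 'n \<Rightarrow> real \<Rightarrow> real ^ 'n" where
  "upd i x s = (\<chi> j. if j = i then s else x $ j)"

lemma upd_nth [simp]: "upd i x s $ j = (if j = i then s else x $ j)"
  by (simp add: upd_def)

lemma upd_same [simp]: "upd i x (x $ i) = x"
  by (simp add: vec_eq_iff)

lemma upd_upd [simp]: "upd i (upd i x s) t = upd i x t"
  by (simp add: vec_eq_iff)

lemma continuous_on_upd [continuous_intros]:
  "continuous_on A f \<Longrightarrow> continuous_on A g \<Longrightarrow> continuous_on A (\<lambda>z. upd i (f z) (g z))"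
  unfolding upd_def
proof (intro continuous_on_vec_lambda)
  fix j
  assume "continuous_on A f" "continuous_on A g"
  then show "continuous_on A (\<lambda>z. if j = i then g z else f z $ j)"
    by (cases "j = i") (auto intro!: continuous_intros)
qed

lemma measurable_upd [measurable (raw)]:
  assumes "f \<in> borel_measurable M" "g \<in> borel_measurable M"
  shows "(\<lambda>z. upd i (f z) (g z)) \<in> borel_measurable M"
proof -
  have "(\<lambda>p. upd i (fst p) (snd p)) \<in> borel_measurable (borel \<Otimes>\<^sub>M borel)"
    unfolding borel_prod by (intro borel_measurable_continuous_onI continuous_intros)
  then show ?thesis
    using measurable_compose[OF measurable_Pair[OF assms], of "\<lambda>p. upd i (fst p) (snd p)" borel] by simp
qed

lemma upd_eq: "upd i x s = x + (s - x $ i) *\<^sub>R axis i 1"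
  by (simp add: vec_eq_iff axis_def)

lemma inner_upd_upd: "upd i x s \<bullet> upd i y t = upd i x 0 \<bullet> upd i y 0 + s * t"
proof -
  have "(\<Sum>j\<in>UNIV. upd i x s $ j * upd i y t $ j) =
        (\<Sum>j\<in>UNIV. upd i x 0 $ j * upd i y 0 $ j + (if j = i then s * t else 0))"
    by (rule sum.cong) auto
  also have "\<dots> = (\<Sum>j\<in>UNIV. upd i x 0 $ j * upd i y 0 $ j) + s * t"
    by (simp add: sum.distrib)
  finally show ?thesis by (simp add: inner_vec_def)
qed

lemma norm_upd: "(norm (upd i x s))\<^sup>2 = (norm (upd i x 0))\<^sup>2 + s\<^sup>2"
  using inner_upd_upd[of i x s x s] by (simp add: dot_square_norm power2_eq_square)

text \<open>Exchanging \<open>x $ i\<close> with an extra real variable preserves Lebesgue measure, because boxes go to boxes.\<close>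

lemma lborel_swap_coordinate:
  "distr (lborel \<Otimes>\<^sub>M lborel) (borel \<Otimes>\<^sub>M borel) (\<lambda>(x :: real ^ 'n, s). (upd i x s, x $ i)) = lborel \<Otimes>\<^sub>M lborel"
    (is "distr _ _ ?h = _")
proof -
  have [measurable]: "?h \<in> borel \<Otimes>\<^sub>M borel \<rightarrow>\<^sub>M borel \<Otimes>\<^sub>M borel"
    unfolding borel_prod case_prod_beta by (intro borel_measurable_continuous_onI continuous_intros)
  have box: "emeasure lborel (box l u) = (\<Prod>j\<in>UNIV. ennreal (u $ j - l $ j))"
    if "\<And>j. l $ j \<le> u $ j" for l u :: "real ^ 'n"
  proof -
    have "(\<Prod>b\<in>Basis. (u - l) \<bullet> b) = (\<Prod>j\<in>UNIV. u $ j - l $ j)"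
      unfolding Basis_vec_def
      by (subst prod.UNION_disjoint) (auto simp: axis_eq_axis inner_axis)
    then show ?thesis using that
      by (subst emeasure_lborel_box) (auto simp: Basis_vec_def inner_axis prod_ennreal)
  qed
  have box_Pair: "box (a, b) (c, d) = box a c \<times> box b d" for a c :: "real ^ 'n" and b d :: real
    by (auto simp: box_def Basis_prod_def)
  have "lborel = distr (lborel \<Otimes>\<^sub>M lborel) (borel \<Otimes>\<^sub>M borel) ?h"
  proof (rule lborel_eqI)
    fix L U :: "(real ^ 'n) \<times> real"
    assume LU: "\<And>b. b \<in> Basis \<Longrightarrow> L \<bullet> b \<le> U \<bullet> b"
    obtain l a u b where eq: "L = (l, a)" "U = (u, b)" by (metis surj_pair)
    have lu: "l $ j \<le> u $ j" for j
      using LU[of "(axis j 1, 0)"] by (simp add: eq Basis_prod_def inner_axis axis_in_Basis_iff)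
    have ab: "a \<le> b" using LU[of "(0, 1)"] by (simp add: eq Basis_prod_def)
    have pre: "?h -` box L U \<inter> space (lborel \<Otimes>\<^sub>M lborel) = box (upd i l a) (upd i u b) \<times> box (l $ i) (u $ i)"
      by (auto simp: eq box_Pair mem_box_cart space_pair_measure split: if_splits)
    have meas: "box L U \<in> sets (borel \<Otimes>\<^sub>M borel)" by (subst borel_prod) (rule borel_open, rule open_box)
    have "emeasure (distr (lborel \<Otimes>\<^sub>M lborel) (borel \<Otimes>\<^sub>M borel) ?h) (box L U) =
          emeasure lborel (box (upd i l a) (upd i u b)) * emeasure lborel (box (l $ i) (u $ i))"
      by (subst emeasure_distr) (auto simp: meas pre lborel.emeasure_pair_measure_Times)
    also have "\<dots> = (\<Prod>j\<in>UNIV. ennreal (upd i u b $ j - upd i l a $ j)) * ennreal (u $ i - l $ i)"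
      using lu ab by (subst box) (auto simp: box_real)
    also have "(\<Prod>j\<in>UNIV. ennreal (upd i u b $ j - upd i l a $ j)) =
        ennreal (b - a) * (\<Prod>j\<in>UNIV - {i}. ennreal (u $ j - l $ j))"
      by (subst prod.remove[of UNIV i]) auto
    also have "\<dots> * ennreal (u $ i - l $ i) = (\<Prod>j\<in>UNIV. ennreal (u $ j - l $ j)) * ennreal (b - a)"
      by (subst prod.remove[of UNIV i]) (auto simp: mult_ac)
    also have "\<dots> = emeasure (lborel \<Otimes>\<^sub>M lborel) (box l u \<times> box a b)"
      using lu ab by (subst lborel.emeasure_pair_measure_Times) (auto simp: box)
    also have "\<dots> = emeasure lborel (box L U)" by (simp add: lborel_prod box_Pair eq)
    also have "\<dots> = (\<Prod>b\<in>Basis. (U - L) \<bullet> b)" using LU by (rule emeasure_lborel_box)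
    finally show "emeasure (distr (lborel \<Otimes>\<^sub>M lborel) (borel \<Otimes>\<^sub>M borel) ?h) (box L U) = (\<Prod>b\<in>Basis. (U - L) \<bullet> b)" .
  qed (simp add: borel_prod)
  then show ?thesis by (simp add: lborel_prod)
qed

text \<open>Fubini along the lines parallel to an axis. The inner integral does not depend on
  \<open>x $ i\<close>, so integrating it over the whole space would count every line infinitely
  often; the probability density \<open>r\<close> in that coordinate corrects this. The proof
  applies the coordinate swap to the double integral of \<open>r s * h x\<close>.\<close>

lemma nn_integral_resample:
  fixes h :: "real ^ 'n \<Rightarrow> ennreal" and r :: "real \<Rightarrow> ennreal"
  assumes [measurable]: "h \<in> borel_measurable borel" "r \<in> borel_measurable borel"
    and r: "(\<integral>\<^sup>+s. r s \<partial>lborel) = 1"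
  shows "(\<integral>\<^sup>+x. r (x $ i) * (\<integral>\<^sup>+s. h (upd i x s) \<partial>lborel) \<partial>lborel) = (\<integral>\<^sup>+x. h x \<partial>lborel)"
proof -
  have [measurable]: "(\<lambda>x. x $ i) \<in> borel_measurable borel"
    by (intro borel_measurable_continuous_onI continuous_intros)
  have [measurable]: "(\<lambda>(x :: real ^ 'n, s). (upd i x s, x $ i)) \<in> borel \<Otimes>\<^sub>M borel \<rightarrow>\<^sub>M borel \<Otimes>\<^sub>M borel"
    by measurable
  have "(\<integral>\<^sup>+x. r (x $ i) * (\<integral>\<^sup>+s. h (upd i x s) \<partial>lborel) \<partial>lborel) =
        (\<integral>\<^sup>+x. (\<integral>\<^sup>+s. r (x $ i) * h (upd i x s) \<partial>lborel) \<partial>lborel)"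
    by (intro nn_integral_cong nn_integral_cmult[symmetric]) measurable
  also have "\<dots> = (\<integral>\<^sup>+(x, s). r (x $ i) * h (upd i x s) \<partial>(lborel \<Otimes>\<^sub>M lborel))"
    by (subst lborel.nn_integral_fst[symmetric]) (auto intro!: nn_integral_cong simp: case_prod_beta)
  also have "\<dots> = (\<integral>\<^sup>+(x, s). r s * h x
      \<partial>distr (lborel \<Otimes>\<^sub>M lborel) (borel \<Otimes>\<^sub>M borel) (\<lambda>(x :: real ^ 'n, s). (upd i x s, x $ i)))"
    by (subst nn_integral_distr) (auto simp: case_prod_unfold)
  also have "\<dots> = (\<integral>\<^sup>+x. (\<integral>\<^sup>+s. r s * h x \<partial>lborel) \<partial>lborel)"
    by (subst lborel_swap_coordinate, subst lborel.nn_integral_fst[symmetric]) (auto simp: case_prod_beta)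
  also have "\<dots> = (\<integral>\<^sup>+x. h x \<partial>lborel)"
    by (simp add: nn_integral_multc r)
  finally show ?thesis .
qed

lemma integral_resample:
  fixes h :: "real ^ 'n \<Rightarrow> real" and r :: "real \<Rightarrow> real"
  assumes h: "integrable lborel h" and r: "integrable lborel r" "(LINT s|lborel. r s) = 1"
  shows "(LINT x|lborel. r (x $ i) * (LINT s|lborel. h (upd i x s))) = (LINT x|lborel. h x)"
proof -
  have [measurable]: "h \<in> borel_measurable borel" "r \<in> borel_measurable borel"
    using h r(1) by (auto dest: borel_measurable_integrable)
  have [measurable]: "(\<lambda>x. x $ i) \<in> borel_measurable borel"
    by (intro borel_measurable_continuous_onI continuous_intros)
  have [measurable]: "(\<lambda>(x :: real ^ 'n, s). (upd i x s, x $ i)) \<in> borel \<Otimes>\<^sub>M borel \<rightarrow>\<^sub>M borel \<Otimes>\<^sub>M borel"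
    by measurable
  have int: "integrable (lborel \<Otimes>\<^sub>M lborel) (\<lambda>(x, s). h x * r s)"
  proof (rule lborel_pair.Fubini_integrable)
    show "integrable lborel (\<lambda>x. LINT s|lborel. norm (case (x, s) of (x, s) \<Rightarrow> h x * r s))"
      using h by (simp add: abs_mult)
    show "AE x in lborel. integrable lborel (\<lambda>s. case (x, s) of (x, s) \<Rightarrow> h x * r s)"
      using r by simp
  qed measurable
  have "integrable (distr (lborel \<Otimes>\<^sub>M lborel) (borel \<Otimes>\<^sub>M borel)
          (\<lambda>(x :: real ^ 'n, s). (upd i x s, x $ i))) (\<lambda>(x, s). h x * r s)"
    unfolding lborel_swap_coordinate by (rule int)
  then have int': "integrable (lborel \<Otimes>\<^sub>M lborel) (\<lambda>(x, s). h (upd i x s) * r (x $ i))"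
    by (subst (asm) integrable_distr_eq) (auto simp: split_beta')
  have "(LINT x|lborel. r (x $ i) * (LINT s|lborel. h (upd i x s))) =
        (LINT x|lborel. LINT s|lborel. h (upd i x s) * r (x $ i))"
    by (simp add: mult.commute)
  also have "\<dots> = (LINT (x, s)|(lborel \<Otimes>\<^sub>M lborel). h (upd i x s) * r (x $ i))"
    by (rule lborel_pair.integral_fst[OF int'])
  also have "\<dots> = (LINT (x, s)|distr (lborel \<Otimes>\<^sub>M lborel) (borel \<Otimes>\<^sub>M borel)
      (\<lambda>(x :: real ^ 'n, s). (upd i x s, x $ i)). h x * r s)"
    by (subst integral_distr) (auto simp: split_beta')
  also have "\<dots> = (LINT x|lborel. LINT s|lborel. h x * r s)"
    unfolding lborel_swap_coordinate by (rule lborel_pair.integral_fst[OF int, symmetric])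
  also have "\<dots> = (LINT x|lborel. h x)" by (simp add: r)
  finally show ?thesis .
qed

lemma ex_density: "\<exists>r :: real \<Rightarrow> ennreal. r \<in> borel_measurable borel \<and> (\<integral>\<^sup>+s. r s \<partial>lborel) = 1"
  by (intro exI[of _ "indicator {0..1}"]) auto

lemma nn_integral_translate:
  fixes h :: "'a::euclidean_space \<Rightarrow> ennreal"
  assumes "h \<in> borel_measurable borel"
  shows "(\<integral>\<^sup>+x. h (c + x) \<partial>lborel) = (\<integral>\<^sup>+x. h x \<partial>lborel)"
  using assms by (subst (2) lborel_distr_plus[of c, symmetric], subst nn_integral_distr) auto

text \<open>A shear moves each line parallel to the \<open>i\<close>-th axis, or each hyperplane \<open>x $ i = s\<close>, by a translation.\<close>

lemma lborel_shear:
  fixes v :: "real ^ 'n"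
  assumes v: "v $ i = 0"
  shows "distr lborel borel (\<lambda>x. x + (x $ i) *\<^sub>R v) = lborel"
    and "distr lborel borel (\<lambda>x. x - (v \<bullet> x) *\<^sub>R axis i 1) = lborel"
proof -
  have nth[measurable]: "(\<lambda>x. x $ i) \<in> borel_measurable borel"
    by (intro borel_measurable_continuous_onI continuous_intros)
  obtain r :: "real \<Rightarrow> ennreal" where r[measurable]: "r \<in> borel_measurable borel" and r1: "(\<integral>\<^sup>+s. r s \<partial>lborel) = 1"
    using ex_density by blast
  have eqI: "distr lborel borel S = lborel"
    if [measurable]: "S \<in> borel_measurable borel"
      and "\<And>h. h \<in> borel_measurable borel \<Longrightarrow> (\<integral>\<^sup>+x. h (S x) \<partial>lborel) = (\<integral>\<^sup>+x. h x \<partial>lborel)"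
    for S :: "real ^ 'n \<Rightarrow> real ^ 'n"
  proof (rule measure_eqI)
    fix A assume "A \<in> sets (distr lborel borel S)"
    then have [measurable]: "A \<in> sets borel" by simp
    have "emeasure (distr lborel borel S) A = (\<integral>\<^sup>+x. indicator A (S x) \<partial>lborel)"
      by (subst nn_integral_indicator[symmetric], simp, subst nn_integral_distr) auto
    also have "\<dots> = (\<integral>\<^sup>+x. indicator A x \<partial>lborel)" by (rule that(2)) simp
    finally show "emeasure (distr lborel borel S) A = emeasure lborel A" by simp
  qed simp
  show "distr lborel borel (\<lambda>x. x + (x $ i) *\<^sub>R v) = lborel"
  proof (rule eqI)
    fix h :: "real ^ 'n \<Rightarrow> ennreal" assume h[measurable]: "h \<in> borel_measurable borel"
    have "(\<integral>\<^sup>+x. h (x + (x $ i) *\<^sub>R v) \<partial>lborel) =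
          (\<integral>\<^sup>+x. r (x $ i) * (\<integral>\<^sup>+s. h (upd i x s + s *\<^sub>R v) \<partial>lborel) \<partial>lborel)"
      by (subst nn_integral_resample[of _ r i, symmetric]) (auto simp: r1)
    also have "\<dots> = (\<integral>\<^sup>+x. (\<integral>\<^sup>+s. r (x $ i) * h (upd i x s + s *\<^sub>R v) \<partial>lborel) \<partial>lborel)"
      by (intro nn_integral_cong nn_integral_cmult[symmetric]) measurable
    also have "\<dots> = (\<integral>\<^sup>+s. (\<integral>\<^sup>+x. r (x $ i) * h (upd i x s + s *\<^sub>R v) \<partial>lborel) \<partial>lborel)"
      by (rule lborel_pair.Fubini') measurable
    \<comment> \<open>For fixed \<open>s\<close> the shear is a translation by
      \<open>s *\<^sub>R v\<close>, and since \<open>v $ i = 0\<close> this translation does not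
      affect the weight \<open>r (x $ i)\<close>.\<close>
    also have "\<dots> = (\<integral>\<^sup>+s. (\<integral>\<^sup>+x. r ((s *\<^sub>R v + x) $ i) * h (upd i (s *\<^sub>R v + x) s) \<partial>lborel) \<partial>lborel)"
    proof (intro nn_integral_cong)
      fix s :: real and x :: "real ^ 'n"
      have "upd i x s + s *\<^sub>R v = upd i (s *\<^sub>R v + x) s" using v by (simp add: vec_eq_iff)
      then show "r (x $ i) * h (upd i x s + s *\<^sub>R v) = r ((s *\<^sub>R v + x) $ i) * h (upd i (s *\<^sub>R v + x) s)"
        using v by simp
    qed
    also have "\<dots> = (\<integral>\<^sup>+s. (\<integral>\<^sup>+x. r (x $ i) * h (upd i x s) \<partial>lborel) \<partial>lborel)"
      by (intro nn_integral_cong nn_integral_translate[of "\<lambda>x. r (x $ i) * h (upd i x _)"]) measurable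
    also have "\<dots> = (\<integral>\<^sup>+x. (\<integral>\<^sup>+s. r (x $ i) * h (upd i x s) \<partial>lborel) \<partial>lborel)"
      by (rule lborel_pair.Fubini'[symmetric]) measurable
    also have "\<dots> = (\<integral>\<^sup>+x. r (x $ i) * (\<integral>\<^sup>+s. h (upd i x s) \<partial>lborel) \<partial>lborel)"
      by (intro nn_integral_cong nn_integral_cmult) measurable
    also have "\<dots> = (\<integral>\<^sup>+x. h x \<partial>lborel)" by (intro nn_integral_resample r1 h r)
    finally show "(\<integral>\<^sup>+x. h (x + (x $ i) *\<^sub>R v) \<partial>lborel) = (\<integral>\<^sup>+x. h x \<partial>lborel)" .
  qed measurable
  show "distr lborel borel (\<lambda>x. x - (v \<bullet> x) *\<^sub>R axis i 1) = lborel"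
  proof (rule eqI)
    fix h :: "real ^ 'n \<Rightarrow> ennreal" assume h[measurable]: "h \<in> borel_measurable borel"
    have eq: "upd i x s - (v \<bullet> upd i x s) *\<^sub>R axis i 1 = upd i x (- (v \<bullet> x) + s)" for x s
    proof -
      have "v \<bullet> upd i x s = v \<bullet> x" unfolding upd_eq using v by (simp add: inner_add_right inner_axis)
      then show ?thesis by (simp add: vec_eq_iff axis_def)
    qed
    have "(\<integral>\<^sup>+x. h (x - (v \<bullet> x) *\<^sub>R axis i 1) \<partial>lborel) =
          (\<integral>\<^sup>+x. r (x $ i) * (\<integral>\<^sup>+s. h (upd i x (- (v \<bullet> x) + s)) \<partial>lborel) \<partial>lborel)"
      by (subst nn_integral_resample[of _ r i, symmetric]) (auto simp: r1 eq)
    also have "\<dots> = (\<integral>\<^sup>+x. r (x $ i) * (\<integral>\<^sup>+s. h (upd i x s) \<partial>lborel) \<partial>lborel)"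
      by (subst nn_integral_translate[of "\<lambda>s. h (upd i _ s)"]) measurable
    also have "\<dots> = (\<integral>\<^sup>+x. h x \<partial>lborel)" by (intro nn_integral_resample r1 h r)
    finally show "(\<integral>\<^sup>+x. h (x - (v \<bullet> x) *\<^sub>R axis i 1) \<partial>lborel) = (\<integral>\<^sup>+x. h x \<partial>lborel)" .
  qed measurable
qed

section \<open>Layer-cake formulas and polar coordinates\<close>

lemma measurable_nth [measurable]: "(\<lambda>x :: real ^ 'n. x $ i) \<in> borel_measurable borel"
  by (intro borel_measurable_continuous_onI continuous_intros)

lemma nn_integral_scale:
  fixes h :: "'a::euclidean_space \<Rightarrow> ennreal"
  assumes [measurable]: "h \<in> borel_measurable borel" and t: "0 < t"
  shows "(\<integral>\<^sup>+x. h x \<partial>lborel) = ennreal (t ^ DIM('a)) * (\<integral>\<^sup>+x. h (t *\<^sub>R x) \<partial>lborel)"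
proof -
  have "(\<integral>\<^sup>+x. h x \<partial>lborel) = (\<integral>\<^sup>+x. h x \<partial>density (distr lborel borel (\<lambda>x. 0 + t *\<^sub>R x)) (\<lambda>_. \<bar>t\<bar> ^ DIM('a)))"
    using t by (subst lborel_affine[of t 0, symmetric]) auto
  also have "\<dots> = (\<integral>\<^sup>+x. ennreal (t ^ DIM('a)) * h (t *\<^sub>R x) \<partial>lborel)"
    using t by (subst nn_integral_density, simp, simp, subst nn_integral_distr) auto
  also have "\<dots> = ennreal (t ^ DIM('a)) * (\<integral>\<^sup>+x. h (t *\<^sub>R x) \<partial>lborel)"
    by (rule nn_integral_cmult) simp
  finally show ?thesis .
qed

lemma nn_integral_exp_tail:
  fixes a :: real
  assumes "0 \<le> a"
  shows "(\<integral>\<^sup>+s. ennreal (s * exp (- s\<^sup>2 / 2)) * indicator {a..} s \<partial>lborel) = ennreal (exp (- a\<^sup>2 / 2))"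
proof -
  have "((\<lambda>s::real. - exp (- s\<^sup>2 / 2)) \<longlongrightarrow> 0) at_top"
    by real_asymp
  then have "(\<integral>\<^sup>+s. ennreal (s * exp (- s\<^sup>2 / 2)) * indicator {a..} s \<partial>lborel) = ennreal (0 - (- exp (- a\<^sup>2 / 2)))"
    using assms
    by (intro nn_integral_FTC_atLeast)
      (auto intro!: derivative_eq_intros simp: field_simps)
  then show ?thesis by simp
qed

text \<open>Layer-cake: write \<open>exp (- p\<^sup>2 / 2)\<close> as the integral of \<open>s exp (- s\<^sup>2 / 2)\<close> over \<open>s \<ge> p\<close> and rescale.\<close>

lemma nn_integral_gauge_gaussian:
  fixes p :: "'a::euclidean_space \<Rightarrow> real" and h :: "'a \<Rightarrow> real"
  assumes p[measurable]: "p \<in> borel_measurable borel" and h[measurable]: "h \<in> borel_measurable borel"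
    and p0: "\<And>x. 0 \<le> p x" and h0: "\<And>x. 0 \<le> h x"
    and pt: "\<And>t x. 0 < t \<Longrightarrow> p (t *\<^sub>R x) = t * p x"
    and ht: "\<And>t x. 0 < t \<Longrightarrow> h (t *\<^sub>R x) = t ^ d * h x"
  shows "(\<integral>\<^sup>+x. ennreal (h x * exp (- (p x)\<^sup>2 / 2)) \<partial>lborel) =
    (\<integral>\<^sup>+s. ennreal (s ^ (DIM('a) + d + 1) * exp (- s\<^sup>2 / 2)) * indicator {0<..} s \<partial>lborel) *
    (\<integral>\<^sup>+x. ennreal (h x) * indicator {x. p x \<le> 1} x \<partial>lborel)"
proof -
  let ?e = "\<lambda>s::real. ennreal (s * exp (- s\<^sup>2 / 2))"
  let ?A = "{z. p (fst z) \<le> snd z \<and> 0 < snd z} :: ('a \<times> real) set"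
  have A[measurable]: "?A \<in> sets (borel \<Otimes>\<^sub>M borel)"
  proof -
    have "?A = {z \<in> space (borel \<Otimes>\<^sub>M borel). p (fst z) \<le> snd z \<and> 0 < snd z}" by (simp add: space_pair_measure)
    also have "\<dots> \<in> sets (borel \<Otimes>\<^sub>M borel)" by measurable
    finally show ?thesis .
  qed
  have "(\<integral>\<^sup>+x. ennreal (h x * exp (- (p x)\<^sup>2 / 2)) \<partial>lborel) =
    (\<integral>\<^sup>+x. (\<integral>\<^sup>+s. ennreal (h x) * (?e s * indicator ?A (x, s)) \<partial>lborel) \<partial>lborel)"
  proof (intro nn_integral_cong)
    fix x
    \<comment> \<open>Requiring \<open>0 < snd z\<close> in \<open>?A\<close> keeps the later
      rescaling by \<open>s\<close> legitimate; it removes at most the null set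
      \<open>{0}\<close>.\<close>
    have "AE s in lborel. s \<noteq> (0 :: real)" by (rule AE_lborel_singleton)
    then have "(\<integral>\<^sup>+s. ?e s * indicator ?A (x, s) \<partial>lborel) = (\<integral>\<^sup>+s. ?e s * indicator {p x..} s \<partial>lborel)"
      using p0[of x] by (intro nn_integral_cong_AE) (auto simp: indicator_def)
    then have "(\<integral>\<^sup>+s. ?e s * indicator ?A (x, s) \<partial>lborel) = ennreal (exp (- (p x)\<^sup>2 / 2))"
      using nn_integral_exp_tail[OF p0] by simp
    then show "ennreal (h x * exp (- (p x)\<^sup>2 / 2)) =
        (\<integral>\<^sup>+s. ennreal (h x) * (?e s * indicator ?A (x, s)) \<partial>lborel)"
      by (subst nn_integral_cmult) (auto simp: ennreal_mult h0)
  qed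
  also have "\<dots> = (\<integral>\<^sup>+s. (\<integral>\<^sup>+x. ennreal (h x) * (?e s * indicator ?A (x, s)) \<partial>lborel) \<partial>lborel)"
    by (rule lborel_pair.Fubini') measurable
  also have "\<dots> = (\<integral>\<^sup>+s. ennreal (s ^ (DIM('a) + d + 1) * exp (- s\<^sup>2 / 2)) * indicator {0<..} s *
    (\<integral>\<^sup>+x. ennreal (h x) * indicator {x. p x \<le> 1} x \<partial>lborel) \<partial>lborel)"
  proof (intro nn_integral_cong)
    fix s :: real
    show "(\<integral>\<^sup>+x. ennreal (h x) * (?e s * indicator ?A (x, s)) \<partial>lborel) =
      ennreal (s ^ (DIM('a) + d + 1) * exp (- s\<^sup>2 / 2)) * indicator {0<..} s *
      (\<integral>\<^sup>+x. ennreal (h x) * indicator {x. p x \<le> 1} x \<partial>lborel)"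
    proof (cases "0 < s")
      case True
      \<comment> \<open>Rescaling by \<open>s\<close> brings \<open>s ^ DIM('a)\<close> from the
        volume and \<open>s ^ d\<close> from the homogeneity of \<open>h\<close>; the remaining
        factor \<open>s\<close> belongs to \<open>?e\<close>. This is the exponent
        \<open>DIM('a) + d + 1\<close>.\<close>
      have "(\<integral>\<^sup>+x. ennreal (h x) * (?e s * indicator ?A (x, s)) \<partial>lborel) =
        ennreal (s ^ DIM('a)) * (\<integral>\<^sup>+x. ennreal (h (s *\<^sub>R x)) * (?e s * indicator ?A (s *\<^sub>R x, s)) \<partial>lborel)"
        by (rule nn_integral_scale[OF _ True]) measurable
      also have "(\<integral>\<^sup>+x. ennreal (h (s *\<^sub>R x)) * (?e s * indicator ?A (s *\<^sub>R x, s)) \<partial>lborel) =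
        (\<integral>\<^sup>+x. (ennreal (s ^ d) * ?e s) * (ennreal (h x) * indicator {x. p x \<le> 1} x) \<partial>lborel)"
        using True h0 by (intro nn_integral_cong) (auto simp: ht pt indicator_def ennreal_mult mult_ac)
      also have "\<dots> = (ennreal (s ^ d) * ?e s) * (\<integral>\<^sup>+x. ennreal (h x) * indicator {x. p x \<le> 1} x \<partial>lborel)"
        by (rule nn_integral_cmult) measurable
      finally have *: "(\<integral>\<^sup>+x. ennreal (h x) * (?e s * indicator ?A (x, s)) \<partial>lborel) =
        ennreal (s ^ DIM('a)) * ennreal (s ^ d) * ?e s * (\<integral>\<^sup>+x. ennreal (h x) * indicator {x. p x \<le> 1} x \<partial>lborel)"
        by (simp only: mult.assoc)
      have "ennreal (s ^ DIM('a)) * ennreal (s ^ d) * ?e s = ennreal (s ^ DIM('a) * s ^ d * (s * exp (- s\<^sup>2 / 2)))"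
        using True by (simp add: ennreal_mult)
      also have "s ^ DIM('a) * s ^ d * (s * exp (- s\<^sup>2 / 2)) = s ^ (DIM('a) + d + 1) * exp (- s\<^sup>2 / 2)"
        by (simp add: power_add)
      finally show ?thesis
        unfolding * using True by simp
    qed (simp add: indicator_def)
  qed
  also have "\<dots> = (\<integral>\<^sup>+s. ennreal (s ^ (DIM('a) + d + 1) * exp (- s\<^sup>2 / 2)) * indicator {0<..} s \<partial>lborel) *
    (\<integral>\<^sup>+x. ennreal (h x) * indicator {x. p x \<le> 1} x \<partial>lborel)"
    by (rule nn_integral_multc) measurable
  finally show ?thesis .
qed

lemma moment_finite_pos:
  fixes k :: nat
  shows "(\<integral>\<^sup>+s. ennreal (s ^ k * exp (- s\<^sup>2 / 2)) * indicator {0<..} s \<partial>lborel) < \<infinity>"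
    and "0 < (\<integral>\<^sup>+s. ennreal (s ^ k * exp (- s\<^sup>2 / 2)) * indicator {0<..} s \<partial>lborel)"
proof -
  have "integrable lborel (\<lambda>s. sqrt (2 * pi) * (std_normal_density s * s ^ k))"
    by (intro integrable_mult_right integrable_std_normal_moment)
  then have "integrable lborel (\<lambda>s::real. s ^ k * exp (- s\<^sup>2 / 2))"
    by (simp add: std_normal_density_def field_simps)
  then have "integrable lborel (\<lambda>s::real. s ^ k * exp (- s\<^sup>2 / 2) * indicator {0<..} s)"
    by (rule integrable_real_mult_indicator[rotated]) simp
  then have "(\<integral>\<^sup>+s. ennreal (s ^ k * exp (- s\<^sup>2 / 2) * indicator {0<..} s) \<partial>lborel) < \<infinity>"
    by (subst nn_integral_eq_integral) (auto simp: indicator_def)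
  also have "(\<integral>\<^sup>+s. ennreal (s ^ k * exp (- s\<^sup>2 / 2) * indicator {0<..} s) \<partial>lborel) =
      (\<integral>\<^sup>+s. ennreal (s ^ k * exp (- s\<^sup>2 / 2)) * indicator {0<..} s \<partial>lborel)"
    by (intro nn_integral_cong) (auto simp: indicator_def)
  finally show "(\<integral>\<^sup>+s. ennreal (s ^ k * exp (- s\<^sup>2 / 2)) * indicator {0<..} s \<partial>lborel) < \<infinity>" .
  have "0 < (\<integral>\<^sup>+s. ennreal (exp (- 2)) * indicator {1..2::real} s \<partial>lborel)"
    by (subst nn_integral_cmult_indicator) auto
  also have "\<dots> \<le> (\<integral>\<^sup>+s. ennreal (s ^ k * exp (- s\<^sup>2 / 2)) * indicator {0<..} s \<partial>lborel)"
  proof (intro nn_integral_mono)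
    fix s :: real
    have "1 * exp (- 2) \<le> s ^ k * exp (- s\<^sup>2 / 2)" if "1 \<le> s" "s \<le> 2"
      using that power_mono[of s 2 2] by (intro mult_mono one_le_power) auto
    then show "ennreal (exp (- 2)) * indicator {1..2} s \<le> ennreal (s ^ k * exp (- s\<^sup>2 / 2)) * indicator {0<..} s"
      by (auto simp: indicator_def intro!: ennreal_leI)
  qed
  finally show "0 < (\<integral>\<^sup>+s. ennreal (s ^ k * exp (- s\<^sup>2 / 2)) * indicator {0<..} s \<partial>lborel)" .
qed

text \<open>The layer-cake formula for the gauge \<open>sqrt (2 * e) * norm x\<close> and the weight
  1 reduces the integral to the volume of a ball times a finite moment.\<close>

lemma integrable_gaussian:
  fixes e :: real
  assumes "0 < e"
  shows "integrable lborel (\<lambda>x :: 'a::euclidean_space. exp (- (e * (norm x)\<^sup>2)))"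
proof -
  have "(\<integral>\<^sup>+x. ennreal (1 * exp (- (sqrt (2 * e) * norm (x :: 'a))\<^sup>2 / 2)) \<partial>lborel) =
    (\<integral>\<^sup>+s. ennreal (s ^ (DIM('a) + 0 + 1) * exp (- s\<^sup>2 / 2)) * indicator {0<..} s \<partial>lborel) *
    (\<integral>\<^sup>+x. ennreal 1 * indicator {x :: 'a. sqrt (2 * e) * norm x \<le> 1} x \<partial>lborel)"
    by (rule nn_integral_gauge_gaussian) (use assms in auto)
  also have "(\<integral>\<^sup>+x. ennreal 1 * indicator {x :: 'a. sqrt (2 * e) * norm x \<le> 1} x \<partial>lborel) =
      emeasure lborel (cball (0 :: 'a) (1 / sqrt (2 * e)))"
  proof -
    have "{x :: 'a. sqrt (2 * e) * norm x \<le> 1} = cball 0 (1 / sqrt (2 * e))"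
      using assms by (auto simp: field_simps)
    then show ?thesis by simp
  qed
  also have "(\<integral>\<^sup>+s. ennreal (s ^ (DIM('a) + 0 + 1) * exp (- s\<^sup>2 / 2)) * indicator {0<..} s \<partial>lborel) *
      emeasure lborel (cball (0 :: 'a) (1 / sqrt (2 * e))) < \<infinity>"
    using moment_finite_pos(1)[of "DIM('a) + 0 + 1"]
      emeasure_bounded_finite[OF bounded_cball[of "0 :: 'a" "1 / sqrt (2 * e)"]]
    by (auto simp: ennreal_mult_less_top)
  finally show ?thesis
    using assms by (intro integrableI_nonneg) (auto simp: power_mult_distrib)
qed

text \<open>
  Polar coordinates: evaluate the double integral of \<open>A x * B (t x) * t ^ (n - 1)\<close> over \<open>x\<close> and
  \<open>t > 0\<close> in both orders, for \<open>A x = |x| ^ n\<close> on the unit ball and \<open>B\<close> the indicator of \<open>{p \<le> 1}\<close>.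
\<close>

lemma nn_integral_polar:
  fixes p :: "'a::euclidean_space \<Rightarrow> real"
  assumes p[measurable]: "p \<in> borel_measurable borel"
    and p0: "\<And>x. x \<noteq> 0 \<Longrightarrow> 0 < p x"
    and pt: "\<And>t x. 0 < t \<Longrightarrow> p (t *\<^sub>R x) = t * p x"
  shows "(\<integral>\<^sup>+x. ennreal ((norm x / p x) ^ DIM('a)) * indicator (cball 0 1 - {0}) x \<partial>lborel) =
    emeasure lborel {x. p x \<le> 1}"
proof -
  define n where "n = DIM('a)"
  have n: "0 < n" by (simp add: n_def)
  have I: "(\<integral>\<^sup>+t. ennreal (t ^ (n - 1)) * indicator {0<..b} t \<partial>lborel) = ennreal (b ^ n / n)" if "0 < b" for b :: real
  proof -
    have "(\<integral>\<^sup>+t. ennreal (t ^ (n - 1)) * indicator {0..b} t \<partial>lborel) = ennreal (b ^ n / n - 0 ^ n / n)"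
      using that n by (intro nn_integral_FTC_Icc) (auto intro!: derivative_eq_intros)
    moreover have "AE s in lborel. s \<noteq> (0 :: real)" by (rule AE_lborel_singleton)
    then have "(\<integral>\<^sup>+t. ennreal (t ^ (n - 1)) * indicator {0<..b} t \<partial>lborel) =
        (\<integral>\<^sup>+t. ennreal (t ^ (n - 1)) * indicator {0..b} t \<partial>lborel)"
      by (intro nn_integral_cong_AE) (auto simp: indicator_def)
    ultimately show ?thesis using n by (simp add: zero_power)
  qed
  have [measurable]: "{x. p x \<le> 1} \<in> sets borel" "cball 0 1 - {0 :: 'a} \<in> sets borel" by simp_all
  define A where "A x = ennreal (norm x ^ n) * indicator (cball 0 1 - {0}) x" for x :: 'a
  define B where "B x = (indicator {x. p x \<le> 1} x :: ennreal)" for x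
  define J where "J t = ennreal (t ^ (n - 1)) * indicator {0<..} t" for t :: real
  have [measurable]: "A \<in> borel_measurable borel" "B \<in> borel_measurable borel" "J \<in> borel_measurable borel"
    unfolding A_def B_def J_def by measurable
  have L: "A x * (\<integral>\<^sup>+t. B (t *\<^sub>R x) * J t \<partial>lborel) =
      ennreal (1 / n) * (ennreal ((norm x / p x) ^ n) * indicator (cball 0 1 - {0}) x)" for x
  proof (cases "x = 0")
    case False
    have "(\<integral>\<^sup>+t. B (t *\<^sub>R x) * J t \<partial>lborel) = (\<integral>\<^sup>+t. ennreal (t ^ (n - 1)) * indicator {0<..1 / p x} t \<partial>lborel)"
      using p0[OF False] by (intro nn_integral_cong) (auto simp: B_def J_def indicator_def pt field_simps)
    also have "\<dots> = ennreal ((1 / p x) ^ n / n)" using p0[OF False] by (intro I) simp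
    finally show ?thesis
      using p0[OF False] n
      by (auto simp: A_def indicator_def ennreal_mult[symmetric] power_divide field_simps)
  qed (simp add: A_def)
  \<comment> \<open>On \<open>norm x \<le> t\<close> the integrand is
    \<open>norm x ^ n / t ^ (n + 1)\<close>, whose integral is \<open>1 / n\<close> for every
    \<open>x\<close>. The factor \<open>norm x ^ n\<close> in \<open>A\<close> was chosen for
    this.\<close>
  have R: "B x * (\<integral>\<^sup>+t. A (inverse t *\<^sub>R x) * ennreal (1 / t) * indicator {0<..} t \<partial>lborel) = B x * ennreal (1 / n)" if "x \<noteq> 0" for x
  proof -
    have pos: "0 < t" if "norm x \<le> t" for t :: real
      using that \<open>x \<noteq> 0\<close> by (meson less_le_trans zero_less_norm_iff)
    have "(\<integral>\<^sup>+t. A (inverse t *\<^sub>R x) * ennreal (1 / t) * indicator {0<..} t \<partial>lborel) =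
        (\<integral>\<^sup>+t. ennreal (norm x ^ n / t ^ (n + 1)) * indicator {norm x..} t \<partial>lborel)"
      using that n
      by (intro nn_integral_cong)
        (auto simp: A_def indicator_def ennreal_mult[symmetric] field_simps power_divide dest: pos)
    also have "\<dots> = ennreal (0 - (- (norm x ^ n / n * inverse (norm x ^ n))))"
    proof (rule nn_integral_FTC_atLeast[where F = "\<lambda>t. - (norm x ^ n / n * inverse (t ^ n))"])
      have "filterlim (\<lambda>t::real. t ^ n) at_top at_top" using n by (rule filterlim_pow_at_top[OF _ filterlim_ident])
      then have "((\<lambda>t. - (norm x ^ n / n) * inverse (t ^ n)) \<longlongrightarrow> - (norm x ^ n / n) * 0) at_top"
        by (intro tendsto_intros tendsto_inverse_0_at_top)
      then show "((\<lambda>t. - (norm x ^ n / n * inverse (t ^ n))) \<longlongrightarrow> 0) at_top" by simp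
      show "((\<lambda>t. - (norm x ^ n / n * inverse (t ^ n))) has_real_derivative norm x ^ n / t ^ (n + 1)) (at t)"
        if "norm x \<le> t" for t
      proof -
        have "0 < t" using that by (rule pos)
        have t1: "t ^ n = t * t ^ (n - 1)" using n by (cases n) auto
        have *: "c / n * (inverse (t * T) * (n * T) * inverse (t * T)) = c / (t * (t * T))" if "T \<noteq> 0" for c T :: real
          using that n \<open>0 < t\<close> by (simp add: field_simps)
        have "norm x ^ n / n * (inverse (t ^ n) * (n * t ^ (n - 1)) * inverse (t ^ n)) = norm x ^ n / t ^ (n + 1)"
          unfolding Suc_eq_plus1[symmetric] power_Suc t1 by (rule *) (use \<open>0 < t\<close> in simp)
        moreover have "((\<lambda>t. - (norm x ^ n / n * inverse (t ^ n))) has_real_derivative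
            - (norm x ^ n / n * - (inverse (t ^ n) * (real n * t ^ (n - 1)) * inverse (t ^ n)))) (at t)"
          using \<open>0 < t\<close> by (intro DERIV_minus DERIV_cmult DERIV_inverse' DERIV_pow[of n, simplified]) auto
        ultimately show ?thesis by simp
      qed
    qed (auto dest: pos)
    also have "\<dots> = ennreal (1 / n)" using that by simp
    finally show ?thesis by simp
  qed
  have "ennreal (1 / n) * (\<integral>\<^sup>+x. ennreal ((norm x / p x) ^ n) * indicator (cball 0 1 - {0}) x \<partial>lborel) =
      (\<integral>\<^sup>+x. A x * (\<integral>\<^sup>+t. B (t *\<^sub>R x) * J t \<partial>lborel) \<partial>lborel)"
    unfolding L by (rule nn_integral_cmult[symmetric]) measurable
  also have "\<dots> = (\<integral>\<^sup>+x. (\<integral>\<^sup>+t. A x * B (t *\<^sub>R x) * J t \<partial>lborel) \<partial>lborel)"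
    by (simp add: nn_integral_cmult mult.assoc)
  also have "\<dots> = (\<integral>\<^sup>+t. (\<integral>\<^sup>+x. A x * B (t *\<^sub>R x) * J t \<partial>lborel) \<partial>lborel)"
    by (rule lborel_pair.Fubini') measurable
  \<comment> \<open>The substitution of \<open>inverse t *\<^sub>R x\<close> for \<open>x\<close>
    costs a factor \<open>inverse t ^ n\<close>, of which the weight \<open>t ^ (n - 1)\<close> in
    \<open>J\<close> leaves \<open>1 / t\<close>.\<close>
  also have "\<dots> = (\<integral>\<^sup>+t. (\<integral>\<^sup>+x. B x * (A (inverse t *\<^sub>R x) * ennreal (1 / t) * indicator {0<..} t) \<partial>lborel) \<partial>lborel)"
  proof (rule nn_integral_cong)
    fix t :: real
    show "(\<integral>\<^sup>+x. A x * B (t *\<^sub>R x) * J t \<partial>lborel) =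
        (\<integral>\<^sup>+x. B x * (A (inverse t *\<^sub>R x) * ennreal (1 / t) * indicator {0<..} t) \<partial>lborel)"
    proof (cases "0 < t")
      case True
      have "(\<integral>\<^sup>+x. A x * B (t *\<^sub>R x) * J t \<partial>lborel) =
          ennreal (inverse t ^ n) * (\<integral>\<^sup>+x. A (inverse t *\<^sub>R x) * B (t *\<^sub>R inverse t *\<^sub>R x) * J t \<partial>lborel)"
        unfolding n_def using True by (intro nn_integral_scale) auto
      also have "\<dots> = (\<integral>\<^sup>+x. ennreal (inverse t ^ n) * (A (inverse t *\<^sub>R x) * B (t *\<^sub>R inverse t *\<^sub>R x) * J t) \<partial>lborel)"
        by (rule nn_integral_cmult[symmetric]) measurable
      also have "\<dots> = (\<integral>\<^sup>+x. B x * (A (inverse t *\<^sub>R x) * ennreal (1 / t) * indicator {0<..} t) \<partial>lborel)"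
      proof (intro nn_integral_cong)
        fix x
        have "inverse t ^ n * t ^ (n - 1) = 1 / t"
          using True n by (cases n) (auto simp: field_simps)
        then have "ennreal (inverse t ^ n) * ennreal (t ^ (n - 1)) = ennreal (1 / t)"
          using True by (subst ennreal_mult[symmetric]) auto
        then show "ennreal (inverse t ^ n) * (A (inverse t *\<^sub>R x) * B (t *\<^sub>R inverse t *\<^sub>R x) * J t) =
            B x * (A (inverse t *\<^sub>R x) * ennreal (1 / t) * indicator {0<..} t)"
          using True by (simp add: J_def mult_ac)
      qed
      finally show ?thesis .
    qed (simp add: J_def)
  qed
  also have "\<dots> = (\<integral>\<^sup>+x. (\<integral>\<^sup>+t. B x * (A (inverse t *\<^sub>R x) * ennreal (1 / t) * indicator {0<..} t) \<partial>lborel) \<partial>lborel)"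
    by (rule lborel_pair.Fubini'[symmetric]) measurable
  also have "\<dots> = (\<integral>\<^sup>+x. B x * (\<integral>\<^sup>+t. A (inverse t *\<^sub>R x) * ennreal (1 / t) * indicator {0<..} t \<partial>lborel) \<partial>lborel)"
    by (intro nn_integral_cong nn_integral_cmult) measurable
  also have "\<dots> = (\<integral>\<^sup>+x. B x * ennreal (1 / n) \<partial>lborel)"
    using AE_lborel_singleton[of "0 :: 'a"] by (intro nn_integral_cong_AE) (auto simp: R)
  also have "\<dots> = emeasure lborel {x. p x \<le> 1} * ennreal (1 / n)"
    by (subst nn_integral_multc) (auto simp: B_def[abs_def])
  finally have "ennreal (1 / n) * (\<integral>\<^sup>+x. ennreal ((norm x / p x) ^ n) * indicator (cball 0 1 - {0}) x \<partial>lborel) =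
      ennreal (1 / n) * emeasure lborel {x. p x \<le> 1}" by (simp add: mult.commute)
  then show ?thesis
    using n by (subst (asm) ennreal_mult_cancel_left) (auto simp: n_def ennreal_eq_0_iff)
qed

section \<open>Gaussian symmetrization along an axis\<close>

text \<open>A class stable under all operations of the induction: injective linear changes of
  variable, translations, exponential tilts and the symmetrization below. The tail bound supplies
  first moments and the dominating functions for passing to the limit.\<close>

definition gaussian_dominated :: "('a::euclidean_space \<Rightarrow> real) \<Rightarrow> bool" where
  "gaussian_dominated f \<longleftrightarrow> continuous_on UNIV f \<and> (\<forall>x. 0 < f x) \<and>
     (\<exists>C e. 0 < e \<and> (\<forall>x. f x \<le> C * exp (- (e * (norm x)\<^sup>2))))"

lemma gaussian_dominatedI:
  assumes "continuous_on UNIV f" "\<And>x. 0 < f x" "0 < e" "\<And>x. f x \<le> C * exp (- (e * (norm x)\<^sup>2))"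
  shows "gaussian_dominated f"
  using assms unfolding gaussian_dominated_def by blast

lemma gaussian_dominatedD:
  assumes "gaussian_dominated f"
  shows "continuous_on UNIV f" "0 < f x"
  using assms unfolding gaussian_dominated_def by auto

lemma gaussian_dominatedE:
  assumes "gaussian_dominated f"
  obtains C e where "0 < C" "0 < e" "\<And>x. f x \<le> C * exp (- (e * (norm x)\<^sup>2))"
proof -
  obtain C e where *: "0 < e" "\<And>x. f x \<le> C * exp (- (e * (norm x)\<^sup>2))"
    using assms unfolding gaussian_dominated_def by blast
  have "0 < C" using gaussian_dominatedD(2)[OF assms, of 0] *(2)[of 0] by simp
  then show thesis using * that by blast
qed

lemma gaussian_dominated_measurable [measurable_dest]:
  "gaussian_dominated f \<Longrightarrow> f \<in> borel_measurable borel"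
  by (intro borel_measurable_continuous_onI gaussian_dominatedD)

lemma gaussian_dominated_integrable:
  assumes f: "gaussian_dominated f"
  shows "integrable lborel f"
proof -
  obtain C e where Ce: "0 < C" "0 < e" "\<And>x. f x \<le> C * exp (- (e * (norm x)\<^sup>2))"
    using gaussian_dominatedE[OF f] by blast
  show ?thesis
  proof (rule Bochner_Integration.integrable_bound)
    show "integrable lborel (\<lambda>x. C * exp (- (e * (norm x)\<^sup>2)))"
      by (intro integrable_mult_right integrable_gaussian Ce)
    show "f \<in> borel_measurable lborel" using f by measurable
    show "AE x in lborel. norm (f x) \<le> norm (C * exp (- (e * (norm x)\<^sup>2)))"
      using Ce gaussian_dominatedD(2)[OF f] by (auto intro!: AE_I2 simp: abs_of_pos)
  qed
qed

text \<open>Complete the square in \<open>norm x\<close>. It lets a linear weight be absorbed by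
  giving up half of the Gaussian exponent.\<close>

lemma norm_le_exp_square:
  fixes e :: real
  assumes "0 < e"
  shows "norm x \<le> exp (1 / (4 * e)) * exp (e * (norm x)\<^sup>2)"
proof -
  have "0 \<le> (sqrt e * norm x - 1 / (2 * sqrt e))\<^sup>2" by simp
  also have "\<dots> = e * (norm x)\<^sup>2 + 1 / (4 * e) - norm x"
    using assms by (simp add: power2_diff power_mult_distrib power_divide)
  finally have "norm x \<le> 1 / (4 * e) + e * (norm x)\<^sup>2" by simp
  also have "\<dots> \<le> exp (1 / (4 * e) + e * (norm x)\<^sup>2)" using exp_ge_add_one_self[of "1 / (4 * e) + e * (norm x)\<^sup>2"] by linarith
  finally show ?thesis by (simp add: exp_add)
qed

lemma gaussian_dominated_integrable_nth:
  fixes f :: "real ^ 'n \<Rightarrow> real"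
  assumes f: "gaussian_dominated f"
  shows "integrable lborel (\<lambda>x. x $ j * f x)"
proof -
  obtain C e where Ce: "0 < C" "0 < e" "\<And>x. f x \<le> C * exp (- (e * (norm x)\<^sup>2))"
    using gaussian_dominatedE[OF f] by blast
  show ?thesis
  proof (rule Bochner_Integration.integrable_bound)
    show "integrable lborel (\<lambda>x :: real ^ 'n. (exp (1 / (4 * (e / 2))) * C) * exp (- ((e / 2) * (norm x)\<^sup>2)))"
      using Ce by (intro integrable_mult_right integrable_gaussian) simp
    have [measurable]: "f \<in> borel_measurable borel" using f by measurable
    show "(\<lambda>x. x $ j * f x) \<in> borel_measurable lborel" by measurable
    have "\<bar>x $ j\<bar> * f x \<le> (exp (1 / (4 * (e / 2))) * C) * exp (- ((e / 2) * (norm x)\<^sup>2))" for x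
    proof -
      have "\<bar>x $ j\<bar> * f x \<le> (exp (1 / (4 * (e / 2))) * exp (e / 2 * (norm x)\<^sup>2)) * (C * exp (- (e * (norm x)\<^sup>2)))"
        using Ce gaussian_dominatedD(2)[OF f] component_le_norm_cart[of x j] norm_le_exp_square[of "e / 2" x]
        by (intro mult_mono) (auto simp: less_imp_le)
      also have "\<dots> = (exp (1 / (4 * (e / 2))) * C) * (exp (e / 2 * (norm x)\<^sup>2) * exp (- (e * (norm x)\<^sup>2)))"
        by simp
      also have "exp (e / 2 * (norm x)\<^sup>2) * exp (- (e * (norm x)\<^sup>2)) = exp (- ((e / 2) * (norm x)\<^sup>2))"
        unfolding exp_add[symmetric] by simp
      finally show ?thesis .
    qed
    then show "AE x in lborel. norm (x $ j * f x) \<le> norm ((exp (1 / (4 * (e / 2))) * C) * exp (- ((e / 2) * (norm x)\<^sup>2)))"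
      using Ce gaussian_dominatedD(2)[OF f] by (intro AE_I2) (simp add: abs_mult abs_of_pos)
  qed
qed

lemma gaussian_dominated_linear:
  fixes f :: "'a::euclidean_space \<Rightarrow> real" and S :: "'b::euclidean_space \<Rightarrow> 'a"
  assumes f: "gaussian_dominated f" and S: "linear S" "inj S"
  shows "gaussian_dominated (\<lambda>x. f (S x))"
proof -
  obtain C e where Ce: "0 < C" "0 < e" "\<And>x. f x \<le> C * exp (- (e * (norm x)\<^sup>2))"
    using gaussian_dominatedE[OF f] by blast
  obtain B where B: "0 < B" "\<And>x. B * norm x \<le> norm (S x)"
    using linear_inj_bounded_below_pos[OF S] by blast
  show ?thesis
  proof (rule gaussian_dominatedI)
    show "continuous_on UNIV (\<lambda>x. f (S x))"
      using continuous_on_compose2[OF gaussian_dominatedD(1)[OF f] linear_continuous_on] S(1)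
      by (auto simp: linear_conv_bounded_linear)
    show "0 < f (S x)" for x by (rule gaussian_dominatedD(2)[OF f])
    show "0 < e * B\<^sup>2" using Ce B by simp
    show "f (S x) \<le> C * exp (- (e * B\<^sup>2 * (norm x)\<^sup>2))" for x
    proof -
      have "B\<^sup>2 * (norm x)\<^sup>2 \<le> (norm (S x))\<^sup>2"
        unfolding power_mult_distrib[symmetric] using B by (intro power_mono) auto
      then have "C * exp (- (e * (norm (S x))\<^sup>2)) \<le> C * exp (- (e * B\<^sup>2 * (norm x)\<^sup>2))"
        using Ce by simp
      then show ?thesis using Ce(3)[of "S x"] by linarith
    qed
  qed
qed

lemma gaussian_dominated_translate:
  fixes f :: "'a::euclidean_space \<Rightarrow> real"
  assumes f: "gaussian_dominated f"
  shows "gaussian_dominated (\<lambda>x. f (z + x))"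
proof -
  obtain C e where Ce: "0 < C" "0 < e" "\<And>x. f x \<le> C * exp (- (e * (norm x)\<^sup>2))"
    using gaussian_dominatedE[OF f] by blast
  show ?thesis
  proof (rule gaussian_dominatedI)
    show "continuous_on UNIV (\<lambda>x. f (z + x))"
      by (rule continuous_on_compose2[OF gaussian_dominatedD(1)[OF f]]) (auto intro!: continuous_intros)
    show "0 < f (z + x)" for x by (rule gaussian_dominatedD(2)[OF f])
    show "0 < e / 2" using Ce by simp
    show "f (z + x) \<le> (C * exp (e * (norm z)\<^sup>2)) * exp (- (e / 2 * (norm x)\<^sup>2))" for x
    proof -
      \<comment> \<open>The difference of the two sides is half the square of the norm of
        \<open>2 *\<^sub>R z + x\<close>. Half of the exponent \<open>e\<close> is given up to
        absorb the shift.\<close>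
      have "(norm x)\<^sup>2 / 2 \<le> (norm (z + x))\<^sup>2 + (norm z)\<^sup>2"
        using zero_le_power2[of "norm (2 *\<^sub>R z + x)"] unfolding dot_square_norm[symmetric]
        by (simp add: inner_add inner_commute algebra_simps)
      then have "e * ((norm x)\<^sup>2 / 2) \<le> e * ((norm (z + x))\<^sup>2 + (norm z)\<^sup>2)"
        using Ce(2) by (intro mult_left_mono) auto
      then have "exp (- (e * (norm (z + x))\<^sup>2)) \<le> exp (e * (norm z)\<^sup>2) * exp (- (e / 2 * (norm x)\<^sup>2))"
        unfolding exp_add[symmetric] by (simp add: algebra_simps)
      then have "C * exp (- (e * (norm (z + x))\<^sup>2)) \<le> C * (exp (e * (norm z)\<^sup>2) * exp (- (e / 2 * (norm x)\<^sup>2)))"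
        using Ce(1) by (intro mult_left_mono) auto
      then show ?thesis using Ce(3)[of "z + x"] by (simp add: mult.assoc)
    qed
  qed
qed

lemma gaussian_dominated_exp:
  fixes f :: "'a::euclidean_space \<Rightarrow> real"
  assumes f: "gaussian_dominated f"
  shows "gaussian_dominated (\<lambda>x. f x * exp (z \<bullet> x))"
proof -
  obtain C e where Ce: "0 < C" "0 < e" "\<And>x. f x \<le> C * exp (- (e * (norm x)\<^sup>2))"
    using gaussian_dominatedE[OF f] by blast
  show ?thesis
  proof (rule gaussian_dominatedI)
    show "continuous_on UNIV (\<lambda>x. f x * exp (z \<bullet> x))"
      by (intro continuous_intros gaussian_dominatedD(1)[OF f])
    show "0 < f x * exp (z \<bullet> x)" for x using gaussian_dominatedD(2)[OF f, of x] by simp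
    show "0 < e / 2" using Ce by simp
    show "f x * exp (z \<bullet> x) \<le> (C * exp ((norm z)\<^sup>2 / (2 * e))) * exp (- (e / 2 * (norm x)\<^sup>2))" for x
    proof -
      have "0 \<le> (norm z - e * norm x)\<^sup>2 / (2 * e)" using Ce by simp
      also have "\<dots> = (norm z)\<^sup>2 / (2 * e) + e / 2 * (norm x)\<^sup>2 - norm z * norm x"
        using Ce by (simp add: power2_diff field_simps power2_eq_square)
      finally have "z \<bullet> x \<le> (norm z)\<^sup>2 / (2 * e) + e / 2 * (norm x)\<^sup>2"
        using norm_cauchy_schwarz[of z x] by linarith
      then have "exp (- (e * (norm x)\<^sup>2)) * exp (z \<bullet> x) \<le> exp ((norm z)\<^sup>2 / (2 * e)) * exp (- (e / 2 * (norm x)\<^sup>2))"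
        unfolding exp_add[symmetric] by (simp add: field_simps)
      then have "C * (exp (- (e * (norm x)\<^sup>2)) * exp (z \<bullet> x)) \<le> C * (exp ((norm z)\<^sup>2 / (2 * e)) * exp (- (e / 2 * (norm x)\<^sup>2)))"
        using Ce(1) by (intro mult_left_mono) auto
      moreover have "f x * exp (z \<bullet> x) \<le> (C * exp (- (e * (norm x)\<^sup>2))) * exp (z \<bullet> x)"
        using Ce(3)[of x] by (intro mult_right_mono) auto
      ultimately show ?thesis unfolding mult.assoc by (rule order_trans[rotated])
    qed
  qed
qed

section \<open>Half-line integrals and the symmetrized function\<close>

lemma half_line_integral_pos:
  fixes f :: "real \<Rightarrow> real"
  assumes "continuous_on UNIV f" "\<And>s. 0 < f s" "set_integrable lborel {0..} f"
  shows "0 < (LINT s:{0..}|lborel. f s)"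
proof -
  obtain E where "\<And>s. 0 < s \<Longrightarrow> (E has_real_derivative f s) (at s)"
    "(E \<longlongrightarrow> 0) (at_right 0)" "(E \<longlongrightarrow> (LINT s:{0..}|lborel. f s)) at_top"
    "\<And>s t. 0 < s \<Longrightarrow> s < t \<Longrightarrow> E s < E t" "\<And>s. 0 < s \<Longrightarrow> 0 < E s"
    "\<And>s. 0 < s \<Longrightarrow> E s < (LINT s:{0..}|lborel. f s)"
    using primitive_from_zero[OF assms] by blast
  from this(5,6)[of 1] show ?thesis by simp
qed

lemma gauss_half_pos: "0 < gauss_half"
proof -
  have int: "set_integrable lborel {0..} (\<lambda>s::real. exp (- s\<^sup>2 / 2))"
    using integrable_mult_indicator[OF _ integrable_exp_square_half, of "{0..}"] by (simp add: set_integrable_def)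
  have cont: "continuous_on UNIV (\<lambda>s::real. exp (- s\<^sup>2 / 2))" by (intro continuous_intros) auto
  show ?thesis unfolding gauss_half_def by (rule half_line_integral_pos[OF cont exp_gt_zero int])
qed

lemma integral_exp_square_half: "(LINT s|lborel. exp (- s\<^sup>2 / 2 :: real)) = 2 * gauss_half"
proof -
  let ?e = "\<lambda>s::real. exp (- s\<^sup>2 / 2)"
  have int: "integrable lborel (\<lambda>s. indicator {0..} s * ?e s)" "integrable lborel (\<lambda>s. indicator {..<0} s * ?e s)"
    using integrable_mult_indicator[OF _ integrable_exp_square_half] by auto
  have "(LINT s|lborel. ?e s) = (LINT s|lborel. indicator {0..} s * ?e s + indicator {..<0} s * ?e s)"
    by (intro Bochner_Integration.integral_cong) (auto simp: indicator_def)
  also have "\<dots> = gauss_half + (LINT s|lborel. indicator {..<0} s * ?e s)"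
    using int by (simp add: gauss_half_def set_lebesgue_integral_def)
  also have "(LINT s|lborel. indicator {..<0} s * ?e s) = (LINT s|lborel. indicator {..<0} (0 + (-1) * s) * ?e (0 + (-1) * s))"
    by (subst lborel_integral_real_affine[where c="-1" and t=0]) auto
  also have "\<dots> = (LINT s|lborel. indicator {0..} s * ?e s)"
    using AE_lborel_singleton[of "0::real"] by (intro integral_cong_AE) (auto simp: indicator_def)
  finally show ?thesis by (simp add: gauss_half_def set_lebesgue_integral_def)
qed

text \<open>
  Replaces \<open>f\<close>, on each line parallel to the \<open>i\<close>-th axis, by a centred Gaussian whose mass is twice that
  of the restriction of \<open>f\<close> to the half-line \<open>x $ i \<ge> 0\<close>.
\<close>

definition half_symm :: "'n \<Rightarrow> (real ^ 'n \<Rightarrow> real) \<Rightarrow> real ^ 'n \<Rightarrow> real" where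
  "half_symm i f x = exp (- (x $ i)\<^sup>2 / 2) / gauss_half * (LINT s:{0..}|lborel. f (upd i x s))"

lemma norm_le_upd: "\<bar>s\<bar> \<le> norm (upd i x s)"
  using component_le_norm_cart[of "upd i x s" i] by simp

lemma gaussian_dominated_line:
  fixes f :: "real ^ 'n \<Rightarrow> real"
  assumes f: "gaussian_dominated f"
  shows "continuous_on UNIV (\<lambda>s. f (upd i x s))" "set_integrable lborel {0..} (\<lambda>s. f (upd i x s))"
proof -
  obtain C e where Ce: "0 < C" "0 < e" "\<And>x. f x \<le> C * exp (- (e * (norm x)\<^sup>2))"
    using gaussian_dominatedE[OF f] by blast
  have "gaussian_dominated (\<lambda>s. f (upd i x s))"
  proof (rule gaussian_dominatedI)
    show "continuous_on UNIV (\<lambda>s. f (upd i x s))"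
      by (rule continuous_on_compose2[OF gaussian_dominatedD(1)[OF f]]) (auto intro!: continuous_intros)
    show "0 < f (upd i x s)" for s by (rule gaussian_dominatedD(2)[OF f])
    show "0 < e" by fact
    show "f (upd i x s) \<le> C * exp (- (e * (norm s)\<^sup>2))" for s
    proof -
      have "(norm s)\<^sup>2 \<le> (norm (upd i x s))\<^sup>2" using norm_le_upd[of s i x] by (intro power_mono) auto
      then have "C * exp (- (e * (norm (upd i x s))\<^sup>2)) \<le> C * exp (- (e * (norm s)\<^sup>2))" using Ce by simp
      then show ?thesis using Ce(3)[of "upd i x s"] by linarith
    qed
  qed
  then have gd: "gaussian_dominated (\<lambda>s. f (upd i x s))" .
  show "continuous_on UNIV (\<lambda>s. f (upd i x s))" "set_integrable lborel {0..} (\<lambda>s. f (upd i x s))"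
    using integrable_mult_indicator[OF _ gaussian_dominated_integrable[OF gd], of "{0..}"] gaussian_dominatedD(1)[OF gd]
    by (auto simp: set_integrable_def)
qed

lemma gaussian_dominated_line_pos:
  assumes f: "gaussian_dominated f"
  shows "0 < (LINT s:{0..}|lborel. f (upd i x s))"
  by (intro half_line_integral_pos gaussian_dominated_line gaussian_dominatedD f)

lemma half_symm_dominated:
  fixes f :: "real ^ 'n \<Rightarrow> real"
  assumes f: "gaussian_dominated f"
  shows "gaussian_dominated (half_symm i f)"
proof -
  obtain C e where Ce: "0 < C" "0 < e" "\<And>x. f x \<le> C * exp (- (e * (norm x)\<^sup>2))"
    using gaussian_dominatedE[OF f] by blast
  have [measurable]: "f \<in> borel_measurable borel" using f by measurable
  have nn: "f x \<ge> 0" for x using gaussian_dominatedD(2)[OF f, of x] by simp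
  have bound: "f (upd i x s) \<le> C * exp (- (e * (norm (upd i x 0))\<^sup>2)) * exp (- (e * s\<^sup>2))" for x s
  proof -
    have "exp (- (e * ((norm (upd i x 0))\<^sup>2 + s\<^sup>2))) = exp (- (e * (norm (upd i x 0))\<^sup>2)) * exp (- (e * s\<^sup>2))"
      unfolding exp_add[symmetric] by (simp add: distrib_left)
    then show ?thesis using Ce(3)[of "upd i x s"] unfolding norm_upd[of i x s] by (simp only: mult.assoc)
  qed
  have bound': "f (upd i x s) \<le> C * exp (- (e * s\<^sup>2))" for x s
  proof -
    have "C * exp (- (e * (norm (upd i x 0))\<^sup>2)) * exp (- (e * s\<^sup>2)) \<le> C * 1 * exp (- (e * s\<^sup>2))"
      using Ce by (intro mult_right_mono mult_left_mono) auto
    then show ?thesis using bound[of x s] by simp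
  qed
  have intb: "integrable lborel (\<lambda>s. indicator {0..} s * (D * exp (- (e * s\<^sup>2))))" for D
    using integrable_mult_indicator[OF _ integrable_mult_right[OF integrable_exp_square[OF Ce(2)]], of "{0..}"] by simp
  define J where "J = (LINT s:{0..}|lborel. exp (- (e * s\<^sup>2)))"
  have int_le: "(LINT s:{0..}|lborel. f (upd i x s)) \<le> C * exp (- (e * (norm (upd i x 0))\<^sup>2)) * J" for x
  proof -
    have "(LINT s:{0..}|lborel. f (upd i x s)) \<le> (LINT s:{0..}|lborel. C * exp (- (e * (norm (upd i x 0))\<^sup>2)) * exp (- (e * s\<^sup>2)))"
      using intb gaussian_dominated_line(2)[OF f]
      by (intro set_integral_mono bound) (auto simp: set_integrable_def)
    then show ?thesis by (simp add: J_def)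
  qed
  have cont: "continuous_on UNIV (\<lambda>x. LINT s:{0..}|lborel. f (upd i x s))"
  proof (rule continuous_on_sequentiallyI)
    fix u a assume u: "u \<longlonglongrightarrow> (a :: real ^ 'n)"
    show "(\<lambda>n. LINT s:{0..}|lborel. f (upd i (u n) s)) \<longlonglongrightarrow> (LINT s:{0..}|lborel. f (upd i a s))"
      unfolding set_lebesgue_integral_def
    proof (rule integral_dominated_convergence[where w="\<lambda>s. indicator {0..} s * (C * exp (- (e * s\<^sup>2)))"])
      show "AE s in lborel. (\<lambda>n. indicator {0..} s *\<^sub>R f (upd i (u n) s)) \<longlonglongrightarrow> indicator {0..} s *\<^sub>R f (upd i a s)"
      proof (intro AE_I2 tendsto_scaleR tendsto_const)
        fix s
        have "continuous_on UNIV (\<lambda>x. f (upd i x s))"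
          by (rule continuous_on_compose2[OF gaussian_dominatedD(1)[OF f]]) (auto intro!: continuous_intros)
        then have "isCont (\<lambda>x. f (upd i x s)) a" by (simp add: continuous_on_eq_continuous_at)
        then show "(\<lambda>n. f (upd i (u n) s)) \<longlonglongrightarrow> f (upd i a s)" using u by (rule isCont_tendsto_compose)
      qed
      show "AE s in lborel. norm (indicator {0..} s *\<^sub>R f (upd i (u n) s)) \<le> indicator {0..} s * (C * exp (- (e * s\<^sup>2)))" for n
        using bound' nn by (auto intro!: AE_I2 simp: indicator_def)
    qed (use intb in auto)
  qed
  \<comment> \<open>The symmetrized function decays at rate \<open>1 / 2\<close> in the
    \<open>i\<close>-th coordinate and at the old rate \<open>e\<close> in the others;
    \<open>m\<close> is the worse of the two.\<close>
  define m where "m = min e (1 / 2)"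
  show ?thesis
  proof (rule gaussian_dominatedI)
    show "continuous_on UNIV (half_symm i f)"
      unfolding half_symm_def by (intro continuous_intros cont) (use gauss_half_pos in auto)
    show "0 < half_symm i f x" for x
      using gaussian_dominated_line_pos[OF f] gauss_half_pos by (simp add: half_symm_def)
    show "0 < m" using Ce by (simp add: m_def)
    show "half_symm i f x \<le> (C * J / gauss_half) * exp (- (m * (norm x)\<^sup>2))" for x
    proof -
      have "0 < J" using less_le_trans[OF gaussian_dominated_line_pos[OF f] int_le] Ce(1)
        by (metis exp_gt_zero mult_pos_pos zero_less_mult_pos)
      have "half_symm i f x \<le> exp (- (x $ i)\<^sup>2 / 2) / gauss_half * (C * exp (- (e * (norm (upd i x 0))\<^sup>2)) * J)"
        unfolding half_symm_def using gauss_half_pos by (intro mult_left_mono int_le) auto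
      also have "\<dots> = (C * J / gauss_half) * (exp (- (x $ i)\<^sup>2 / 2) * exp (- (e * (norm (upd i x 0))\<^sup>2)))"
        by simp
      also have "\<dots> \<le> (C * J / gauss_half) * exp (- (m * (norm x)\<^sup>2))"
      proof (intro mult_left_mono)
        have "m * (norm (upd i x 0))\<^sup>2 \<le> e * (norm (upd i x 0))\<^sup>2" "m * (x $ i)\<^sup>2 \<le> (1 / 2) * (x $ i)\<^sup>2"
          by (intro mult_right_mono; simp add: m_def)+
        moreover have "(norm x)\<^sup>2 = (norm (upd i x 0))\<^sup>2 + (x $ i)\<^sup>2" using norm_upd[of i x "x $ i"] by simp
        ultimately show "exp (- (x $ i)\<^sup>2 / 2) * exp (- (e * (norm (upd i x 0))\<^sup>2)) \<le> exp (- (m * (norm x)\<^sup>2))"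
          unfolding exp_add[symmetric] by (simp add: distrib_left)
      qed (use \<open>0 < J\<close> Ce gauss_half_pos in simp)
      finally show ?thesis .
    qed
  qed
qed

lemma half_symm_upd: "half_symm i f (upd i x s) = half_symm i f (upd i x 0) * exp (- s\<^sup>2 / 2)"
  by (simp add: half_symm_def)

text \<open>Resample with the normalized Gaussian \<open>?r\<close> as density, applied to twice the
  restriction of \<open>w * f\<close> to the upper half-space. The weight is constant along each
  line: \<open>w = 1\<close> gives the mass, and \<open>w x = x $ j\<close> with
  \<open>j \<noteq> i\<close> the other first moments.\<close>

lemma integral_half_symm_weighted:
  fixes f :: "real ^ 'n \<Rightarrow> real"
  assumes int: "integrable lborel (\<lambda>x. w x * f x)" and w: "\<And>x s. w (upd i x s) = w x"
  shows "(LINT x|lborel. w x * half_symm i f x) = 2 * (LINT x|lborel. indicator {x. 0 \<le> x $ i} x * (w x * f x))"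
proof -
  let ?h = "\<lambda>x. 2 * (indicator {x. 0 \<le> x $ i} x * (w x * f x))"
  let ?r = "\<lambda>s::real. exp (- s\<^sup>2 / 2) / (2 * gauss_half)"
  have [measurable]: "{x :: real ^ 'n. 0 \<le> x $ i} \<in> sets borel"
    by (rule borel_closed) (intro closed_Collect_le continuous_intros)
  have "integrable lborel ?h"
    using integrable_mult_indicator[OF _ int, of "{x. 0 \<le> x $ i}"] by simp
  then have "(LINT x|lborel. ?r (x $ i) * (LINT s|lborel. ?h (upd i x s))) = (LINT x|lborel. ?h x)"
    using integrable_exp_square_half gauss_half_pos
    by (intro integral_resample) (auto simp: integral_exp_square_half[simplified])
  moreover have "?r (x $ i) * (LINT s|lborel. ?h (upd i x s)) = w x * half_symm i f x" for x
  proof -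
    have "(LINT s|lborel. ?h (upd i x s)) = (LINT s|lborel. (2 * w x) * (indicator {0..} s *\<^sub>R f (upd i x s)))"
      by (intro Bochner_Integration.integral_cong) (auto simp: w indicator_def)
    also have "\<dots> = (2 * w x) * (LINT s:{0..}|lborel. f (upd i x s))"
      by (simp add: set_lebesgue_integral_def)
    finally show ?thesis by (simp add: half_symm_def)
  qed
  ultimately have "(LINT x|lborel. w x * half_symm i f x) = (LINT x|lborel. ?h x)" by (simp only:)
  then show ?thesis by simp
qed

lemma integral_half_symm:
  assumes f: "gaussian_dominated f"
  shows "(LINT x|lborel. half_symm i f x) = 2 * (LINT x|lborel. indicator {x. 0 \<le> x $ i} x * f x)"
  using integral_half_symm_weighted[of "\<lambda>_. 1" f i] gaussian_dominated_integrable[OF f] by simp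

lemma integral_half_symm_nth:
  assumes f: "gaussian_dominated f" and "j \<noteq> i"
  shows "(LINT x|lborel. x $ j * half_symm i f x) = 2 * (LINT x|lborel. indicator {x. 0 \<le> x $ i} x * (x $ j * f x))"
  using integral_half_symm_weighted[of "\<lambda>x. x $ j" f i] gaussian_dominated_integrable_nth[OF f] \<open>j \<noteq> i\<close> by simp

lemma exp_squares_le: "exp (- a\<^sup>2 / 2) * exp (- b\<^sup>2 / 2) \<le> exp (- (a * b :: real))"
proof -
  have "0 \<le> (a - b)\<^sup>2" by simp
  then show ?thesis unfolding exp_add[symmetric] by (simp add: power2_diff)
qed

context
  fixes f g :: "real ^ 'n \<Rightarrow> real"
  assumes f: "gaussian_dominated f" and g: "gaussian_dominated g"
    and fg: "\<And>x y. f x * g y \<le> exp (- (x \<bullet> y))"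
begin

text \<open>The inner product of points on two parallel lines is \<open>s * t\<close> plus a
  constant. Moving that constant into \<open>f\<close> produces the hypothesis of the half-line
  inequality.\<close>

lemma dual_bound_upd:
  "0 \<le> s \<Longrightarrow> 0 \<le> t \<Longrightarrow> exp (upd i x 0 \<bullet> upd i y 0) * f (upd i x s) * g (upd i y t) \<le> exp (- (s * t))"
proof -
  have "exp (upd i x 0 \<bullet> upd i y 0) * (f (upd i x s) * g (upd i y t)) \<le>
      exp (upd i x 0 \<bullet> upd i y 0) * exp (- (upd i x s \<bullet> upd i y t))"
    by (intro mult_left_mono fg) auto
  also have "\<dots> = exp (- (s * t))"
    unfolding exp_add[symmetric] inner_upd_upd[of i x s y t] by simp
  finally show ?thesis by (simp add: mult.assoc)
qed


text \<open>The half-line inequality on the two lines through \<open>x\<close> and \<open>y\<close>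
  bounds the product of the masses by \<open>gauss_half\<^sup>2 * exp (- ?u)\<close>, and
  \<open>exp_squares_le\<close> handles the Gaussian factors. Equality at a single pair of points
  thus forces equality on the whole pair of half-lines, where \<open>f\<close> and \<open>g\<close>
  become Gaussian with reciprocal rates.\<close>

lemma half_symm_pair: "half_symm i f x * half_symm i g y \<le> exp (- (x \<bullet> y))"
  and half_symm_pair_eq: "half_symm i f x * half_symm i g y = exp (- (x \<bullet> y)) \<Longrightarrow>
    \<exists>a>0. \<exists>b>0. \<exists>c>0. \<forall>s\<ge>0. f (upd i x s) = a * exp (- (c * s\<^sup>2) / 2) \<and> g (upd i y s) = b * exp (- s\<^sup>2 / (2 * c))"
proof -
  let ?u = "upd i x 0 \<bullet> upd i y 0"
  have line_facts:
    "continuous_on UNIV (\<lambda>s. exp ?u * f (upd i x s))"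
    "\<And>s. 0 < exp ?u * f (upd i x s)"
    "set_integrable lborel {0..} (\<lambda>s. exp ?u * f (upd i x s))"
    "continuous_on UNIV (\<lambda>s. g (upd i y s))"
    "\<And>s. 0 < g (upd i y s)"
    "set_integrable lborel {0..} (\<lambda>s. g (upd i y s))"
    using gaussian_dominated_line[OF f, of i x] gaussian_dominated_line[OF g, of i y]
      gaussian_dominatedD(2)[OF f] gaussian_dominatedD(2)[OF g]
    by (auto intro!: continuous_intros)
  define F where "F = (LINT s:{0..}|lborel. f (upd i x s))"
  define G where "G = (LINT s:{0..}|lborel. g (upd i y s))"
  have FG: "exp ?u * F * G \<le> gauss_half\<^sup>2"
    using half_line_santalo_le[OF line_facts dual_bound_upd[of _ _ i x y]] by (simp add: F_def G_def)
  have pos: "0 < F" "0 < G" using gaussian_dominated_line_pos[OF f] gaussian_dominated_line_pos[OF g] by (auto simp: F_def G_def)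
  have xy: "x \<bullet> y = ?u + x $ i * y $ i" using inner_upd_upd[of i x "x $ i" y "y $ i"] by simp
  have "F * G / gauss_half\<^sup>2 = exp (- ?u) * (exp ?u * F * G / gauss_half\<^sup>2)"
    by (simp add: exp_minus)
  also have "\<dots> \<le> exp (- ?u) * 1"
    using FG gauss_half_pos by (intro mult_left_mono) (auto simp: divide_le_eq)
  finally have FG': "F * G / gauss_half\<^sup>2 \<le> exp (- ?u)" by simp
  have eq: "half_symm i f x * half_symm i g y = (F * G / gauss_half\<^sup>2) * (exp (- (x $ i)\<^sup>2 / 2) * exp (- (y $ i)\<^sup>2 / 2))"
    by (simp add: half_symm_def F_def G_def power2_eq_square)
  show "half_symm i f x * half_symm i g y \<le> exp (- (x \<bullet> y))"
  proof -
    have "(F * G / gauss_half\<^sup>2) * (exp (- (x $ i)\<^sup>2 / 2) * exp (- (y $ i)\<^sup>2 / 2)) \<le> exp (- ?u) * exp (- (x $ i * y $ i))"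
      using FG' pos by (intro mult_mono exp_squares_le) auto
    then show ?thesis unfolding eq xy by (simp add: exp_add[symmetric])
  qed
  assume "half_symm i f x * half_symm i g y = exp (- (x \<bullet> y))"
  then have "exp (- ?u) * exp (- (x $ i * y $ i)) = (F * G / gauss_half\<^sup>2) * (exp (- (x $ i)\<^sup>2 / 2) * exp (- (y $ i)\<^sup>2 / 2))"
    unfolding eq xy by (simp add: exp_add[symmetric])
  also have "\<dots> \<le> (F * G / gauss_half\<^sup>2) * exp (- (x $ i * y $ i))"
    using pos by (intro mult_left_mono exp_squares_le) auto
  finally have "exp (- ?u) \<le> F * G / gauss_half\<^sup>2" by (rule mult_right_le_imp_le) simp
  then have "exp (- ?u) = F * G / gauss_half\<^sup>2" using FG' by simp
  then have "exp ?u * F * G = gauss_half\<^sup>2"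
    using gauss_half_pos by (simp add: exp_minus field_simps)
  then have "(LINT s:{0..}|lborel. exp ?u * f (upd i x s)) * (LINT s:{0..}|lborel. g (upd i y s)) = gauss_half\<^sup>2"
    by (simp add: F_def G_def)
  from half_line_santalo_eq[OF line_facts dual_bound_upd[of _ _ i x y] this]
  obtain a c where ac: "0 < a" "0 < c" "\<And>s. 0 \<le> s \<Longrightarrow> exp ?u * f (upd i x s) = a * exp (- (c * s\<^sup>2) / 2)"
    "\<And>s. 0 \<le> s \<Longrightarrow> g (upd i y s) = exp (- s\<^sup>2 / (2 * c)) / a" by blast
  have "f (upd i x s) = (a / exp ?u) * exp (- (c * s\<^sup>2) / 2)" if "0 \<le> s" for s
    using ac(3)[OF that] by (simp add: field_simps)
  then show "\<exists>a>0. \<exists>b>0. \<exists>c>0. \<forall>s\<ge>0. f (upd i x s) = a * exp (- (c * s\<^sup>2) / 2) \<and> g (upd i y s) = b * exp (- s\<^sup>2 / (2 * c))"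
    using ac by (intro exI[of _ "a / exp ?u"] conjI exI[of _ "1 / a"] exI[of _ c]) auto
qed

end

section \<open>Equality in the symmetrization\<close>

text \<open>The condition on inner products says that \<open>B\<close> is the inverse of the adjoint
  of \<open>A\<close>: the quadratic forms of \<open>f\<close> and \<open>g\<close> are dual to each
  other. Stating it this way avoids inverses and matrices and makes the notion visibly
  symmetric.\<close>

definition gaussian_pair :: "('a::euclidean_space \<Rightarrow> real) \<Rightarrow> ('a \<Rightarrow> real) \<Rightarrow> bool" where
  "gaussian_pair f g \<longleftrightarrow> (\<exists>A B :: 'a \<Rightarrow> 'a. \<exists>c>0. linear A \<and> linear B \<and> (\<forall>x y. A x \<bullet> B y = x \<bullet> y) \<and>
     (\<forall>x. f x = c * exp (- (norm (A x))\<^sup>2 / 2)) \<and> (\<forall>y. g y = exp (- (norm (B y))\<^sup>2 / 2) / c))"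

lemma gaussian_pairE:
  fixes f g :: "'a::euclidean_space \<Rightarrow> real"
  assumes "gaussian_pair f g"
  obtains A B :: "'a \<Rightarrow> 'a" and c where "0 < c" "linear A" "linear B" "\<And>x y. A x \<bullet> B y = x \<bullet> y"
    "\<And>x. f x = c * exp (- (norm (A x))\<^sup>2 / 2)" "\<And>y. g y = exp (- (norm (B y))\<^sup>2 / 2) / c"
proof -
  obtain A B :: "'a \<Rightarrow> 'a" and c where "0 < c \<and> linear A \<and> linear B \<and> (\<forall>x y. A x \<bullet> B y = x \<bullet> y) \<and>
     (\<forall>x. f x = c * exp (- (norm (A x))\<^sup>2 / 2)) \<and> (\<forall>y. g y = exp (- (norm (B y))\<^sup>2 / 2) / c)"
    using assms unfolding gaussian_pair_def by (elim exE) (rule that)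
  then show thesis by (intro that[of c A B]) auto
qed

lemma gaussian_pairI:
  fixes f g :: "'a::euclidean_space \<Rightarrow> real" and A B :: "'a \<Rightarrow> 'a"
  assumes "0 < c" "linear A" "linear B" "\<And>x y. A x \<bullet> B y = x \<bullet> y"
    "\<And>x. f x = c * exp (- (norm (A x))\<^sup>2 / 2)" "\<And>y. g y = exp (- (norm (B y))\<^sup>2 / 2) / c"
  shows "gaussian_pair f g"
  unfolding gaussian_pair_def
  by (rule exI[of _ A], rule exI[of _ B], rule exI[of _ c]) (use assms in auto)

lemma gaussian_pair_sym:
  fixes f g :: "'a::euclidean_space \<Rightarrow> real"
  assumes "gaussian_pair f g"
  shows "gaussian_pair g f"
proof -
  obtain A B :: "'a \<Rightarrow> 'a" and c where "0 < c" "linear A" "linear B" "\<And>x y. A x \<bullet> B y = x \<bullet> y"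
    "\<And>x. f x = c * exp (- (norm (A x))\<^sup>2 / 2)" "\<And>y. g y = exp (- (norm (B y))\<^sup>2 / 2) / c"
    by (rule gaussian_pairE[OF assms]) (rule that)
  then show ?thesis
    by (intro gaussian_pairI[of "1 / c" B A]) (auto simp: inner_commute)
qed

text \<open>Choose \<open>y\<close> with \<open>B y = A x\<close>; then
  \<open>x \<bullet> y = A x \<bullet> A x\<close>. So equality in the pairing bound occurs above
  every \<open>x\<close>, which is what lets the pointwise equality analysis reach every
  line.\<close>

lemma gaussian_pair_partner:
  fixes f g :: "'a::euclidean_space \<Rightarrow> real"
  assumes "gaussian_pair f g"
  shows "\<exists>y. f x * g y = exp (- (x \<bullet> y))"
proof -
  obtain A B :: "'a \<Rightarrow> 'a" and c where *: "0 < c" "linear A" "linear B" "\<And>x y. A x \<bullet> B y = x \<bullet> y"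
    "\<And>x. f x = c * exp (- (norm (A x))\<^sup>2 / 2)" "\<And>y. g y = exp (- (norm (B y))\<^sup>2 / 2) / c"
    by (rule gaussian_pairE[OF assms]) (rule that)
  have "inj B"
  proof (rule linear_injective_0[OF *(3), THEN iffD2, rule_format])
    fix y assume "B y = 0"
    then have "x \<bullet> y = 0" for x using *(4)[of x y] by simp
    then show "y = 0" by (metis inner_eq_zero_iff)
  qed
  then have "surj B" using *(3) linear_injective_imp_surjective by blast
  then obtain y where y: "A x = B y" by (metis surjD)
  have "norm (A x) = norm (B y)" using y by simp
  moreover have "(norm (B y))\<^sup>2 = x \<bullet> y" using *(4)[of x y] y by (simp add: dot_square_norm)
  ultimately have "f x * g y = exp (- (x \<bullet> y) / 2) * exp (- (x \<bullet> y) / 2)"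
    using *(1) by (simp add: *(5,6))
  also have "\<dots> = exp (- (x \<bullet> y))" unfolding exp_add[symmetric] by simp
  finally show ?thesis by blast
qed

text \<open>Every line of \<open>f\<close>, and every line of \<open>g\<close>, has a partner at
  which the pairing bound is attained, so both functions are Gaussian on all half-lines, with rates
  that might still vary with the line. The bound between lines that are not partners makes the rate
  uniform; the amplitudes are then read off from the half-line masses.\<close>

lemma half_symm_gaussian:
  fixes f g :: "real ^ 'n \<Rightarrow> real"
  assumes f: "gaussian_dominated f" and g: "gaussian_dominated g"
    and fg: "\<And>x y. f x * g y \<le> exp (- (x \<bullet> y))"
    and gp: "gaussian_pair (half_symm i f) (half_symm i g)"
  shows "\<exists>c>0. \<forall>x s. 0 \<le> s \<longrightarrow>
    f (upd i x s) = half_symm i f (upd i x 0) * sqrt c * exp (- (c * s\<^sup>2) / 2) \<and>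
    g (upd i x s) = half_symm i g (upd i x 0) / sqrt c * exp (- s\<^sup>2 / (2 * c))"
proof -
  have "\<exists>a>0. \<exists>b>0. \<exists>c>0. \<exists>y. \<forall>s\<ge>0. f (upd i x s) = a * exp (- (c * s\<^sup>2) / 2) \<and> g (upd i y s) = b * exp (- s\<^sup>2 / (2 * c))" for x
    using half_symm_pair_eq[OF f g fg] gaussian_pair_partner[OF gp, of x] by metis
  then obtain fa fb fc fy where F: "\<And>x. 0 < fa x" "\<And>x. 0 < fb x" "\<And>x. 0 < fc x"
    "\<And>x s. 0 \<le> s \<Longrightarrow> f (upd i x s) = fa x * exp (- (fc x * s\<^sup>2) / 2)"
    "\<And>x s. 0 \<le> s \<Longrightarrow> g (upd i (fy x) s) = fb x * exp (- s\<^sup>2 / (2 * fc x))"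
    by metis
  have "\<exists>a>0. \<exists>b>0. \<exists>c>0. \<exists>x. \<forall>s\<ge>0. f (upd i x s) = a * exp (- (c * s\<^sup>2) / 2) \<and> g (upd i y s) = b * exp (- s\<^sup>2 / (2 * c))" for y
  proof -
    obtain x where "half_symm i g y * half_symm i f x = exp (- (y \<bullet> x))"
      using gaussian_pair_partner[OF gaussian_pair_sym[OF gp], of y] by blast
    then have "half_symm i f x * half_symm i g y = exp (- (x \<bullet> y))" by (simp add: mult.commute inner_commute)
    from half_symm_pair_eq[OF f g fg this] show ?thesis by blast
  qed
  then obtain ga gb gc gx where G: "\<And>y. 0 < ga y" "\<And>y. 0 < gb y" "\<And>y. 0 < gc y"
    "\<And>y s. 0 \<le> s \<Longrightarrow> f (upd i (gx y) s) = ga y * exp (- (gc y * s\<^sup>2) / 2)"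
    "\<And>y s. 0 \<le> s \<Longrightarrow> g (upd i y s) = gb y * exp (- s\<^sup>2 / (2 * gc y))"
    by metis
  text \<open>Unless \<open>c \<ge> c'\<close>, the bound \<open>f * g \<le> exp (- x \<bullet> y)\<close> fails along \<open>(s, c' s)\<close> as \<open>s \<rightarrow> \<infinity>\<close>.\<close>
  have rate: "c' \<le> c"
    if f': "\<And>s. 0 \<le> s \<Longrightarrow> f (upd i x s) = a * exp (- (c * s\<^sup>2) / 2)"
      and g': "\<And>s. 0 \<le> s \<Longrightarrow> g (upd i y s) = b * exp (- s\<^sup>2 / (2 * c'))"
      and pos: "0 < a" "0 < b" "0 < c'" for x y a b c c'
  proof (rule ccontr)
    assume "\<not> c' \<le> c"
    define k where "k = exp (upd i x 0 \<bullet> upd i y 0) * a * b"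
    have k: "0 < k" using pos by (simp add: k_def)
    have le: "k \<le> exp (- ((c' - c) / 2 * s\<^sup>2))" if "0 \<le> s" for s
    proof -
      have "exp (upd i x 0 \<bullet> upd i y 0) * f (upd i x s) * g (upd i y (c' * s)) \<le> exp (- (s * (c' * s)))"
        using that pos by (intro dual_bound_upd[OF f g fg]) auto
      moreover have "exp (upd i x 0 \<bullet> upd i y 0) * f (upd i x s) * g (upd i y (c' * s)) =
          k * (exp (- (c * s\<^sup>2) / 2) * exp (- (c' * s)\<^sup>2 / (2 * c')))"
        using f'[of s] g'[of "c' * s"] that pos by (simp add: k_def)
      moreover have "exp (- (c * s\<^sup>2) / 2) * exp (- (c' * s)\<^sup>2 / (2 * c')) = exp (- ((c + c') / 2 * s\<^sup>2))"
        unfolding exp_add[symmetric] using pos by (simp add: field_simps power2_eq_square)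
      ultimately have "k * exp (- ((c + c') / 2 * s\<^sup>2)) \<le> exp (- (s * (c' * s)))" by simp
      also have "\<dots> = exp (- ((c' - c) / 2 * s\<^sup>2)) * exp (- ((c + c') / 2 * s\<^sup>2))"
        unfolding exp_add[symmetric] by (simp add: field_simps power2_eq_square)
      finally show ?thesis by (rule mult_right_le_imp_le) simp
    qed
    have "filterlim (\<lambda>s::real. (c' - c) / 2 * s\<^sup>2) at_top at_top"
      using \<open>\<not> c' \<le> c\<close>
      by (intro filterlim_tendsto_pos_mult_at_top[OF tendsto_const] filterlim_pow_at_top filterlim_ident) auto
    then have "((\<lambda>s. exp (- ((c' - c) / 2 * s\<^sup>2))) \<longlongrightarrow> 0) at_top"
      by (intro filterlim_compose[OF exp_at_bot] filterlim_compose[OF filterlim_uminus_at_bot_at_top])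
    then have "k \<le> 0"
      by (rule tendsto_lowerbound[OF _ eventually_at_top_linorderI[of 0]]) (use le in auto)
    with k show False by simp
  qed
  define c where "c = fc 0"
  have c: "0 < c" by (simp add: c_def F)
  \<comment> \<open>Each inequality compares the \<open>f\<close>-line of one point with the partner
    \<open>g\<close>-line of the other; exchanging the points gives the reverse inequality.\<close>
  have fc: "fc x = c" for x
  proof (rule antisym)
    show "fc x \<le> c" unfolding c_def by (rule rate[OF F(4) F(5)]) (use F in auto)
    show "c \<le> fc x" unfolding c_def by (rule rate[OF F(4) F(5)]) (use F in auto)
  qed
  have gc: "gc y = c" for y
  proof (rule antisym)
    show "gc y \<le> c" unfolding c_def by (rule rate[OF F(4) G(5)]) (use F G in auto)
    show "c \<le> gc y" unfolding c_def by (rule rate[OF G(4) F(5)]) (use F G in auto)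
  qed
  have I: "(LINT s:{0..}|lborel. a * exp (- (d * s\<^sup>2) / 2)) = a * gauss_half / sqrt d" if "0 < d" for a d :: real
  proof -
    have "gauss_half = sqrt d * (LINT s|lborel. indicator {0..} (0 + sqrt d * s) * exp (- (0 + sqrt d * s)\<^sup>2 / 2))"
      unfolding gauss_half_def set_lebesgue_integral_def
      by (subst lborel_integral_real_affine[where c="sqrt d" and t=0]) (use that in auto)
    also have "(LINT s|lborel. indicator {0..} (0 + sqrt d * s) * exp (- (0 + sqrt d * s)\<^sup>2 / 2)) =
        (LINT s:{0..}|lborel. exp (- (d * s\<^sup>2) / 2))"
      unfolding set_lebesgue_integral_def using that
      by (intro Bochner_Integration.integral_cong) (auto simp: indicator_def power_mult_distrib zero_le_mult_iff)
    finally show ?thesis using that by (simp add: field_simps)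
  qed
  have hf: "half_symm i f (upd i x 0) * sqrt c = fa x" for x
  proof -
    have "(LINT s:{0..}|lborel. f (upd i x s)) = (LINT s:{0..}|lborel. fa x * exp (- (c * s\<^sup>2) / 2))"
      by (intro set_lebesgue_integral_cong) (auto simp: F(4) fc)
    then show ?thesis using I[OF c, of "fa x"] c gauss_half_pos by (simp add: half_symm_def)
  qed
  have hg: "half_symm i g (upd i y 0) / sqrt c = gb y" for y
  proof -
    have "(LINT s:{0..}|lborel. g (upd i y s)) = (LINT s:{0..}|lborel. gb y * exp (- ((1 / c) * s\<^sup>2) / 2))"
      by (intro set_lebesgue_integral_cong) (auto simp: G(5) gc field_simps)
    then show ?thesis using I[of "1 / c" "gb y"] c gauss_half_pos G(2)[of y]
      by (simp add: half_symm_def real_sqrt_divide field_simps)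
  qed
  show ?thesis
    by (intro exI[of _ c] conjI c allI impI) (auto simp: hf hg F(4) G(5) fc gc)
qed

section \<open>Reflections and functions that are Gaussian in some of the coordinates\<close>

definition reflect :: "'n \<Rightarrow> real ^ 'n \<Rightarrow> real ^ 'n" where
  "reflect i x = upd i x (- (x $ i))"

lemma reflect_simps [simp]:
  "reflect i (reflect i x) = x" "reflect i x $ j = (if j = i then - (x $ j) else x $ j)"
  "reflect i (upd i x s) = upd i x (- s)"
  by (auto simp: reflect_def vec_eq_iff)

lemma linear_reflect: "linear (reflect i)"
  by (rule linearI) (auto simp: reflect_def vec_eq_iff)

lemma inj_reflect: "inj (reflect i)"
  by (metis injI reflect_simps(1))

lemma inner_reflect: "reflect i x \<bullet> reflect i y = x \<bullet> y"
  using inner_upd_upd[of i x "x $ i" y "y $ i"] inner_upd_upd[of i x "- (x $ i)" y "- (y $ i)"]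
  by (simp add: reflect_def)

lemma lborel_reflect: "distr lborel borel (reflect i) = (lborel :: (real ^ 'n) measure)"
proof (rule measure_eqI)
  have [measurable]: "reflect i \<in> borel_measurable borel"
    unfolding reflect_def by measurable
  obtain r :: "real \<Rightarrow> ennreal" where r[measurable]: "r \<in> borel_measurable borel" and r1: "(\<integral>\<^sup>+s. r s \<partial>lborel) = 1"
    using ex_density by blast
  fix A assume "A \<in> sets (distr lborel borel (reflect i))"
  then have A[measurable]: "A \<in> sets borel" by simp
  have "emeasure (distr lborel borel (reflect i)) A = (\<integral>\<^sup>+x. indicator A (reflect i x) \<partial>lborel)"
    by (subst nn_integral_indicator[symmetric], simp, subst nn_integral_distr) auto
  also have "\<dots> = (\<integral>\<^sup>+x. r (x $ i) * (\<integral>\<^sup>+s. indicator A (upd i x (0 + (-1) * s)) \<partial>lborel) \<partial>lborel)"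
    by (subst nn_integral_resample[of "\<lambda>x. indicator A (reflect i x)" r i, OF _ r r1, symmetric]) auto
  also have "\<dots> = (\<integral>\<^sup>+x. r (x $ i) * (\<integral>\<^sup>+s. indicator A (upd i x s) \<partial>lborel) \<partial>lborel)"
    by (subst (2) nn_integral_real_affine[where c="-1" and t=0]) auto
  also have "\<dots> = (\<integral>\<^sup>+x. indicator A x \<partial>lborel)" by (rule nn_integral_resample[OF _ r r1]) simp
  finally show "emeasure (distr lborel borel (reflect i)) A = emeasure lborel A" by simp
qed simp

lemma integral_measure_preserving:
  fixes h :: "'a::euclidean_space \<Rightarrow> real"
  assumes T: "T \<in> borel_measurable borel" "distr lborel borel T = (lborel :: 'a measure)" and h: "h \<in> borel_measurable borel"
  shows "(LINT x|lborel. h (T x)) = (LINT x|lborel. h x)"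
proof -
  have "(LINT x|lborel. h x) = (LINT x|distr lborel borel T. h x)" by (simp add: T)
  also have "\<dots> = (LINT x|lborel. h (T x))" using T h by (intro integral_distr) auto
  finally show ?thesis by simp
qed

lemma measurable_linear: "linear T \<Longrightarrow> T \<in> borel_measurable borel"
  for T :: "'a::euclidean_space \<Rightarrow> 'b::euclidean_space"
  by (intro borel_measurable_continuous_onI linear_continuous_on) (simp add: linear_conv_bounded_linear)

text \<open>In each coordinate outside \<open>I\<close>, \<open>f\<close> is a standard Gaussian
  factor times something independent of that coordinate. \<open>I\<close> holds the coordinates
  still to be symmetrized and is the set on which the induction runs.\<close>

definition gaussian_off :: "'n set \<Rightarrow> (real ^ 'n \<Rightarrow> real) \<Rightarrow> bool" where
  "gaussian_off I f \<longleftrightarrow> (\<forall>j. j \<notin> I \<longrightarrow> (\<forall>x t. f (upd j x t) * exp (t\<^sup>2 / 2) = f x * exp ((x $ j)\<^sup>2 / 2)))"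

text \<open>The coordinates are set to zero one after the other, each contributing its own Gaussian
  factor.\<close>

lemma gaussian_off_empty:
  assumes f: "gaussian_off {} f"
  shows "f x = f 0 * exp (- (norm x)\<^sup>2 / 2)"
proof -
  have "f x * exp ((\<Sum>j\<in>J. (x $ j)\<^sup>2) / 2) = f (\<chi> j. if j \<in> J then 0 else x $ j)" if "finite J" for J
    using that
  proof (induction J)
    case (insert k J)
    let ?y = "\<chi> j. if j \<in> J then 0 else x $ j"
    have "upd k ?y 0 = (\<chi> j. if j \<in> insert k J then 0 else x $ j)" by (auto simp: vec_eq_iff)
    moreover have "f (upd k ?y 0) * exp (0\<^sup>2 / 2) = f ?y * exp ((?y $ k)\<^sup>2 / 2)"
      using f unfolding gaussian_off_def by blast
    ultimately have "f (\<chi> j. if j \<in> insert k J then 0 else x $ j) = f x * (exp ((\<Sum>j\<in>J. (x $ j)\<^sup>2) / 2) * exp ((x $ k)\<^sup>2 / 2))"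
      using insert by simp
    then show ?case using insert by (simp add: exp_add[symmetric] add_divide_distrib add.commute)
  qed simp
  from this[of UNIV] have "f x * exp ((norm x)\<^sup>2 / 2) = f 0"
    by (simp add: norm_vec_def L2_set_def sum_nonneg zero_vec_def)
  then show ?thesis by (simp add: exp_minus field_simps)
qed

lemma upd_commute: "i \<noteq> j \<Longrightarrow> upd i (upd j x t) s = upd j (upd i x s) t"
  by (auto simp: vec_eq_iff)

lemma gaussian_off_half_symm:
  assumes f: "gaussian_off (insert i I) f"
  shows "gaussian_off I (half_symm i f)"
  unfolding gaussian_off_def
proof (intro allI impI)
  fix j x t assume j: "j \<notin> I"
  show "half_symm i f (upd j x t) * exp (t\<^sup>2 / 2) = half_symm i f x * exp ((x $ j)\<^sup>2 / 2)"
  proof (cases "j = i")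
    case True
    then show ?thesis by (simp add: half_symm_def exp_minus)
  next
    case False
    then have "f (upd i (upd j x t) s) * exp (t\<^sup>2 / 2) = f (upd i x s) * exp ((x $ j)\<^sup>2 / 2)" for s
      using f j upd_commute[of i j x t s] unfolding gaussian_off_def by (metis insert_iff upd_nth)
    then have "(LINT s:{0..}|lborel. f (upd i (upd j x t) s) * exp (t\<^sup>2 / 2)) = (LINT s:{0..}|lborel. f (upd i x s) * exp ((x $ j)\<^sup>2 / 2))"
      by simp
    then show ?thesis using False by (simp add: half_symm_def mult.commute)
  qed
qed

lemma gaussian_off_reflect:
  assumes f: "gaussian_off I f" and i: "i \<in> I"
  shows "gaussian_off I (\<lambda>x. f (reflect i x))"
  unfolding gaussian_off_def
proof (intro allI impI)
  fix j x t assume j: "j \<notin> I"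
  then have "reflect i (upd j x t) = upd j (reflect i x) t" using i by (auto simp: vec_eq_iff)
  moreover have "reflect i x $ j = x $ j" using i j by auto
  ultimately show "f (reflect i (upd j x t)) * exp (t\<^sup>2 / 2) = f (reflect i x) * exp ((x $ j)\<^sup>2 / 2)"
    using f j unfolding gaussian_off_def by metis
qed

text \<open>Equals \<open>(2 * pi) powr (n / 2)\<close> in dimension n, so its square is the
  constant of the functional inequality.\<close>

definition gauss_total :: "'a::euclidean_space itself \<Rightarrow> real" where
  "gauss_total _ = (LINT x::'a|lborel. exp (- (norm x)\<^sup>2 / 2))"

section \<open>The functional Santalo inequality\<close>

lemma integral_pos_open:
  fixes h :: "'a::euclidean_space \<Rightarrow> real"
  assumes int: "integrable lborel h" and nn: "\<And>x. 0 \<le> h x"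
    and U: "open U" "U \<noteq> {}" "\<And>x. x \<in> U \<Longrightarrow> 0 < h x"
  shows "0 < (LINT x|lborel. h x)"
proof (rule ccontr)
  assume "\<not> ?thesis"
  moreover have "0 \<le> (LINT x|lborel. h x)" using nn by simp
  ultimately have "(LINT x|lborel. h x) = 0" by simp
  then have "AE x in lborel. h x = 0" using int nn by (subst (asm) integral_nonneg_eq_0_iff_AE) auto
  then have "AE x in lborel. x \<notin> U" using U(3) by (auto elim!: eventually_mono) force
  then have "U \<in> null_sets lborel" using U(1) by (subst AE_iff_null_sets) auto
  then have "negligible U" by (simp add: negligible_iff_null_sets null_sets_completionI)
  then show False using open_not_negligible U by blast
qed

lemma AE_nth_neq: "AE x in lborel. (x :: real ^ 'n) $ i \<noteq> r"
proof -
  obtain q :: "real \<Rightarrow> ennreal" where q: "q \<in> borel_measurable borel" "(\<integral>\<^sup>+s. q s \<partial>lborel) = 1"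
    using ex_density by blast
  have "closed {x :: real ^ 'n. x $ i = r}" by (intro closed_Collect_eq continuous_intros)
  then have m[measurable]: "{x :: real ^ 'n. x $ i = r} \<in> sets borel" by (rule borel_closed)
  have "emeasure lborel {x :: real ^ 'n. x $ i = r} = (\<integral>\<^sup>+x. indicator {x :: real ^ 'n. x $ i = r} x \<partial>lborel)"
    by simp
  also have "\<dots> = (\<integral>\<^sup>+x. q (x $ i) * (\<integral>\<^sup>+s. indicator {x :: real ^ 'n. x $ i = r} (upd i x s) \<partial>lborel) \<partial>lborel)"
    by (rule nn_integral_resample[OF _ q, symmetric]) simp
  also have "\<dots> = (\<integral>\<^sup>+(x :: real ^ 'n). 0 \<partial>lborel)"
  proof (rule nn_integral_cong)
    fix x :: "real ^ 'n"
    have "(\<integral>\<^sup>+s. indicator {x. x $ i = r} (upd i x s) \<partial>lborel) = (\<integral>\<^sup>+s. indicator {r} s \<partial>lborel)"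
      by (intro nn_integral_cong) (auto simp: indicator_def)
    then show "q (x $ i) * (\<integral>\<^sup>+s. indicator {x. x $ i = r} (upd i x s) \<partial>lborel) = 0" by simp
  qed
  finally have "emeasure lborel {x :: real ^ 'n. x $ i = r} = 0" by simp
  then have "{x :: real ^ 'n. x $ i = r} \<in> null_sets lborel" using m by (auto simp: null_sets_def)
  then show ?thesis using AE_not_in by force
qed

lemma upper_half_space_measurable [measurable]: "{x :: real ^ 'n. r \<le> x $ i} \<in> sets borel"
  by (rule borel_closed) (intro closed_Collect_le continuous_intros)

lemma measurable_reflect [measurable]: "reflect i \<in> borel_measurable borel"
  by (rule measurable_linear[OF linear_reflect])

lemma integral_reflect_split:
  fixes f :: "real ^ 'n \<Rightarrow> real"
  assumes f: "integrable lborel f"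
  shows "(LINT x|lborel. f x) = (LINT x|lborel. indicator {x. 0 \<le> x $ i} x * f x) +
    (LINT x|lborel. indicator {x. 0 \<le> x $ i} x * f (reflect i x))"
proof -
  have [measurable]: "f \<in> borel_measurable borel" using f by (auto dest: borel_measurable_integrable)
  have int: "integrable lborel (\<lambda>x. indicator A x * f x)" if "A \<in> sets borel" for A
    using integrable_mult_indicator[OF _ f, of A] that by simp
  have le: "{x :: real ^ 'n. x $ i \<le> 0} \<in> sets borel"
    by (rule borel_closed) (intro closed_Collect_le continuous_intros)
  have "(LINT x|lborel. f x) = (LINT x|lborel. indicator {x. 0 \<le> x $ i} x * f x + indicator {x. x $ i \<le> 0} x * f x)"
    using AE_nth_neq[of i 0] le by (intro integral_cong_AE) (auto elim!: eventually_mono simp: indicator_def)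
  also have "\<dots> = (LINT x|lborel. indicator {x. 0 \<le> x $ i} x * f x) + (LINT x|lborel. indicator {x. x $ i \<le> 0} x * f x)"
    using le by (intro Bochner_Integration.integral_add int) auto
  also have "(LINT x|lborel. indicator {x. x $ i \<le> 0} x * f x) =
      (LINT x|lborel. indicator {x. x $ i \<le> 0} (reflect i x) * f (reflect i x))"
    using le by (intro integral_measure_preserving[symmetric] lborel_reflect) auto
  also have "\<dots> = (LINT x|lborel. indicator {x. 0 \<le> x $ i} x * f (reflect i x))"
    by (intro Bochner_Integration.integral_cong) (auto simp: indicator_def)
  finally show ?thesis .
qed

text \<open>Moments are prescribed only in the coordinates of \<open>I\<close>: outside
  \<open>I\<close> the function is even in each coordinate, so those moments vanish by themselves.
  The equality case is carried along because it has to be traced back through every step.\<close>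

definition santalo_on :: "'n::finite set \<Rightarrow> bool" where
  "santalo_on I \<longleftrightarrow> (\<forall>f g :: real ^ 'n \<Rightarrow> real. gaussian_dominated f \<longrightarrow> gaussian_dominated g \<longrightarrow>
     gaussian_off I f \<longrightarrow> gaussian_off I g \<longrightarrow> (\<forall>x y. f x * g y \<le> exp (- (x \<bullet> y))) \<longrightarrow>
     (\<forall>j\<in>I. (LINT x|lborel. x $ j * f x) = 0) \<longrightarrow>
     (LINT x|lborel. f x) * (LINT x|lborel. g x) \<le> (gauss_total TYPE(real ^ 'n))\<^sup>2 \<and>
     ((LINT x|lborel. f x) * (LINT x|lborel. g x) = (gauss_total TYPE(real ^ 'n))\<^sup>2 \<longrightarrow> gaussian_pair f g))"

lemma santalo_onD:
  fixes f g :: "real ^ 'n \<Rightarrow> real"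
  assumes "santalo_on I" "gaussian_dominated f" "gaussian_dominated g"
    "gaussian_off I f" "gaussian_off I g" "\<And>x y. f x * g y \<le> exp (- (x \<bullet> y))"
    "\<And>j. j \<in> I \<Longrightarrow> (LINT x|lborel. x $ j * f x) = 0"
  shows "(LINT x|lborel. f x) * (LINT x|lborel. g x) \<le> (gauss_total TYPE(real ^ 'n))\<^sup>2"
    and "(LINT x|lborel. f x) * (LINT x|lborel. g x) = (gauss_total TYPE(real ^ 'n))\<^sup>2 \<Longrightarrow> gaussian_pair f g"
  using assms unfolding santalo_on_def by blast+

lemma gaussian_dominated_integral_pos:
  assumes f: "gaussian_dominated f"
  shows "0 < (LINT x|lborel. f x)"
  by (rule integral_pos_open[of _ UNIV])
    (auto intro: gaussian_dominated_integrable f gaussian_dominatedD(2)[OF f] less_imp_le)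

text \<open>Symmetrizing \<open>f\<close> and its reflection gives two functions of the same mass
  \<open>?F\<close>, because the hyperplane bisects \<open>f\<close>, whereas the two
  symmetrizations of \<open>g\<close> have masses \<open>Gp\<close> and \<open>Gm\<close> with mean
  \<open>?G\<close>. So \<open>?F * ?G\<close> is the mean of \<open>?F * Gp\<close> and
  \<open>?F * Gm\<close>, and the induction hypothesis bounds both. In the equality case both bounds
  are attained, each half is Gaussian, and the halves must be glued.\<close>

lemma santalo_balanced:
  fixes f g :: "real ^ 'n \<Rightarrow> real"
  assumes IH: "santalo_on I" and i: "i \<notin> I"
    and f: "gaussian_dominated f" "gaussian_off (insert i I) f"
    and g: "gaussian_dominated g" "gaussian_off (insert i I) g"
    and fg: "\<And>x y. f x * g y \<le> exp (- (x \<bullet> y))"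
    and bal: "(LINT x|lborel. indicator {x. 0 \<le> x $ i} x * f x) = (LINT x|lborel. indicator {x. 0 \<le> x $ i} x * f (reflect i x))"
    and cen: "\<And>j. j \<in> I \<Longrightarrow> (LINT x|lborel. indicator {x. 0 \<le> x $ i} x * (x $ j * f x)) = 0"
      "\<And>j. j \<in> I \<Longrightarrow> (LINT x|lborel. indicator {x. 0 \<le> x $ i} x * (x $ j * f (reflect i x))) = 0"
  shows "(LINT x|lborel. f x) * (LINT x|lborel. g x) \<le> (gauss_total TYPE(real ^ 'n))\<^sup>2"
    and "(LINT x|lborel. f x) * (LINT x|lborel. g x) = (gauss_total TYPE(real ^ 'n))\<^sup>2 \<Longrightarrow> gaussian_pair f g"
proof -
  define W where "W = (gauss_total TYPE(real ^ 'n))\<^sup>2"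
  define f' where "f' x = f (reflect i x)" for x
  define g' where "g' x = g (reflect i x)" for x
  have f': "gaussian_dominated f'" "gaussian_off (insert i I) f'"
    unfolding f'_def
    by (rule gaussian_dominated_linear[OF f(1) linear_reflect inj_reflect], rule gaussian_off_reflect[OF f(2)]) simp
  have g': "gaussian_dominated g'" "gaussian_off (insert i I) g'"
    unfolding g'_def
    by (rule gaussian_dominated_linear[OF g(1) linear_reflect inj_reflect], rule gaussian_off_reflect[OF g(2)]) simp
  have fg': "f' x * g' y \<le> exp (- (x \<bullet> y))" for x y
    unfolding f'_def g'_def using fg[of "reflect i x" "reflect i y"] by (simp add: inner_reflect)
  let ?F = "LINT x|lborel. f x" and ?G = "LINT x|lborel. g x"
  have F: "?F = (LINT x|lborel. indicator {x. 0 \<le> x $ i} x * f x) + (LINT x|lborel. indicator {x. 0 \<le> x $ i} x * f' x)"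
    unfolding f'_def by (rule integral_reflect_split[OF gaussian_dominated_integrable[OF f(1)]])
  have G: "?G = (LINT x|lborel. indicator {x. 0 \<le> x $ i} x * g x) + (LINT x|lborel. indicator {x. 0 \<le> x $ i} x * g' x)"
    unfolding g'_def by (rule integral_reflect_split[OF gaussian_dominated_integrable[OF g(1)]])
  have Fp: "(LINT x|lborel. half_symm i f x) = ?F" and Fm: "(LINT x|lborel. half_symm i f' x) = ?F"
    using F bal by (simp_all add: integral_half_symm f f' f'_def[symmetric])
  define Gp where "Gp = (LINT x|lborel. half_symm i g x)"
  define Gm where "Gm = (LINT x|lborel. half_symm i g' x)"
  have GG: "Gp + Gm = 2 * ?G" using G by (simp add: Gp_def Gm_def integral_half_symm g g')
  have nth: "(LINT x|lborel. x $ j * half_symm i f x) = 0" "(LINT x|lborel. x $ j * half_symm i f' x) = 0"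
    if "j \<in> I" for j
  proof -
    have "j \<noteq> i" using that i by auto
    then show "(LINT x|lborel. x $ j * half_symm i f x) = 0" "(LINT x|lborel. x $ j * half_symm i f' x) = 0"
      using cen[OF that] by (simp_all add: integral_half_symm_nth f f' f'_def[symmetric])
  qed
  note P = santalo_onD[OF IH half_symm_dominated[OF f(1), of i] half_symm_dominated[OF g(1), of i]
      gaussian_off_half_symm[OF f(2)] gaussian_off_half_symm[OF g(2)] half_symm_pair[OF f(1) g(1) fg] nth(1),
      unfolded Fp Gp_def[symmetric], folded W_def]
  note M = santalo_onD[OF IH half_symm_dominated[OF f'(1), of i] half_symm_dominated[OF g'(1), of i]
      gaussian_off_half_symm[OF f'(2)] gaussian_off_half_symm[OF g'(2)] half_symm_pair[OF f'(1) g'(1) fg'] nth(2),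
      unfolded Fm Gm_def[symmetric], folded W_def]
  have sum: "2 * (?F * ?G) = ?F * Gp + ?F * Gm"
    unfolding distrib_left[symmetric] GG by simp
  show "?F * ?G \<le> (gauss_total TYPE(real ^ 'n))\<^sup>2" using sum P(1) M(1) unfolding W_def[symmetric] by simp
  assume "?F * ?G = (gauss_total TYPE(real ^ 'n))\<^sup>2"
  then have "?F * Gp = W" "?F * Gm = W" using sum P(1) M(1) unfolding W_def[symmetric] by simp_all
  then have gp: "gaussian_pair (half_symm i f) (half_symm i g)" and gp': "gaussian_pair (half_symm i f') (half_symm i g')"
    using P(2) M(2) by auto
  obtain c where c: "0 < c"
    "\<And>x s. 0 \<le> s \<Longrightarrow> f (upd i x s) = half_symm i f (upd i x 0) * sqrt c * exp (- (c * s\<^sup>2) / 2)"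
    "\<And>x s. 0 \<le> s \<Longrightarrow> g (upd i x s) = half_symm i g (upd i x 0) / sqrt c * exp (- s\<^sup>2 / (2 * c))"
    using half_symm_gaussian[OF f(1) g(1) fg gp] by blast
  obtain d where d: "0 < d"
    "\<And>x s. 0 \<le> s \<Longrightarrow> f' (upd i x s) = half_symm i f' (upd i x 0) * sqrt d * exp (- (d * s\<^sup>2) / 2)"
    "\<And>x s. 0 \<le> s \<Longrightarrow> g' (upd i x s) = half_symm i g' (upd i x 0) / sqrt d * exp (- s\<^sup>2 / (2 * d))"
    using half_symm_gaussian[OF f'(1) g'(1) fg' gp'] by blast
  \<comment> \<open>Both half-lines start at the same point of the hyperplane, so the values at 0
    agree. Integrated, this compares \<open>?F * sqrt c\<close> with \<open>?F * sqrt d\<close>, and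
    the rates of the two halves coincide.\<close>
  have zero: "half_symm i f (upd i x 0) * sqrt c = half_symm i f' (upd i x 0) * sqrt d"
    "half_symm i g (upd i x 0) / sqrt c = half_symm i g' (upd i x 0) / sqrt d" for x
    using c(2,3)[of 0 x] d(2,3)[of 0 x] by (simp_all add: f'_def g'_def)
  have "half_symm i f x * sqrt c = half_symm i f' x * sqrt d" for x
    using zero(1)[of x] half_symm_upd[of i f x "x $ i"] half_symm_upd[of i f' x "x $ i"] by (simp add: mult_ac)
  then have "(LINT x|lborel. half_symm i f x * sqrt c) = (LINT x|lborel. half_symm i f' x * sqrt d)" by simp
  then have "?F * sqrt c = ?F * sqrt d" by (simp add: Fp Fm)
  then have dc: "d = c" using gaussian_dominated_integral_pos[OF f(1)] by simp
  have full: "f (upd i x s) = half_symm i f (upd i x 0) * sqrt c * exp (- (c * s\<^sup>2) / 2)"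
    "g (upd i x s) = half_symm i g (upd i x 0) / sqrt c * exp (- s\<^sup>2 / (2 * c))" for x s
  proof (atomize (full), cases "0 \<le> s")
    case False
    then have s: "0 \<le> - s" by simp
    show "f (upd i x s) = half_symm i f (upd i x 0) * sqrt c * exp (- (c * s\<^sup>2) / 2) \<and>
      g (upd i x s) = half_symm i g (upd i x 0) / sqrt c * exp (- s\<^sup>2 / (2 * c))"
      using d(2)[OF s, of x] d(3)[OF s, of x] zero[of x] c(1) unfolding dc by (simp add: f'_def g'_def)
  qed (use c in auto)
  \<comment> \<open>Stretching the \<open>i\<close>-th coordinate by \<open>sqrt c\<close> turns the
    standard Gaussian factor of the symmetrized function into the one of rate \<open>c\<close>; the
    inverse stretch on the side of \<open>g\<close> preserves the duality of \<open>A\<close> and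
    \<open>B\<close>.\<close>
  define D where "D t x = upd i x (t * x $ i)" for t and x :: "real ^ 'n"
  have linD: "linear (D t)" for t
    by (rule linearI) (auto simp: D_def vec_eq_iff distrib_left)
  obtain A B :: "real ^ 'n \<Rightarrow> real ^ 'n" and k where k: "0 < k" "linear A" "linear B" "\<And>x y. A x \<bullet> B y = x \<bullet> y"
    "\<And>x. half_symm i f x = k * exp (- (norm (A x))\<^sup>2 / 2)" "\<And>y. half_symm i g y = exp (- (norm (B y))\<^sup>2 / 2) / k"
    by (rule gaussian_pairE[OF gp]) (rule that)
  show "gaussian_pair f g"
  proof (rule gaussian_pairI[of "sqrt c * k" "\<lambda>x. A (D (sqrt c) x)" "\<lambda>x. B (D (1 / sqrt c) x)"])
    show "0 < sqrt c * k" using k c by simp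
    show "linear (\<lambda>x. A (D (sqrt c) x))" "linear (\<lambda>x. B (D (1 / sqrt c) x))"
      using linear_compose[OF linD k(2)] linear_compose[OF linD k(3)] by (auto simp: o_def)
    show "A (D (sqrt c) x) \<bullet> B (D (1 / sqrt c) y) = x \<bullet> y" for x y
      using c inner_upd_upd[of i x "x $ i" y "y $ i"] inner_upd_upd[of i x "sqrt c * x $ i" y "1 / sqrt c * y $ i"]
      by (simp add: k D_def)
    show "f x = sqrt c * k * exp (- (norm (A (D (sqrt c) x)))\<^sup>2 / 2)" for x
    proof -
      have "f x = sqrt c * (half_symm i f (upd i x 0) * exp (- (sqrt c * x $ i)\<^sup>2 / 2))"
        using full(1)[of x "x $ i"] c by (simp add: power_mult_distrib)
      also have "half_symm i f (upd i x 0) * exp (- (sqrt c * x $ i)\<^sup>2 / 2) = half_symm i f (D (sqrt c) x)"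
        unfolding D_def by (rule half_symm_upd[symmetric])
      finally show ?thesis by (simp add: k)
    qed
    show "g x = exp (- (norm (B (D (1 / sqrt c) x)))\<^sup>2 / 2) / (sqrt c * k)" for x
    proof -
      have "g x = (half_symm i g (upd i x 0) * exp (- (1 / sqrt c * x $ i)\<^sup>2 / 2)) / sqrt c"
        using full(2)[of x "x $ i"] c by (simp add: power_mult_distrib power_divide mult.commute)
      also have "half_symm i g (upd i x 0) * exp (- (1 / sqrt c * x $ i)\<^sup>2 / 2) = half_symm i g (D (1 / sqrt c) x)"
        unfolding D_def by (rule half_symm_upd[symmetric])
      finally show ?thesis by (simp add: k)
    qed
  qed
qed

section \<open>Bisection, tilting and centring\<close>

text \<open>The mass above the hyperplane depends continuously on its height, because hyperplanes
  are null sets, and runs from the full mass to 0; the intermediate value theorem applies.\<close>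

lemma bisecting_coordinate:
  fixes g :: "real ^ 'n \<Rightarrow> real"
  assumes g: "integrable lborel g" "\<And>x. 0 \<le> g x"
  shows "\<exists>r. (LINT x|lborel. indicator {x. r \<le> x $ i} x * g x) = (LINT x|lborel. g x) / 2"
proof (cases "(LINT x|lborel. g x) = 0")
  case True
  then have "AE x in lborel. g x = 0" using g by (subst (asm) integral_nonneg_eq_0_iff_AE) auto
  then have "AE x in lborel. indicator {x. 0 \<le> x $ i} x * g x = 0" by (auto elim!: eventually_mono)
  then have "(LINT x|lborel. indicator {x. 0 \<le> x $ i} x * g x) = 0" by (rule integral_eq_zero_AE)
  then show ?thesis using True by auto
next
  case False
  then have pos: "0 < (LINT x|lborel. g x)" using g by (simp add: less_le)
  have [measurable]: "g \<in> borel_measurable borel" using g by (auto dest: borel_measurable_integrable)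
  define M where "M r = (LINT x|lborel. indicator {x. r \<le> x $ i} x * g x)" for r
  have cont: "continuous_on UNIV M"
  proof (rule continuous_on_sequentiallyI)
    fix u r assume u: "u \<longlonglongrightarrow> (r :: real)"
    show "(\<lambda>n. M (u n)) \<longlonglongrightarrow> M r"
      unfolding M_def
    proof (rule integral_dominated_convergence[where w=g])
      show "AE x in lborel. (\<lambda>n. indicator {x. u n \<le> x $ i} x * g x) \<longlonglongrightarrow> indicator {x. r \<le> x $ i} x * g x"
        using AE_nth_neq[of i r]
      proof (rule eventually_mono)
        fix x :: "real ^ 'n" assume x: "x $ i \<noteq> r"
        have "eventually (\<lambda>n. (u n \<le> x $ i) = (r \<le> x $ i)) sequentially"
        proof (cases "r < x $ i")
          case True
          then show ?thesis using order_tendstoD(2)[OF u True] by (auto elim!: eventually_mono)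
        next
          case False
          then show ?thesis using order_tendstoD(1)[OF u, of "x $ i"] x by (auto elim!: eventually_mono)
        qed
        then show "(\<lambda>n. indicator {x. u n \<le> x $ i} x * g x) \<longlonglongrightarrow> indicator {x. r \<le> x $ i} x * g x"
          by (intro tendsto_eventually) (auto elim!: eventually_mono simp: indicator_def)
      qed
    qed (use g in \<open>auto simp: indicator_def intro!: AE_I2\<close>)
  qed
  have "(\<lambda>n. M (real n)) \<longlonglongrightarrow> (LINT x :: real ^ 'n|lborel. 0 :: real)"
    unfolding M_def
  proof (rule integral_dominated_convergence[where w=g])
    show "AE x in lborel. (\<lambda>n. indicator {x. real n \<le> x $ i} x * g x) \<longlonglongrightarrow> 0"
    proof (intro AE_I2 tendsto_eventually)
      fix x :: "real ^ 'n"
      obtain N where "x $ i < real N" using reals_Archimedean2 by blast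
      then show "eventually (\<lambda>n. indicator {x. real n \<le> x $ i} x * g x = 0) sequentially"
        by (intro eventually_sequentiallyI[of N]) (auto simp: indicator_def)
    qed
  qed (use g in \<open>auto simp: indicator_def intro!: AE_I2\<close>)
  then have "eventually (\<lambda>n. M (real n) < (LINT x|lborel. g x) / 2) sequentially"
    using pos by (intro order_tendstoD(2)) auto
  then obtain a where a: "M (real a) < (LINT x|lborel. g x) / 2" using eventually_happens by force
  have "(\<lambda>n. M (- real n)) \<longlonglongrightarrow> (LINT x|lborel. g x)"
    unfolding M_def
  proof (rule integral_dominated_convergence[where w=g])
    show "AE x in lborel. (\<lambda>n. indicator {x. - real n \<le> x $ i} x * g x) \<longlonglongrightarrow> g x"
    proof (intro AE_I2 tendsto_eventually)
      fix x :: "real ^ 'n"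
      obtain N where "- (x $ i) < real N" using reals_Archimedean2 by blast
      then show "eventually (\<lambda>n. indicator {x. - real n \<le> x $ i} x * g x = g x) sequentially"
        by (intro eventually_sequentiallyI[of N]) (auto simp: indicator_def)
    qed
  qed (use g in \<open>auto simp: indicator_def intro!: AE_I2\<close>)
  then have "eventually (\<lambda>n. (LINT x|lborel. g x) / 2 < M (- real n)) sequentially"
    using pos by (intro order_tendstoD(1)) auto
  then obtain b where b: "(LINT x|lborel. g x) / 2 < M (- real b)" using eventually_happens by force
  have "\<exists>r\<ge>- real b. r \<le> real a \<and> M r = (LINT x|lborel. g x) / 2"
    by (rule IVT2) (use a b cont in \<open>auto simp: continuous_on_eq_continuous_at\<close>)
  then show ?thesis unfolding M_def by blast
qed

lemma exp_gt_add_one_self: "u \<noteq> 0 \<Longrightarrow> 1 + u < exp (u :: real)"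
proof -
  assume "u \<noteq> 0"
  then have "1 + u \<noteq> exp u" using ln_eq_minus_one[of "exp u"] by auto
  then show "1 + u < exp u" using exp_ge_add_one_self[of u] by linarith
qed

text \<open>Integrate \<open>exp u \<ge> 1 + u\<close> at \<open>u = z \<bullet> x\<close> against
  \<open>f\<close>: the linear term vanishes by the moment condition. The inequality is strict where
  \<open>u\<close> is nonzero, which is a nonempty open set when \<open>z \<noteq> 0\<close>, and
  \<open>f\<close> is positive there.\<close>

lemma integral_tilt_ge:
  fixes f :: "real ^ 'n \<Rightarrow> real"
  assumes f: "gaussian_dominated f" and z: "\<And>j. z $ j \<noteq> 0 \<Longrightarrow> (LINT x|lborel. x $ j * f x) = 0"
  shows "(LINT x|lborel. f x) \<le> (LINT x|lborel. f x * exp (z \<bullet> x))"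
    and "(LINT x|lborel. f x) = (LINT x|lborel. f x * exp (z \<bullet> x)) \<Longrightarrow> z = 0"
proof -
  let ?h = "\<lambda>x. f x * (exp (z \<bullet> x) - (1 + z \<bullet> x))"
  have zx: "z \<bullet> x * f x = (\<Sum>j\<in>UNIV. z $ j * (x $ j * f x))" for x
    by (simp add: inner_vec_def sum_distrib_right mult.assoc)
  have int: "integrable lborel (\<lambda>x. z \<bullet> x * f x)"
    unfolding zx by (intro Bochner_Integration.integrable_sum integrable_mult_right gaussian_dominated_integrable_nth f)
  have "(LINT x|lborel. z \<bullet> x * f x) = (\<Sum>j\<in>UNIV. z $ j * (LINT x|lborel. x $ j * f x))"
    unfolding zx by (simp add: gaussian_dominated_integrable_nth f)
  also have "\<dots> = 0" using z by (intro sum.neutral) auto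
  finally have 0: "(LINT x|lborel. z \<bullet> x * f x) = 0" .
  note ints = gaussian_dominated_integrable[OF f] gaussian_dominated_integrable[OF gaussian_dominated_exp[OF f, of z]] int
  have heq: "?h = (\<lambda>x. f x * exp (z \<bullet> x) - f x - z \<bullet> x * f x)" by (auto simp: algebra_simps)
  have inth: "integrable lborel ?h" unfolding heq using ints by auto
  have I: "(LINT x|lborel. ?h x) = (LINT x|lborel. f x * exp (z \<bullet> x)) - (LINT x|lborel. f x)"
    unfolding heq using ints 0 by simp
  have nn: "0 \<le> ?h x" for x
    using gaussian_dominatedD(2)[OF f, of x] exp_ge_add_one_self[of "z \<bullet> x"] by simp
  have "0 \<le> (LINT x|lborel. ?h x)" using nn by simp
  then show "(LINT x|lborel. f x) \<le> (LINT x|lborel. f x * exp (z \<bullet> x))" unfolding I by simp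
  assume eq: "(LINT x|lborel. f x) = (LINT x|lborel. f x * exp (z \<bullet> x))"
  show "z = 0"
  proof (rule ccontr)
    assume "z \<noteq> 0"
    have "0 < (LINT x|lborel. ?h x)"
    proof (rule integral_pos_open[OF inth nn, of "{x. z \<bullet> x \<noteq> 0}"])
      show "open {x. z \<bullet> x \<noteq> 0}" by (intro open_Collect_neq continuous_intros)
      show "{x. z \<bullet> x \<noteq> 0} \<noteq> {}" using \<open>z \<noteq> 0\<close> inner_eq_zero_iff[of z] by blast
      show "0 < ?h x" if "x \<in> {x. z \<bullet> x \<noteq> 0}" for x
        using that gaussian_dominatedD(2)[OF f, of x] exp_gt_add_one_self[of "z \<bullet> x"] by simp
    qed
    then show False unfolding I using eq by simp
  qed
qed

text \<open>
  The hyperplane \<open>x $ i = r\<close> bisects \<open>g\<close>; it meets the segment joining the barycentres of the two halves at \<open>z\<close>,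
  and the shear makes that segment parallel to the \<open>i\<close>-th axis.
\<close>

lemma centering:
  fixes g :: "real ^ 'n \<Rightarrow> real"
  assumes g: "gaussian_dominated g" and i: "i \<notin> I"
  obtains v z where "v $ i = 0" "\<And>j. j \<notin> insert i I \<Longrightarrow> v $ j = 0" "\<And>j. j \<notin> insert i I \<Longrightarrow> z $ j = 0"
    "(LINT x|lborel. indicator {x. 0 \<le> x $ i} x * g (z + (x + x $ i *\<^sub>R v))) =
      (LINT x|lborel. indicator {x. 0 \<le> x $ i} x * g (z + (reflect i x + reflect i x $ i *\<^sub>R v)))"
    "\<And>j. j \<in> I \<Longrightarrow> (LINT x|lborel. indicator {x. 0 \<le> x $ i} x * (x $ j * g (z + (x + x $ i *\<^sub>R v)))) = 0"
    "\<And>j. j \<in> I \<Longrightarrow> (LINT x|lborel. indicator {x. 0 \<le> x $ i} x * (x $ j * g (z + (reflect i x + reflect i x $ i *\<^sub>R v)))) = 0"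
proof -
  have [measurable]: "g \<in> borel_measurable borel" using g by measurable
  note intg = gaussian_dominated_integrable[OF g]
  have gnn: "0 \<le> g x" for x using gaussian_dominatedD(2)[OF g, of x] by simp
  obtain r where r: "(LINT x|lborel. indicator {x. r \<le> x $ i} x * g x) = (LINT x|lborel. g x) / 2"
    using bisecting_coordinate[OF intg gnn] by blast
  define P where "P = {x :: real ^ 'n. r \<le> x $ i}"
  define N where "N = {x :: real ^ 'n. x $ i \<le> r}"
  have [measurable]: "P \<in> sets borel" "N \<in> sets borel" unfolding P_def N_def
    by (auto intro!: borel_closed closed_Collect_le continuous_intros)
  define M where "M = (LINT x|lborel. g x) / 2"
  have int: "integrable lborel (\<lambda>x. indicator A x * g x)" "integrable lborel (\<lambda>x. indicator A x * (x $ j * g x))"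
    if "A \<in> sets borel" for A j
    using integrable_mult_indicator[OF _ intg, of A] integrable_mult_indicator[OF _ gaussian_dominated_integrable_nth[OF g], of A j] that
    by simp_all
  have MP: "(LINT x|lborel. indicator P x * g x) = M" using r by (simp add: P_def M_def)
  have MN: "(LINT x|lborel. indicator N x * g x) = M"
  proof -
    have "(LINT x|lborel. g x) = (LINT x|lborel. indicator P x * g x + indicator N x * g x)"
      using AE_nth_neq[of i r] by (intro integral_cong_AE) (auto elim!: eventually_mono simp: indicator_def P_def N_def)
    also have "\<dots> = (LINT x|lborel. indicator P x * g x) + (LINT x|lborel. indicator N x * g x)"
      by (intro Bochner_Integration.integral_add int) auto
    finally show ?thesis using MP by (simp add: M_def)
  qed
  have Mpos: "0 < M" using gaussian_dominated_integral_pos[OF g] by (simp add: M_def)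
  define XP where "XP j = (LINT x|lborel. indicator P x * (x $ j * g x))" for j
  define XN where "XN j = (LINT x|lborel. indicator N x * (x $ j * g x))" for j
  \<comment> \<open>\<open>sP\<close> and \<open>sN\<close> are the moments of
    \<open>x $ i - r\<close> over the two halves. They have opposite strict signs, so
    \<open>sP - sN\<close> can serve as a denominator.\<close>
  define sP where "sP = XP i - r * M"
  define sN where "sN = XN i - r * M"
  have sP: "0 < sP"
  proof -
    have "0 < (LINT x|lborel. indicator P x * (x $ i * g x) - r * (indicator P x * g x))"
    proof (rule integral_pos_open[of _ "{x. r < x $ i}"])
      show "open {x :: real ^ 'n. r < x $ i}" by (intro open_Collect_less continuous_intros)
      have "axis i (r + 1) \<in> {x :: real ^ 'n. r < x $ i}" by simp
      then show "{x :: real ^ 'n. r < x $ i} \<noteq> {}" by blast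
      show "0 \<le> indicator P x * (x $ i * g x) - r * (indicator P x * g x)" for x
        using gnn[of x] by (auto simp: indicator_def P_def mult_right_mono)
      show "0 < indicator P x * (x $ i * g x) - r * (indicator P x * g x)" if "x \<in> {x. r < x $ i}" for x
        using that gaussian_dominatedD(2)[OF g, of x] by (auto simp: indicator_def P_def)
      show "integrable lborel (\<lambda>x. indicator P x * (x $ i * g x) - r * (indicator P x * g x))"
        by (intro Bochner_Integration.integrable_diff integrable_mult_right int) measurable
    qed
    also have "\<dots> = sP" using int[of P] by (simp add: sP_def XP_def MP)
    finally show ?thesis .
  qed
  have sN: "sN < 0"
  proof -
    have "0 < (LINT x|lborel. r * (indicator N x * g x) - indicator N x * (x $ i * g x))"
    proof (rule integral_pos_open[of _ "{x. x $ i < r}"])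
      show "open {x :: real ^ 'n. x $ i < r}" by (intro open_Collect_less continuous_intros)
      have "axis i (r - 1) \<in> {x :: real ^ 'n. x $ i < r}" by simp
      then show "{x :: real ^ 'n. x $ i < r} \<noteq> {}" by blast
      show "0 \<le> r * (indicator N x * g x) - indicator N x * (x $ i * g x)" for x
        using gnn[of x] by (auto simp: indicator_def N_def mult_right_mono)
      show "0 < r * (indicator N x * g x) - indicator N x * (x $ i * g x)" if "x \<in> {x. x $ i < r}" for x
        using that gaussian_dominatedD(2)[OF g, of x] by (auto simp: indicator_def N_def)
      show "integrable lborel (\<lambda>x. r * (indicator N x * g x) - indicator N x * (x $ i * g x))"
        by (intro Bochner_Integration.integrable_diff integrable_mult_right int) measurable
    qed
    also have "\<dots> = - sN" using int[of N] by (simp add: sN_def XN_def MN)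
    finally show ?thesis by simp
  qed
  \<comment> \<open>\<open>v\<close> is the slope, per unit of the \<open>i\<close>-th coordinate,
    of the segment joining the barycentres, and \<open>z\<close> the point of that segment at height
    \<open>r\<close>. Solving both balance equations for one \<open>j\<close> gives precisely these
    two values.\<close>
  define v where "v = (\<chi> j. if j \<in> I then (XP j - XN j) / (sP - sN) else 0)"
  define z where "z = (\<chi> j. if j = i then r else if j \<in> I then (XP j - sP * v $ j) / M else 0)"
  have vi: "v $ i = 0" and zi: "z $ i = r" using i by (auto simp: v_def z_def)
  have bal: "XP j - z $ j * M - sP * v $ j = 0" "XN j - z $ j * M - sN * v $ j = 0" if "j \<in> I" for j
  proof -
    have "j \<noteq> i" using that i by auto
    then have 1: "z $ j * M = XP j - sP * v $ j" using that Mpos by (simp add: z_def)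
    have "sP - sN \<noteq> 0" using sP sN by simp
    then have "(sP - sN) * v $ j = XP j - XN j" using that by (simp add: v_def)
    then show "XP j - z $ j * M - sP * v $ j = 0" "XN j - z $ j * M - sN * v $ j = 0"
      unfolding 1 by (simp_all add: algebra_simps)
  qed
  define T where "T x = z + (x + x $ i *\<^sub>R v)" for x
  have [measurable]: "(\<lambda>x. x + x $ i *\<^sub>R v) \<in> borel_measurable borel" by measurable
  then have Tm[measurable]: "T \<in> borel_measurable borel" unfolding T_def by measurable
  have "distr lborel borel T = distr (distr lborel borel (\<lambda>x. x + x $ i *\<^sub>R v)) borel ((+) z)"
    by (subst distr_distr) (auto simp: T_def[abs_def] o_def)
  then have T: "distr lborel borel T = lborel" by (simp add: lborel_shear(1)[OF vi] lborel_distr_plus)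
  have Ti: "T x $ i = r + x $ i" and Tj: "x $ j = T x $ j - z $ j - (T x $ i - r) * v $ j" for x j
    by (simp_all add: T_def vi zi)
  have cov: "(LINT x|lborel. indicator {x. 0 \<le> x $ i} x * (w (T x) * g (T x))) = (LINT x|lborel. indicator P x * (w x * g x))"
    "(LINT x|lborel. indicator {x. 0 \<le> x $ i} x * (w (T (reflect i x)) * g (T (reflect i x)))) = (LINT x|lborel. indicator N x * (w x * g x))"
    if [measurable]: "w \<in> borel_measurable borel" for w :: "real ^ 'n \<Rightarrow> real"
  proof -
    have "(LINT x|lborel. indicator P (T x) * (w (T x) * g (T x))) = (LINT x|lborel. indicator P x * (w x * g x))"
      by (rule integral_measure_preserving[OF Tm T]) measurable
    moreover have "indicator P (T x) = (indicator {x. 0 \<le> x $ i} x :: real)" for x by (simp add: indicator_def P_def Ti)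
    ultimately show "(LINT x|lborel. indicator {x. 0 \<le> x $ i} x * (w (T x) * g (T x))) = (LINT x|lborel. indicator P x * (w x * g x))"
      by simp
    have "(LINT x|lborel. indicator N (T (reflect i x)) * (w (T (reflect i x)) * g (T (reflect i x)))) =
        (LINT x|lborel. indicator N (T x) * (w (T x) * g (T x)))"
      by (rule integral_measure_preserving[OF measurable_reflect lborel_reflect]) measurable
    also have "\<dots> = (LINT x|lborel. indicator N x * (w x * g x))"
      by (rule integral_measure_preserving[OF Tm T]) measurable
    finally have "(LINT x|lborel. indicator N (T (reflect i x)) * (w (T (reflect i x)) * g (T (reflect i x)))) =
        (LINT x|lborel. indicator N x * (w x * g x))" .
    moreover have "indicator N (T (reflect i x)) = (indicator {x. 0 \<le> x $ i} x :: real)" for x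
      by (simp add: indicator_def N_def Ti)
    ultimately show "(LINT x|lborel. indicator {x. 0 \<le> x $ i} x * (w (T (reflect i x)) * g (T (reflect i x)))) = (LINT x|lborel. indicator N x * (w x * g x))"
      by simp
  qed
  have lin: "(LINT x|lborel. indicator A x * ((x $ j - z $ j - (x $ i - r) * v $ j) * g x)) =
      (LINT x|lborel. indicator A x * (x $ j * g x)) - z $ j * (LINT x|lborel. indicator A x * g x)
      - ((LINT x|lborel. indicator A x * (x $ i * g x)) - r * (LINT x|lborel. indicator A x * g x)) * v $ j"
    if "A \<in> sets borel" for A j
  proof -
    have "(LINT x|lborel. indicator A x * ((x $ j - z $ j - (x $ i - r) * v $ j) * g x)) =
      (LINT x|lborel. indicator A x * (x $ j * g x) - z $ j * (indicator A x * g x) -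
      (v $ j * (indicator A x * (x $ i * g x)) - r * v $ j * (indicator A x * g x)))"
      by (intro Bochner_Integration.integral_cong refl) (simp add: algebra_simps)
    also have "\<dots> = (LINT x|lborel. indicator A x * (x $ j * g x)) - z $ j * (LINT x|lborel. indicator A x * g x) -
      (v $ j * (LINT x|lborel. indicator A x * (x $ i * g x)) - r * v $ j * (LINT x|lborel. indicator A x * g x))"
      using int[OF that] by simp
    finally show ?thesis by (simp only: left_diff_distrib) (simp only: mult_ac)
  qed
  have c0: "(LINT x|lborel. indicator {x. 0 \<le> x $ i} x * g (T x)) = M"
    "(LINT x|lborel. indicator {x. 0 \<le> x $ i} x * g (T (reflect i x))) = M"
    using cov[of "\<lambda>_. 1"] by (simp_all add: MP MN)
  have c1: "(LINT x|lborel. indicator {x. 0 \<le> x $ i} x * (x $ j * g (T x))) = 0"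
    "(LINT x|lborel. indicator {x. 0 \<le> x $ i} x * (x $ j * g (T (reflect i x)))) = 0" if "j \<in> I" for j
  proof -
    let ?w = "\<lambda>x :: real ^ 'n. x $ j - z $ j - (x $ i - r) * v $ j"
    have w: "?w (T x) = x $ j" for x using Tj[of x j] by simp
    have w': "?w (T (reflect i x)) = x $ j" for x using w[of "reflect i x"] that i by auto
    have m: "?w \<in> borel_measurable borel" by measurable
    show "(LINT x|lborel. indicator {x. 0 \<le> x $ i} x * (x $ j * g (T x))) = 0"
    proof -
      have "(LINT x|lborel. indicator {x. 0 \<le> x $ i} x * (x $ j * g (T x))) = (LINT x|lborel. indicator P x * (?w x * g x))"
        using cov(1)[OF m] unfolding w .
      also have "\<dots> = XP j - z $ j * M - sP * v $ j"
        by (subst lin) (simp_all only: MP XP_def sP_def, measurable)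
      finally show ?thesis using bal(1)[OF that] by simp
    qed
    show "(LINT x|lborel. indicator {x. 0 \<le> x $ i} x * (x $ j * g (T (reflect i x)))) = 0"
    proof -
      have "(LINT x|lborel. indicator {x. 0 \<le> x $ i} x * (x $ j * g (T (reflect i x)))) = (LINT x|lborel. indicator N x * (?w x * g x))"
        using cov(2)[OF m] unfolding w' .
      also have "\<dots> = XN j - z $ j * M - sN * v $ j"
        by (subst lin) (simp_all only: MN XN_def sN_def, measurable)
      finally show ?thesis using bal(2)[OF that] by simp
    qed
  qed
  have off: "v $ j = 0" "z $ j = 0" if "j \<notin> insert i I" for j using that by (simp_all add: v_def z_def)
  show thesis by (rule that[OF vi off c0(1)[folded c0(2), unfolded T_def] c1[unfolded T_def]])
qed

section \<open>The induction on the coordinates\<close>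

lemma inner_shear:
  fixes v :: "real ^ 'n"
  assumes "v $ i = 0"
  shows "(x + x $ i *\<^sub>R v) \<bullet> (y - (v \<bullet> y) *\<^sub>R axis i 1) = x \<bullet> y"
  using assms by (simp add: inner_add_left inner_diff_right inner_axis algebra_simps)

text \<open>The moment condition is on \<open>f\<close>, but centring is applied to
  \<open>g\<close>: the balanced case is used for the pair \<open>(g1, f1)\<close>, with exchanged
  roles. The integral of \<open>g1\<close> is that of \<open>g\<close>, and the integral of
  \<open>f1\<close> is that of the tilted \<open>f\<close>, hence no smaller than that of
  \<open>f\<close>. Equality forces \<open>z = 0\<close>, after which only the shears have to be
  undone.\<close>

lemma santalo_on_insert:
  assumes IH: "santalo_on I" and i: "i \<notin> I"
  shows "santalo_on (insert i I :: 'n::finite set)"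
  unfolding santalo_on_def
proof (intro allI impI)
  fix f g :: "real ^ 'n \<Rightarrow> real"
  assume f: "gaussian_dominated f" "gaussian_off (insert i I) f"
    and g: "gaussian_dominated g" "gaussian_off (insert i I) g"
    and fg: "\<forall>x y. f x * g y \<le> exp (- (x \<bullet> y))"
    and cen: "\<forall>j\<in>insert i I. (LINT x|lborel. x $ j * f x) = 0"
  obtain v z where vi: "v $ i = 0" and off: "\<And>j. j \<notin> insert i I \<Longrightarrow> v $ j = 0" "\<And>j. j \<notin> insert i I \<Longrightarrow> z $ j = 0"
    and bal: "(LINT x|lborel. indicator {x. 0 \<le> x $ i} x * g (z + (x + x $ i *\<^sub>R v))) =
      (LINT x|lborel. indicator {x. 0 \<le> x $ i} x * g (z + (reflect i x + reflect i x $ i *\<^sub>R v)))"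
    and cen': "\<And>j. j \<in> I \<Longrightarrow> (LINT x|lborel. indicator {x. 0 \<le> x $ i} x * (x $ j * g (z + (x + x $ i *\<^sub>R v)))) = 0"
      "\<And>j. j \<in> I \<Longrightarrow> (LINT x|lborel. indicator {x. 0 \<le> x $ i} x * (x $ j * g (z + (reflect i x + reflect i x $ i *\<^sub>R v)))) = 0"
    by (rule centering[OF g(1) i]) (rule that)
  define S where "S x = x + x $ i *\<^sub>R v" for x
  \<comment> \<open>The inverse adjoint of the shear \<open>S\<close>, so that changing both
    variables keeps the inner product.\<close>
  define S' where "S' y = y - (v \<bullet> y) *\<^sub>R axis i 1" for y :: "real ^ 'n"
  have linS: "linear S" "linear S'"
    by (auto intro!: linearI simp: S_def S'_def algebra_simps inner_add_right)
  have SS': "S x \<bullet> S' y = x \<bullet> y" for x y unfolding S_def S'_def by (rule inner_shear[OF vi])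
  define R where "R x = x - x $ i *\<^sub>R v" for x
  define R' where "R' y = y + (v \<bullet> y) *\<^sub>R axis i 1" for y :: "real ^ 'n"
  have linR: "linear R" "linear R'"
    by (auto intro!: linearI simp: R_def R'_def algebra_simps inner_add_right)
  have inv: "S (R x) = x" "R (S x) = x" "S' (R' x) = x" "R' (S' x) = x" for x
    using vi by (auto simp: S_def R_def S'_def R'_def inner_axis inner_add_right inner_diff_right)
  have injS: "inj S" "inj S'" using inv by (metis injI)+
  \<comment> \<open>Translating \<open>g\<close> by \<open>z\<close> introduces the factor
    \<open>exp (- (z \<bullet> S' y))\<close> into the bound; the tilt of \<open>f\<close> cancels
    it.\<close>
  define f1 where "f1 y = f (S' y) * exp (z \<bullet> S' y)" for y
  define g1 where "g1 x = g (z + S x)" for x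
  have f1: "gaussian_dominated f1" unfolding f1_def
    by (rule gaussian_dominated_linear[OF gaussian_dominated_exp[OF f(1)] linS(2) injS(2)])
  have g1: "gaussian_dominated g1" unfolding g1_def
    by (rule gaussian_dominated_linear[OF gaussian_dominated_translate[OF g(1)] linS(1) injS(1)])
  have updS: "S (upd j x t) = upd j (S x) t" "S x $ j = x $ j" "z + upd j x t = upd j (z + x) t"
    "S' (upd j x t) = upd j (S' x) t" "S' x $ j = x $ j" "z \<bullet> upd j x t = z \<bullet> x"
    if "j \<notin> insert i I" for j x t
  proof -
    have "j \<noteq> i" "v $ j = 0" "z $ j = 0" using that off by auto
    moreover from this have "v \<bullet> upd j x t = v \<bullet> x" "z \<bullet> upd j x t = z \<bullet> x"
      unfolding upd_eq by (simp_all add: inner_add_right inner_axis)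
    ultimately show "S (upd j x t) = upd j (S x) t" "S x $ j = x $ j" "z + upd j x t = upd j (z + x) t"
      "S' (upd j x t) = upd j (S' x) t" "S' x $ j = x $ j" "z \<bullet> upd j x t = z \<bullet> x"
      by (auto simp: S_def S'_def vec_eq_iff axis_def)
  qed
  have f1off: "gaussian_off (insert i I) f1"
    unfolding gaussian_off_def
  proof (intro allI impI)
    fix j x t assume j: "j \<notin> insert i I"
    have "f (upd j (S' x) t) * exp (t\<^sup>2 / 2) = f (S' x) * exp ((S' x $ j)\<^sup>2 / 2)"
      using f(2) j unfolding gaussian_off_def by blast
    then show "f1 (upd j x t) * exp (t\<^sup>2 / 2) = f1 x * exp ((x $ j)\<^sup>2 / 2)"
      by (simp add: f1_def updS[OF j])
  qed
  have g1off: "gaussian_off (insert i I) g1"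
    unfolding gaussian_off_def
  proof (intro allI impI)
    fix j x t assume j: "j \<notin> insert i I"
    have "g (upd j (z + S x) t) * exp (t\<^sup>2 / 2) = g (z + S x) * exp (((z + S x) $ j)\<^sup>2 / 2)"
      using g(2) j unfolding gaussian_off_def by blast
    moreover have "z $ j = 0" using off j by blast
    ultimately show "g1 (upd j x t) * exp (t\<^sup>2 / 2) = g1 x * exp ((x $ j)\<^sup>2 / 2)"
      by (simp add: g1_def updS[OF j])
  qed
  have g1f1: "g1 x * f1 y \<le> exp (- (x \<bullet> y))" for x y
  proof -
    have "g1 x * f1 y = (f (S' y) * g (z + S x)) * exp (z \<bullet> S' y)" by (simp add: f1_def g1_def)
    also have "\<dots> \<le> exp (- (S' y \<bullet> (z + S x))) * exp (z \<bullet> S' y)" using fg by (intro mult_right_mono) auto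
    also have "\<dots> = exp (- (x \<bullet> y))"
      unfolding exp_add[symmetric] using SS'[of x y] by (simp add: inner_add_right inner_commute)
    finally show ?thesis .
  qed
  note B = santalo_balanced[OF IH i g1 g1off f1 f1off g1f1 bal[folded S_def g1_def] cen'[folded S_def, folded g1_def]]
  have mS: "S \<in> borel_measurable borel" "S' \<in> borel_measurable borel" using linS by (auto intro: measurable_linear)
  have dS: "distr lborel borel S = lborel" "distr lborel borel S' = lborel"
    unfolding S_def[abs_def] S'_def[abs_def] by (rule lborel_shear[OF vi])+
  have [measurable]: "f \<in> borel_measurable borel" "g \<in> borel_measurable borel" using f g by measurable
  have Ig: "(LINT x|lborel. g1 x) = (LINT x|lborel. g x)"
  proof -
    have "(LINT x|lborel. g1 x) = (LINT x|lborel. g (z + x))"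
      unfolding g1_def by (rule integral_measure_preserving[OF mS(1) dS(1)]) measurable
    also have "\<dots> = (LINT x|lborel. g x)"
      by (rule integral_measure_preserving[of "(+) z"]) (auto simp: lborel_distr_plus)
    finally show ?thesis .
  qed
  have If: "(LINT x|lborel. f1 x) = (LINT x|lborel. f x * exp (z \<bullet> x))"
    unfolding f1_def by (rule integral_measure_preserving[OF mS(2) dS(2)]) measurable
  have z: "(LINT x|lborel. x $ j * f x) = 0" if "z $ j \<noteq> 0" for j using off that cen by blast
  note tilt = integral_tilt_ge[OF f(1) z]
  have gpos: "0 < (LINT x|lborel. g x)" by (rule gaussian_dominated_integral_pos[OF g(1)])
  have le1: "(LINT x|lborel. f x) * (LINT x|lborel. g x) \<le> (LINT x|lborel. g1 x) * (LINT x|lborel. f1 x)"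
    unfolding Ig If using mult_right_mono[OF tilt(1) less_imp_le[OF gpos]] by (simp add: mult.commute)
  show "(LINT x|lborel. f x) * (LINT x|lborel. g x) \<le> (gauss_total TYPE(real ^ 'n))\<^sup>2 \<and>
     ((LINT x|lborel. f x) * (LINT x|lborel. g x) = (gauss_total TYPE(real ^ 'n))\<^sup>2 \<longrightarrow> gaussian_pair f g)"
  proof (intro conjI impI)
    show "(LINT x|lborel. f x) * (LINT x|lborel. g x) \<le> (gauss_total TYPE(real ^ 'n))\<^sup>2"
      using le1 B(1) by linarith
    assume eq: "(LINT x|lborel. f x) * (LINT x|lborel. g x) = (gauss_total TYPE(real ^ 'n))\<^sup>2"
    then have eq1: "(LINT x|lborel. g1 x) * (LINT x|lborel. f1 x) = (gauss_total TYPE(real ^ 'n))\<^sup>2"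
      using le1 B(1) by linarith
    then have "(LINT x|lborel. g x) * (LINT x|lborel. f x) = (LINT x|lborel. g x) * (LINT x|lborel. f x * exp (z \<bullet> x))"
      using eq unfolding Ig If by (simp add: mult.commute)
    then have "(LINT x|lborel. f x) = (LINT x|lborel. f x * exp (z \<bullet> x))"
      using gpos by (metis less_irrefl mult_left_cancel)
    then have z0: "z = 0" by (rule tilt(2)[rotated])
    have gp: "gaussian_pair g1 f1" using B(2) eq1 by blast
    obtain A B :: "real ^ 'n \<Rightarrow> real ^ 'n" and k where k: "0 < k" "linear A" "linear B" "\<And>x y. A x \<bullet> B y = x \<bullet> y"
      "\<And>x. g1 x = k * exp (- (norm (A x))\<^sup>2 / 2)" "\<And>y. f1 y = exp (- (norm (B y))\<^sup>2 / 2) / k"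
      by (rule gaussian_pairE[OF gp]) (rule that)
    have "gaussian_pair g f"
    proof (rule gaussian_pairI[of k "\<lambda>x. A (R x)" "\<lambda>x. B (R' x)"])
      show "linear (\<lambda>x. A (R x))" "linear (\<lambda>x. B (R' x))"
        using linear_compose[OF linR(1) k(2)] linear_compose[OF linR(2) k(3)] by (auto simp: o_def)
      show "A (R x) \<bullet> B (R' y) = x \<bullet> y" for x y using SS'[of "R x" "R' y"] by (simp add: k inv)
      show "g x = k * exp (- (norm (A (R x)))\<^sup>2 / 2)" for x
        using k(5)[of "R x"] by (simp add: g1_def z0 inv)
      show "f x = exp (- (norm (B (R' x)))\<^sup>2 / 2) / k" for x
        using k(6)[of "R' x"] by (simp add: f1_def z0 inv)
    qed fact
    then show "gaussian_pair f g" by (rule gaussian_pair_sym)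
  qed
qed

text \<open>Both functions are multiples of the standard Gaussian, and the bound at the origin
  limits the product of the two multiples to 1.\<close>

lemma santalo_on_empty: "santalo_on ({} :: 'n::finite set)"
  unfolding santalo_on_def
proof (intro allI impI)
  fix f g :: "real ^ 'n \<Rightarrow> real"
  assume f: "gaussian_dominated f" "gaussian_off {} f" and g: "gaussian_dominated g" "gaussian_off {} g"
    and fg: "\<forall>x y. f x * g y \<le> exp (- (x \<bullet> y))"
  define W where "W = gauss_total TYPE(real ^ 'n)"
  have "gaussian_dominated (\<lambda>x :: real ^ 'n. exp (- (norm x)\<^sup>2 / 2))"
    by (rule gaussian_dominatedI[of _ "1 / 2" 1]) (auto intro!: continuous_intros)
  then have W: "0 < W" unfolding W_def gauss_total_def by (rule gaussian_dominated_integral_pos)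
  have fx: "f x = f 0 * exp (- (norm x)\<^sup>2 / 2)" and gx: "g x = g 0 * exp (- (norm x)\<^sup>2 / 2)" for x
    by (rule gaussian_off_empty[OF f(2)], rule gaussian_off_empty[OF g(2)])
  have I: "(LINT x|lborel. f x) = f 0 * W" "(LINT x|lborel. g x) = g 0 * W"
    by (subst fx gx, simp add: W_def gauss_total_def)+
  have fg0: "f 0 * g 0 \<le> 1" using fg[rule_format, of 0 0] by simp
  have FG: "(LINT x|lborel. f x) * (LINT x|lborel. g x) = (f 0 * g 0) * W\<^sup>2"
    unfolding I by (simp add: power2_eq_square)
  show "(LINT x|lborel. f x) * (LINT x|lborel. g x) \<le> (gauss_total TYPE(real ^ 'n))\<^sup>2 \<and>
     ((LINT x|lborel. f x) * (LINT x|lborel. g x) = (gauss_total TYPE(real ^ 'n))\<^sup>2 \<longrightarrow> gaussian_pair f g)"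
    unfolding FG W_def[symmetric]
  proof (intro conjI impI)
    show "f 0 * g 0 * W\<^sup>2 \<le> W\<^sup>2" using mult_right_mono[OF fg0, of "W\<^sup>2"] by simp
    assume "f 0 * g 0 * W\<^sup>2 = W\<^sup>2"
    then have "f 0 * g 0 = 1" using W by simp
    then have g0: "g 0 = 1 / f 0" using gaussian_dominatedD(2)[OF f(1), of 0] by (simp add: field_simps)
    show "gaussian_pair f g"
    proof (rule gaussian_pairI[of "f 0" "\<lambda>x. x" "\<lambda>x. x"])
      show "f x = f 0 * exp (- (norm x)\<^sup>2 / 2)" for x by (rule fx)
      show "g x = exp (- (norm x)\<^sup>2 / 2) / f 0" for x using gx[of x] unfolding g0 by simp
    qed (use gaussian_dominatedD(2)[OF f(1), of 0] in \<open>auto simp: linear_ident\<close>)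
  qed
qed

theorem functional_santalo:
  fixes f g :: "real ^ 'n \<Rightarrow> real"
  assumes f: "gaussian_dominated f" and g: "gaussian_dominated g"
    and fg: "\<And>x y. f x * g y \<le> exp (- (x \<bullet> y))"
    and cen: "\<And>j. (LINT x|lborel. x $ j * f x) = 0"
  shows "(LINT x|lborel. f x) * (LINT x|lborel. g x) \<le> (gauss_total TYPE(real ^ 'n))\<^sup>2"
    and "(LINT x|lborel. f x) * (LINT x|lborel. g x) = (gauss_total TYPE(real ^ 'n))\<^sup>2 \<Longrightarrow> gaussian_pair f g"
proof -
  have "santalo_on I" if "finite I" for I :: "'n set"
    using that by (induction I) (auto intro: santalo_on_empty santalo_on_insert)
  then have "santalo_on (UNIV :: 'n set)" by simp
  moreover have "gaussian_off UNIV f" "gaussian_off UNIV g" by (auto simp: gaussian_off_def)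
  ultimately show "(LINT x|lborel. f x) * (LINT x|lborel. g x) \<le> (gauss_total TYPE(real ^ 'n))\<^sup>2"
    "(LINT x|lborel. f x) * (LINT x|lborel. g x) = (gauss_total TYPE(real ^ 'n))\<^sup>2 \<Longrightarrow> gaussian_pair f g"
    using santalo_onD[of UNIV f g] f g fg cen by blast+
qed

section \<open>The Blaschke--Santalo inequality\<close>

lemma convex_bodies_bounds:
  assumes "K \<in> convex_bodies"
  obtains e R where "0 < e" "cball 0 e \<subseteq> K" "0 < R" "K \<subseteq> cball 0 R"
proof -
  have "0 \<in> interior K" "compact K" using assms by (auto simp: convex_bodies_def)
  then obtain e where "0 < e" "cball 0 e \<subseteq> K" using mem_interior_cball by blast
  moreover obtain R where "0 < R" "K \<subseteq> cball 0 R"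
    using bounded_subset_ballD[OF compact_imp_bounded[OF \<open>compact K\<close>], of 0] ball_subset_cball by blast
  ultimately show thesis using that by blast
qed

lemma closed_polar_body: "closed (polar_body K)"
proof -
  have "polar_body K = (\<Inter>x\<in>K. {y. x \<bullet> y \<le> 1})" by (auto simp: polar_body_def)
  then show ?thesis by (simp add: closed_INT closed_halfspace_le)
qed

lemma convex_polar_body: "convex (polar_body K)"
proof -
  have "polar_body K = (\<Inter>x\<in>K. {y. x \<bullet> y \<le> 1})" by (auto simp: polar_body_def)
  then show ?thesis by (simp add: convex_INT convex_halfspace_le)
qed

lemma polar_body_cball:
  assumes "0 < r"
  shows "polar_body (cball 0 r) = cball (0 :: real ^ 'n) (1 / r)"
proof (intro equalityI subsetI)
  fix y :: "real ^ 'n" assume y: "y \<in> polar_body (cball 0 r)"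
  show "y \<in> cball 0 (1 / r)"
  proof (cases "y = 0")
    case False
    have "(r / norm y) *\<^sub>R y \<in> cball 0 r" using assms False by simp
    then have "((r / norm y) *\<^sub>R y) \<bullet> y \<le> 1" using y unfolding polar_body_def by blast
    then have "r / norm y * (norm y)\<^sup>2 \<le> 1" by (simp add: dot_square_norm)
    then have "r * norm y \<le> 1" using False by (simp add: power2_eq_square)
    then show ?thesis using assms by (simp add: field_simps)
  qed (use assms in simp)
next
  fix y :: "real ^ 'n" assume y: "y \<in> cball 0 (1 / r)"
  show "y \<in> polar_body (cball 0 r)"
    unfolding polar_body_def
  proof (intro CollectI ballI)
    fix x :: "real ^ 'n" assume "x \<in> cball 0 r"
    have "x \<bullet> y \<le> norm x * norm y" by (rule norm_cauchy_schwarz)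
    also have "\<dots> \<le> r * (1 / r)" using \<open>x \<in> _\<close> y assms by (intro mult_mono) auto
    finally show "x \<bullet> y \<le> 1" using assms by simp
  qed
qed

lemma polar_body_antimono: "K \<subseteq> L \<Longrightarrow> polar_body L \<subseteq> polar_body K"
  by (auto simp: polar_body_def)

lemma polar_body_convex_bodies:
  assumes "K \<in> convex_bodies"
  shows "polar_body K \<in> convex_bodies"
proof -
  obtain e R where e: "0 < e" "cball 0 e \<subseteq> K" and R: "0 < R" "K \<subseteq> cball 0 R" by (rule convex_bodies_bounds[OF assms])
  have "polar_body K \<subseteq> cball 0 (1 / e)" using polar_body_antimono[OF e(2)] unfolding polar_body_cball[OF e(1)] .
  then have "compact (polar_body K)"
    using closed_polar_body bounded_subset[OF bounded_cball] by (auto simp: compact_eq_bounded_closed)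
  moreover have "cball 0 (1 / R) \<subseteq> polar_body K" using polar_body_antimono[OF R(2)] unfolding polar_body_cball[OF R(1)] .
  then have "0 \<in> interior (polar_body K)" using R(1) by (auto simp: mem_interior_cball intro!: exI[of _ "1 / R"])
  ultimately show ?thesis by (simp add: convex_bodies_def convex_polar_body)
qed

lemma bipolar:
  assumes "K \<in> convex_bodies"
  shows "polar_body (polar_body K) = K"
proof (intro equalityI subsetI)
  have K: "closed K" "convex K" "0 \<in> K"
    using assms interior_subset by (auto simp: convex_bodies_def compact_imp_closed)
  fix z assume z: "z \<in> polar_body (polar_body K)"
  show "z \<in> K"
  proof (rule ccontr)
    assume "z \<notin> K"
    then obtain a b where ab: "a \<bullet> z < b" "\<And>x. x \<in> K \<Longrightarrow> b < a \<bullet> x"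
      using separating_hyperplane_closed_point[OF K(2,1)] by blast
    \<comment> \<open>As \<open>0 \<in> K\<close>, the separating value is negative; dividing the
      normal by it reverses the inequalities and gives a point of the polar that excludes
      \<open>z\<close>.\<close>
    have b: "b < 0" using ab(2)[OF K(3)] by simp
    have "x \<bullet> ((1 / b) *\<^sub>R a) \<le> 1" if "x \<in> K" for x
      using ab(2)[OF that] b by (simp add: inner_commute divide_le_eq)
    then have "(1 / b) *\<^sub>R a \<in> polar_body K" by (simp add: polar_body_def)
    then have "((1 / b) *\<^sub>R a) \<bullet> z \<le> 1" using z unfolding polar_body_def by blast
    then show False using ab(1) b by (simp add: divide_le_eq)
  qed
qed (auto simp: polar_body_def inner_commute)

section \<open>Support functions and their Gaussians\<close>

text \<open>Also the gauge of the polar body. By the bipolar theorem the gauge of \<open>K\<close>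
  is \<open>support_fun (polar_body K)\<close>, so one notion serves both bodies.\<close>

definition support_fun :: "(real ^ 'n) set \<Rightarrow> real ^ 'n \<Rightarrow> real" where
  "support_fun K y = (SUP x\<in>K. x \<bullet> y)"

context
  fixes K :: "(real ^ 'n) set"
  assumes K: "K \<in> convex_bodies"
begin

lemma support_fun_le_iff: "support_fun K y \<le> c \<longleftrightarrow> (\<forall>x\<in>K. x \<bullet> y \<le> c)"
proof -
  have "compact ((\<lambda>x. x \<bullet> y) ` K)"
    using K by (intro compact_continuous_image continuous_intros) (auto simp: convex_bodies_def)
  then have "bdd_above ((\<lambda>x. x \<bullet> y) ` K)" by (simp add: bounded_imp_bdd_above compact_imp_bounded)
  moreover have "K \<noteq> {}" using K interior_subset by (auto simp: convex_bodies_def)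
  ultimately show ?thesis unfolding support_fun_def by (simp add: cSUP_le_iff)
qed

lemma support_fun_upper: "x \<in> K \<Longrightarrow> x \<bullet> y \<le> support_fun K y"
  using support_fun_le_iff[of y "support_fun K y"] by simp

lemma support_fun_scale:
  assumes t: "0 < t"
  shows "support_fun K (t *\<^sub>R y) = t * support_fun K y"
proof (rule antisym)
  show "support_fun K (t *\<^sub>R y) \<le> t * support_fun K y"
    using t by (auto simp: support_fun_le_iff intro!: mult_left_mono support_fun_upper)
  have "support_fun K y \<le> support_fun K (t *\<^sub>R y) / t"
    using t support_fun_upper[of _ "t *\<^sub>R y"] by (auto simp: support_fun_le_iff field_simps)
  then show "t * support_fun K y \<le> support_fun K (t *\<^sub>R y)" using t by (simp add: field_simps)
qed

lemma support_fun_ge: "\<exists>e>0. \<forall>y. e * norm y \<le> support_fun K y"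
proof -
  obtain e R where e: "0 < e" "cball 0 e \<subseteq> K" by (rule convex_bodies_bounds[OF K])
  have "e * norm y \<le> support_fun K y" for y
  proof (cases "y = 0")
    case True
    have "0 \<in> K" using e by (auto simp: subset_iff)
    then show ?thesis using True support_fun_upper[of 0 0] by simp
  next
    case False
    have "(e / norm y) *\<^sub>R y \<in> K" using e False by auto
    from support_fun_upper[OF this, of y] show ?thesis
      using False by (simp add: dot_square_norm power2_eq_square)
  qed
  then show ?thesis using e by blast
qed

lemma support_fun_pos: "y \<noteq> 0 \<Longrightarrow> 0 < support_fun K y"
  using support_fun_ge by (metis less_le_trans mult_pos_pos zero_less_norm_iff)

lemma support_fun_nonneg: "0 \<le> support_fun K y"
  using support_fun_ge by (metis less_imp_le mult_nonneg_nonneg norm_ge_zero order_trans)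

lemma support_fun_unit_ball: "{y. support_fun K y \<le> 1} = polar_body K"
  by (auto simp: support_fun_le_iff polar_body_def)

lemma continuous_on_support_fun: "continuous_on A (support_fun K)"
proof -
  obtain e R where R: "0 < R" "K \<subseteq> cball 0 R" by (rule convex_bodies_bounds[OF K])
  have *: "support_fun K y \<le> support_fun K z + R * norm (y - z)" for y z
    unfolding support_fun_le_iff
  proof
    fix x assume x: "x \<in> K"
    have "x \<bullet> y = x \<bullet> z + x \<bullet> (y - z)" by (simp add: inner_diff_right)
    also have "\<dots> \<le> support_fun K z + norm x * norm (y - z)"
      by (intro add_mono support_fun_upper x norm_cauchy_schwarz)
    also have "\<dots> \<le> support_fun K z + R * norm (y - z)"
      using x R by (intro add_left_mono mult_right_mono) auto
    finally show "x \<bullet> y \<le> support_fun K z + R * norm (y - z)" .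
  qed
  have "R-lipschitz_on A (support_fun K)"
  proof (rule lipschitz_onI)
    fix y z
    show "dist (support_fun K y) (support_fun K z) \<le> R * dist y z"
      using *[of y z] *[of z y] by (simp add: dist_norm abs_le_iff norm_minus_commute)
  qed (use R(1) in simp)
  then show ?thesis by (rule lipschitz_on_continuous_on)
qed

lemma support_fun_gaussian_dominated: "gaussian_dominated (\<lambda>y. exp (- (support_fun K y)\<^sup>2 / 2))"
proof -
  obtain e where e: "0 < e" "\<And>y. e * norm y \<le> support_fun K y" using support_fun_ge by blast
  show ?thesis
  proof (rule gaussian_dominatedI)
    show "continuous_on UNIV (\<lambda>y. exp (- (support_fun K y)\<^sup>2 / 2))"
      by (intro continuous_intros continuous_on_support_fun) auto
    show "0 < e\<^sup>2 / 2" using e by simp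
    show "exp (- (support_fun K y)\<^sup>2 / 2) \<le> 1 * exp (- (e\<^sup>2 / 2 * (norm y)\<^sup>2))" for y
      using power_mono[OF e(2)[of y], of 2] e(1) by (simp add: power_mult_distrib)
  qed simp
qed

end

text \<open>The layer-cake constant. It multiplies the volumes of the body, of its polar and of the
  unit ball alike, and so cancels from the volume product inequality.\<close>

definition gauss_moment :: "nat \<Rightarrow> real" where
  "gauss_moment k = enn2real (\<integral>\<^sup>+s. ennreal (s ^ k * exp (- s\<^sup>2 / 2)) * indicator {0<..} s \<partial>lborel)"

lemma gauss_moment_pos: "0 < gauss_moment k"
  using moment_finite_pos[of k] by (simp add: gauss_moment_def enn2real_positive_iff)

lemma integral_gauge_gaussian:
  fixes p :: "real ^ 'n \<Rightarrow> real"
  assumes p: "p \<in> borel_measurable borel" "\<And>x. 0 \<le> p x" "\<And>t x. 0 < t \<Longrightarrow> p (t *\<^sub>R x) = t * p x"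
  shows "(LINT x|lborel. exp (- (p x)\<^sup>2 / 2)) = gauss_moment (CARD('n) + 1) * measure lebesgue {x. p x \<le> 1}"
proof -
  have [measurable]: "p \<in> borel_measurable borel" by fact
  have m[measurable]: "{x. p x \<le> 1} \<in> sets borel" by measurable
  have "(\<integral>\<^sup>+x. ennreal (1 * exp (- (p x)\<^sup>2 / 2)) \<partial>lborel) =
    (\<integral>\<^sup>+s. ennreal (s ^ (DIM(real ^ 'n) + 0 + 1) * exp (- s\<^sup>2 / 2)) * indicator {0<..} s \<partial>lborel) *
    (\<integral>\<^sup>+x. ennreal 1 * indicator {x. p x \<le> 1} x \<partial>lborel)"
    by (rule nn_integral_gauge_gaussian) (use p in auto)
  then have 1: "enn2real (\<integral>\<^sup>+x. ennreal (exp (- (p x)\<^sup>2 / 2)) \<partial>lborel) =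
      gauss_moment (CARD('n) + 1) * measure lborel {x. p x \<le> 1}"
    by (simp add: enn2real_mult gauss_moment_def measure_def)
  have 2: "measure lborel {x. p x \<le> 1} = measure lebesgue {x. p x \<le> 1}"
    using m by (simp add: measure_completion)
  have 3: "(LINT x|lborel. exp (- (p x)\<^sup>2 / 2)) = enn2real (\<integral>\<^sup>+x. ennreal (exp (- (p x)\<^sup>2 / 2)) \<partial>lborel)"
    by (rule integral_eq_nn_integral) auto
  show ?thesis unfolding 3 1 2 ..
qed

lemma gauss_total_eq: "gauss_total TYPE(real ^ 'n) = gauss_moment (CARD('n) + 1) * measure lebesgue (cball (0 :: real ^ 'n) 1)"
proof -
  have "{x :: real ^ 'n. norm x \<le> 1} = cball 0 1" by auto
  then show ?thesis unfolding gauss_total_def using integral_gauge_gaussian[of "norm :: real ^ 'n \<Rightarrow> real"] by simp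
qed

lemma support_fun_measurable: "K \<in> convex_bodies \<Longrightarrow> support_fun K \<in> borel_measurable borel"
  by (intro borel_measurable_continuous_onI continuous_on_support_fun)

lemma integral_support_gaussian:
  fixes K :: "(real ^ 'n) set"
  assumes "K \<in> convex_bodies"
  shows "(LINT y|lborel. exp (- (support_fun K y)\<^sup>2 / 2)) = gauss_moment (CARD('n) + 1) * measure lebesgue (polar_body K)"
  using integral_gauge_gaussian[OF support_fun_measurable support_fun_nonneg support_fun_scale] support_fun_unit_ball assms
  by metis

text \<open>Dividing \<open>x\<close> by its gauge gives a point of \<open>K\<close>, whose inner
  product with \<open>y\<close> is at most the support function.\<close>

lemma inner_le_support_fun:
  assumes K: "K \<in> convex_bodies"
  shows "x \<bullet> y \<le> support_fun (polar_body K) x * support_fun K y"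
proof (cases "x = 0")
  case False
  note P = polar_body_convex_bodies[OF K]
  define a where "a = support_fun (polar_body K) x"
  have a: "0 < a" unfolding a_def by (rule support_fun_pos[OF P False])
  have "support_fun (polar_body K) ((1 / a) *\<^sub>R x) \<le> 1" using a by (subst support_fun_scale[OF P]) (auto simp: a_def)
  then have "(1 / a) *\<^sub>R x \<in> K" using support_fun_unit_ball[OF P] bipolar[OF K] by auto
  from support_fun_upper[OF K this, of y] show ?thesis using a by (simp add: a_def[symmetric] field_simps)
qed (simp add: support_fun_nonneg[OF K] support_fun_nonneg[OF polar_body_convex_bodies[OF K]])

lemma convex_bodies_measure_pos:
  fixes K :: "(real ^ 'n) set"
  assumes "K \<in> convex_bodies"
  shows "0 < measure lebesgue K"
proof -
  have "K \<in> lmeasurable" "interior K \<noteq> {}" using assms by (auto simp: convex_bodies_def lmeasurable_compact)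
  then show ?thesis
    by (metis interior_subset measure_nonneg negligible_iff_measure negligible_subset open_interior open_not_negligible order_le_less)
qed

lemma integral_nth_eq_0_if_centroid_eq_0:
  fixes K :: "(real ^ 'n) set"
  assumes K: "K \<in> convex_bodies" and c: "centroid K = 0"
  shows "integrable lborel (\<lambda>x. indicator K x * x $ j)" "(LINT x|lborel. indicator K x * x $ j) = 0"
proof -
  have comp: "compact K" using K by (simp add: convex_bodies_def)
  have int: "integrable lborel (\<lambda>x. indicator K x *\<^sub>R x)"
    by (intro borel_integrable_compact comp continuous_intros)
  have "(LINT x:K|lebesgue. x) = 0"
    using c convex_bodies_measure_pos[OF K] by (simp add: centroid_def)
  moreover have "(LINT x:K|lebesgue. x) = (LINT x|lborel. indicator K x *\<^sub>R x)"
    unfolding set_lebesgue_integral_def using int by (intro integral_completion) (auto dest: borel_measurable_integrable)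
  ultimately have 0: "(LINT x|lborel. indicator K x *\<^sub>R x) = 0" by simp
  show "integrable lborel (\<lambda>x. indicator K x * x $ j)"
    using integrable_bounded_linear[OF bounded_linear_vec_nth[of j] int] by simp
  show "(LINT x|lborel. indicator K x * x $ j) = 0"
    using integral_bounded_linear[OF bounded_linear_vec_nth[of j] int] 0 by simp
qed

text \<open>The layer-cake formula with a weight of degree 1 shows that the positive and the
  negative part of the Gaussian moment are one constant \<open>m\<close> times the corresponding
  parts of the moment of \<open>K\<close>. These two agree because the centroid is the
  origin.\<close>

lemma gaussian_centred:
  fixes K :: "(real ^ 'n) set"
  assumes K: "K \<in> convex_bodies_c"
  shows "(LINT x|lborel. x $ j * exp (- (support_fun (polar_body K) x)\<^sup>2 / 2)) = 0"
proof -
  have K': "K \<in> convex_bodies" and c: "centroid K = 0" using K by (auto simp: convex_bodies_c_def)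
  note P = polar_body_convex_bodies[OF K']
  let ?p = "support_fun (polar_body K)"
  have Kp: "K = {x. ?p x \<le> 1}" using support_fun_unit_ball[OF P] bipolar[OF K'] by simp
  have [measurable]: "?p \<in> borel_measurable borel" by (rule support_fun_measurable[OF P])
  define m where "m = (\<integral>\<^sup>+s. ennreal (s ^ (DIM(real ^ 'n) + 1 + 1) * exp (- s\<^sup>2 / 2)) * indicator {0<..} s \<partial>lborel)"
  \<comment> \<open>The values \<open>d = 1\<close> and \<open>d = -1\<close> select the positive
    and the negative part of the coordinate.\<close>
  have lay: "(\<integral>\<^sup>+x. ennreal (max 0 (d * x $ j) * exp (- (?p x)\<^sup>2 / 2)) \<partial>lborel) =
      m * (\<integral>\<^sup>+x. ennreal (max 0 (d * x $ j)) * indicator {x. ?p x \<le> 1} x \<partial>lborel)" for d :: real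
    unfolding m_def
    by (rule nn_integral_gauge_gaussian)
      (auto simp: support_fun_nonneg[OF P] support_fun_scale[OF P] max_mult_distrib_left mult.left_commute)
  note int = integral_nth_eq_0_if_centroid_eq_0[OF K' c, of j]
  let ?P = "\<lambda>d. \<integral>\<^sup>+x. ennreal (max 0 (d * x $ j)) * indicator {x. ?p x \<le> 1} x \<partial>lborel"
  have eq: "?P d = (\<integral>\<^sup>+x. ennreal (d * (indicator K x * x $ j)) \<partial>lborel)" for d :: real
    by (intro nn_integral_cong) (auto simp: Kp[symmetric] indicator_def max_def ennreal_neg)
  have "0 = enn2real (?P 1) - enn2real (?P (- 1))"
    using int real_lebesgue_integral_def[OF int(1)] unfolding eq by simp
  moreover have "?P 1 \<noteq> \<infinity>" "?P (- 1) \<noteq> \<infinity>"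
    unfolding eq using int(1) by (simp_all add: real_integrable_def)
  moreover have "a = b" if "0 = enn2real a - enn2real b" "a \<noteq> \<infinity>" "b \<noteq> \<infinity>" for a b :: ennreal
    using that by (cases a; cases b) auto
  ultimately have PP: "?P 1 = ?P (- 1)" by blast
  have intf: "integrable lborel (\<lambda>x. x $ j * exp (- (?p x)\<^sup>2 / 2))"
    by (rule gaussian_dominated_integrable_nth[OF support_fun_gaussian_dominated[OF P]])
  have e: "ennreal (d * (x $ j * exp (- (?p x)\<^sup>2 / 2))) = ennreal (max 0 (d * x $ j) * exp (- (?p x)\<^sup>2 / 2))" for x and d :: real
    by (auto simp: max_def ennreal_neg mult_nonpos_nonneg mult.assoc[symmetric])
  have "(LINT x|lborel. x $ j * exp (- (?p x)\<^sup>2 / 2)) =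
      enn2real (\<integral>\<^sup>+x. ennreal (1 * (x $ j * exp (- (?p x)\<^sup>2 / 2))) \<partial>lborel) -
      enn2real (\<integral>\<^sup>+x. ennreal ((- 1) * (x $ j * exp (- (?p x)\<^sup>2 / 2))) \<partial>lborel)"
    using real_lebesgue_integral_def[OF intf] by simp
  also have "\<dots> = 0" unfolding e lay PP by simp
  finally show ?thesis .
qed

lemma linear_bij_if_inner_eq:
  fixes A B :: "'a::euclidean_space \<Rightarrow> 'a"
  assumes "linear A" "\<And>x y. A x \<bullet> B y = x \<bullet> y"
  shows "bij A"
proof -
  have "inj A"
  proof (rule linear_injective_0[OF assms(1), THEN iffD2, rule_format])
    fix x assume "A x = 0"
    then have "x \<bullet> x = 0" using assms(2)[of x x] by simp
    then show "x = 0" by simp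
  qed
  then show ?thesis using assms(1) linear_injective_imp_surjective by (auto simp: bij_def)
qed

lemma origin_symmetric_ellipsoidI:
  fixes A :: "real ^ 'n \<Rightarrow> real ^ 'n"
  assumes "linear A" "bij A"
  shows "origin_symmetric_ellipsoid {x. norm (A x) \<le> 1}"
proof -
  have "{x. norm (A x) \<le> 1} = inv A ` cball 0 1"
  proof (intro equalityI subsetI)
    fix x assume "x \<in> {x. norm (A x) \<le> 1}"
    then have "x = inv A (A x)" "A x \<in> cball 0 1" using assms(2) by (auto simp: bij_is_inj)
    then show "x \<in> inv A ` cball 0 1" by blast
  qed (use assms(2) in \<open>auto simp: surj_f_inv_f bij_is_surj\<close>)
  moreover have "linear (inv A)" using assms by (simp add: bij_is_inj bij_is_surj inj_linear_imp_inv_linear)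
  ultimately show ?thesis
    unfolding origin_symmetric_ellipsoid_def using bij_imp_bij_inv[OF assms(2)] by blast
qed

text \<open>Apply the functional inequality to the Gaussians of the gauge of \<open>K\<close> and of
  the gauge of its polar; both integrals and \<open>gauss_total\<close> carry the same factor
  \<open>k\<close>. In the equality case the gauge of \<open>K\<close> turns out to be the Euclidean
  norm composed with a linear bijection.\<close>

theorem blaschke_santalo_centroid:
  fixes K :: "(real ^ 'n) set"
  assumes K: "K \<in> convex_bodies_c"
  shows "measure lebesgue K * measure lebesgue (polar_body K) \<le> (measure lebesgue (cball (0 :: real ^ 'n) 1))\<^sup>2"
    and "measure lebesgue K * measure lebesgue (polar_body K) = (measure lebesgue (cball (0 :: real ^ 'n) 1))\<^sup>2 \<Longrightarrow>
      origin_symmetric_ellipsoid K"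
proof -
  have K': "K \<in> convex_bodies" using K by (simp add: convex_bodies_c_def)
  note P = polar_body_convex_bodies[OF K']
  let ?f = "\<lambda>x. exp (- (support_fun (polar_body K) x)\<^sup>2 / 2)" and ?g = "\<lambda>y. exp (- (support_fun K y)\<^sup>2 / 2)"
  define k where "k = gauss_moment (CARD('n) + 1)"
  have k: "0 < k" unfolding k_def by (rule gauss_moment_pos)
  have fg: "?f x * ?g y \<le> exp (- (x \<bullet> y))" for x y
    using exp_squares_le[of "support_fun (polar_body K) x" "support_fun K y"] inner_le_support_fun[OF K', of x y]
    by (meson exp_le_cancel_iff neg_le_iff_le order_trans)
  have If: "(LINT x|lborel. ?f x) = k * measure lebesgue K"
    using integral_support_gaussian[OF P] bipolar[OF K'] by (simp add: k_def)
  have Ig: "(LINT x|lborel. ?g x) = k * measure lebesgue (polar_body K)"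
    using integral_support_gaussian[OF K'] by (simp add: k_def)
  have W: "(gauss_total TYPE(real ^ 'n))\<^sup>2 = k\<^sup>2 * (measure lebesgue (cball (0 :: real ^ 'n) 1))\<^sup>2"
    by (simp add: gauss_total_eq k_def power_mult_distrib)
  have prod: "(LINT x|lborel. ?f x) * (LINT x|lborel. ?g x) = k\<^sup>2 * (measure lebesgue K * measure lebesgue (polar_body K))"
    unfolding If Ig by (simp add: power2_eq_square)
  note F = functional_santalo[OF support_fun_gaussian_dominated[OF P] support_fun_gaussian_dominated[OF K'] fg
      gaussian_centred[OF K], unfolded prod W]
  show "measure lebesgue K * measure lebesgue (polar_body K) \<le> (measure lebesgue (cball (0 :: real ^ 'n) 1))\<^sup>2"
    using F(1) k by simp
  assume "measure lebesgue K * measure lebesgue (polar_body K) = (measure lebesgue (cball (0 :: real ^ 'n) 1))\<^sup>2"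
  then have gp: "gaussian_pair ?f ?g" by (intro F(2)) simp
  obtain A B :: "real ^ 'n \<Rightarrow> real ^ 'n" and c where A: "0 < c" "linear A" "linear B" "\<And>x y. A x \<bullet> B y = x \<bullet> y"
    "\<And>x. ?f x = c * exp (- (norm (A x))\<^sup>2 / 2)" "\<And>y. ?g y = exp (- (norm (B y))\<^sup>2 / 2) / c"
    by (rule gaussian_pairE[OF gp]) (rule that)
  \<comment> \<open>Evaluating the Gaussian at the origin, where the gauge vanishes, fixes the
    amplitude \<open>c = 1\<close>.\<close>
  have "support_fun (polar_body K) 0 = 0"
    using support_fun_scale[OF P, of 2 0] by simp
  then have c: "c = 1" using A(5)[of 0] linear_0[OF A(2)] by simp
  have "support_fun (polar_body K) x = norm (A x)" for x
    using A(5)[of x] support_fun_nonneg[OF P, of x] by (simp add: c)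
  then have "K = {x. norm (A x) \<le> 1}"
    using support_fun_unit_ball[OF P] bipolar[OF K'] by simp
  then show "origin_symmetric_ellipsoid K"
    using origin_symmetric_ellipsoidI[OF A(2) linear_bij_if_inner_eq[OF A(2) A(4)]] by simp
qed

section \<open>The volume product of ellipsoids\<close>

lemma polar_body_ellipsoid:
  fixes T :: "real ^ 'n \<Rightarrow> real ^ 'n"
  assumes T: "linear T" "bij T"
  shows "polar_body (T ` cball 0 1) = {y. norm (adjoint T y) \<le> 1}" "linear (adjoint T)" "bij (adjoint T)"
proof -
  have ball: "polar_body (cball 0 1) = cball (0 :: real ^ 'n) 1" using polar_body_cball[of 1] by simp
  have "y \<in> polar_body (T ` cball 0 1) \<longleftrightarrow> adjoint T y \<in> polar_body (cball 0 1)" for y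
    using adjoint_works[OF T(1)] by (simp add: polar_body_def)
  then show "polar_body (T ` cball 0 1) = {y. norm (adjoint T y) \<le> 1}" by (auto simp: ball)
  show lin: "linear (adjoint T)" by (rule adjoint_linear[OF T(1)])
  show "bij (adjoint T)"
  proof (rule linear_bij_if_inner_eq[OF lin])
    fix x y show "adjoint T x \<bullet> inv T y = x \<bullet> y"
      using adjoint_works[OF T(1), of "inv T y" x] T(2) by (simp add: inner_commute bij_is_surj surj_f_inv_f)
  qed
qed

lemma lborel_uminus: "distr lborel borel uminus = (lborel :: 'a::euclidean_space measure)"
  using lborel_affine[of "-1" "0 :: 'a"] by (simp add: density_1 one_ennreal_def[symmetric])

text \<open>The map \<open>(x, y) \<mapsto> (L y, - inv L x)\<close> is a product of three shears, hence preserves Lebesgue measure.\<close>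

lemma nn_integral_linear_inv:
  fixes L :: "'a::euclidean_space \<Rightarrow> 'a" and F G :: "'a \<Rightarrow> ennreal"
  assumes L: "linear L" "bij L" and [measurable]: "F \<in> borel_measurable borel" "G \<in> borel_measurable borel"
  shows "(\<integral>\<^sup>+x. F (L x) \<partial>lborel) * (\<integral>\<^sup>+x. G (- inv L x) \<partial>lborel) = (\<integral>\<^sup>+x. F x \<partial>lborel) * (\<integral>\<^sup>+x. G x \<partial>lborel)"
proof -
  define L' where "L' = inv L"
  have L': "linear L'" using L by (simp add: L'_def bij_is_inj bij_is_surj inj_linear_imp_inv_linear)
  have inv: "L' (L x) = x" "L (L' x) = x" for x
    using L(2) by (simp_all add: L'_def bij_is_inj bij_is_surj surj_f_inv_f)
  have [measurable]: "L \<in> borel_measurable borel" "L' \<in> borel_measurable borel"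
    using L(1) L' by (auto intro: measurable_linear)
  have fst_shear: "(\<integral>\<^sup>+y. (\<integral>\<^sup>+x. H (C y + x) y \<partial>lborel) \<partial>lborel) = (\<integral>\<^sup>+y. (\<integral>\<^sup>+x. H x y \<partial>lborel) \<partial>lborel)"
    if [measurable]: "case_prod H \<in> borel_measurable (borel \<Otimes>\<^sub>M borel)" for H :: "'a \<Rightarrow> 'a \<Rightarrow> ennreal" and C
    by (intro nn_integral_cong nn_integral_translate[where h="\<lambda>x. H x _"]) measurable
  have "(\<integral>\<^sup>+x. F x \<partial>lborel) * (\<integral>\<^sup>+x. G x \<partial>lborel) = (\<integral>\<^sup>+y. (\<integral>\<^sup>+x. F x * G y \<partial>lborel) \<partial>lborel)"
    by (simp add: nn_integral_multc nn_integral_cmult)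
  also have "\<dots> = (\<integral>\<^sup>+y. (\<integral>\<^sup>+x. F (L y + x) * G y \<partial>lborel) \<partial>lborel)"
    by (rule fst_shear[symmetric, of "\<lambda>x y. F x * G y" L]) measurable
  also have "\<dots> = (\<integral>\<^sup>+x. (\<integral>\<^sup>+y. F (L y + x) * G y \<partial>lborel) \<partial>lborel)"
    by (rule lborel_pair.Fubini'[symmetric]) measurable
  also have "\<dots> = (\<integral>\<^sup>+x. (\<integral>\<^sup>+y. F (L (- L' x + y) + x) * G (- L' x + y) \<partial>lborel) \<partial>lborel)"
    by (rule fst_shear[symmetric, of "\<lambda>y x. F (L y + x) * G y" "\<lambda>x. - L' x"]) measurable
  also have "\<dots> = (\<integral>\<^sup>+x. (\<integral>\<^sup>+y. F (L y) * G (- L' x + y) \<partial>lborel) \<partial>lborel)"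
    by (simp add: linear_diff[OF L(1)] inv)
  also have "\<dots> = (\<integral>\<^sup>+y. (\<integral>\<^sup>+x. F (L y) * G (- L' x + y) \<partial>lborel) \<partial>lborel)"
    by (rule lborel_pair.Fubini'[symmetric]) measurable
  also have "\<dots> = (\<integral>\<^sup>+y. (\<integral>\<^sup>+x. F (L y) * G (- L' (L y + x) + y) \<partial>lborel) \<partial>lborel)"
    by (rule fst_shear[symmetric, of "\<lambda>x y. F (L y) * G (- L' x + y)" L]) measurable
  also have "\<dots> = (\<integral>\<^sup>+y. (\<integral>\<^sup>+x. F (L y) * G (- L' x) \<partial>lborel) \<partial>lborel)"
    by (simp add: linear_add[OF L'] inv)
  also have "\<dots> = (\<integral>\<^sup>+x. F (L x) \<partial>lborel) * (\<integral>\<^sup>+x. G (- L' x) \<partial>lborel)"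
    by (simp add: nn_integral_multc nn_integral_cmult)
  finally show ?thesis by (simp add: L'_def)
qed

lemma gaussian_dominated_std: "gaussian_dominated (\<lambda>x :: 'a::euclidean_space. exp (- (norm x)\<^sup>2 / 2))"
  by (rule gaussian_dominatedI[of _ "1 / 2" 1]) (auto intro!: continuous_intros)

text \<open>Take the standard Gaussian for both functions in the three-shear identity; the sign in
  front of the inverse disappears in the norm.\<close>

lemma gaussian_integral_linear_inv:
  fixes L :: "real ^ 'n \<Rightarrow> real ^ 'n"
  assumes L: "linear L" "bij L"
  shows "(LINT x|lborel. exp (- (norm (L x))\<^sup>2 / 2)) * (LINT x|lborel. exp (- (norm (inv L x))\<^sup>2 / 2)) = (gauss_total TYPE(real ^ 'n))\<^sup>2"
proof -
  have L': "linear (inv L)" "inj (inv L)"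
    using L by (simp_all add: bij_is_inj bij_is_surj inj_linear_imp_inv_linear surj_imp_inj_inv)
  have eq: "ennreal (LINT x|lborel. exp (- (norm (S x))\<^sup>2 / 2)) = (\<integral>\<^sup>+x. ennreal (exp (- (norm (S x))\<^sup>2 / 2)) \<partial>lborel)"
    if "linear S" "inj S" for S :: "real ^ 'n \<Rightarrow> real ^ 'n"
    using gaussian_dominated_integrable[OF gaussian_dominated_linear[OF gaussian_dominated_std that]]
    by (intro nn_integral_eq_integral[symmetric]) auto
  let ?g = "\<lambda>x :: real ^ 'n. ennreal (exp (- (norm x)\<^sup>2 / 2))"
  have "(\<integral>\<^sup>+x. ?g (L x) \<partial>lborel) * (\<integral>\<^sup>+x. ?g (- inv L x) \<partial>lborel) = (\<integral>\<^sup>+x. ?g x \<partial>lborel) * (\<integral>\<^sup>+x. ?g x \<partial>lborel)"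
    by (rule nn_integral_linear_inv[OF L]) measurable
  then have "ennreal ((LINT x|lborel. exp (- (norm (L x))\<^sup>2 / 2)) * (LINT x|lborel. exp (- (norm (inv L x))\<^sup>2 / 2))) =
      ennreal (gauss_total TYPE(real ^ 'n) * gauss_total TYPE(real ^ 'n))"
    using eq[OF L(1) bij_is_inj[OF L(2)]] eq[OF L'] eq[of "\<lambda>x. x"]
    by (simp add: ennreal_mult gauss_total_def linear_ident)
  then show ?thesis
    by (subst (asm) ennreal_inj) (auto simp: gauss_total_def power2_eq_square)
qed

text \<open>Cauchy-Schwarz for \<open>A x\<close> and \<open>B y\<close> yields the pairing bound,
  and evenness yields the moment condition.\<close>

lemma gaussian_integral_dual_le:
  fixes A B :: "real ^ 'n \<Rightarrow> real ^ 'n"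
  assumes A: "linear A" and B: "linear B" and AB: "\<And>x y. A x \<bullet> B y = x \<bullet> y"
  shows "(LINT x|lborel. exp (- (norm (A x))\<^sup>2 / 2)) * (LINT x|lborel. exp (- (norm (B x))\<^sup>2 / 2)) \<le> (gauss_total TYPE(real ^ 'n))\<^sup>2"
proof (rule functional_santalo(1))
  have inj: "inj A" "inj B"
    using linear_bij_if_inner_eq[OF A AB] linear_bij_if_inner_eq[OF B, of A] AB
    by (auto simp: bij_is_inj inner_commute)
  show "gaussian_dominated (\<lambda>x. exp (- (norm (A x))\<^sup>2 / 2))" "gaussian_dominated (\<lambda>x. exp (- (norm (B x))\<^sup>2 / 2))"
    by (rule gaussian_dominated_linear[OF gaussian_dominated_std A inj(1)],
        rule gaussian_dominated_linear[OF gaussian_dominated_std B inj(2)])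
  show "exp (- (norm (A x))\<^sup>2 / 2) * exp (- (norm (B y))\<^sup>2 / 2) \<le> exp (- (x \<bullet> y))" for x y
  proof -
    have "x \<bullet> y \<le> norm (A x) * norm (B y)" using norm_cauchy_schwarz[of "A x" "B y"] by (simp add: AB)
    then have "exp (- (norm (A x) * norm (B y))) \<le> exp (- (x \<bullet> y))" by simp
    with exp_squares_le show ?thesis by (rule order_trans)
  qed
  have [measurable]: "A \<in> borel_measurable borel" using A by (rule measurable_linear)
  have "(LINT x|lborel. x $ j * exp (- (norm (A x))\<^sup>2 / 2)) = (LINT x|lborel. (- x) $ j * exp (- (norm (A (- x)))\<^sup>2 / 2))" for j
    by (rule integral_measure_preserving[OF _ lborel_uminus, symmetric]) measurable
  then show "(LINT x|lborel. x $ j * exp (- (norm (A x))\<^sup>2 / 2)) = 0" for j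
    by (simp add: linear_neg[OF A])
qed

text \<open>
  Applying the Santalo inequality to \<open>(A, B)\<close> and to \<open>(inv A, inv B)\<close> bounds two numbers by
  \<open>gauss_total\<^sup>2\<close>, and their product is \<open>gauss_total ^ 4\<close>; so both bounds are equalities.
\<close>

lemma gaussian_integral_dual_eq:
  fixes A B :: "real ^ 'n \<Rightarrow> real ^ 'n"
  assumes A: "linear A" and B: "linear B" and AB: "\<And>x y. A x \<bullet> B y = x \<bullet> y"
  shows "(LINT x|lborel. exp (- (norm (A x))\<^sup>2 / 2)) * (LINT x|lborel. exp (- (norm (B x))\<^sup>2 / 2)) = (gauss_total TYPE(real ^ 'n))\<^sup>2"
proof -
  define I where "I S = (LINT x|lborel. exp (- (norm (S x))\<^sup>2 / 2))" for S :: "real ^ 'n \<Rightarrow> real ^ 'n"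
  define W where "W = gauss_total TYPE(real ^ 'n)"
  have W: "0 < W" unfolding W_def gauss_total_def by (rule gaussian_dominated_integral_pos[OF gaussian_dominated_std])
  have bij: "bij A" "bij B"
    using linear_bij_if_inner_eq[OF A AB] linear_bij_if_inner_eq[OF B, of A] AB by (auto simp: inner_commute)
  have lin: "linear (inv A)" "linear (inv B)"
    using A B bij by (simp_all add: bij_is_inj bij_is_surj inj_linear_imp_inv_linear)
  have AB': "inv A x \<bullet> inv B y = x \<bullet> y" for x y
    using AB[of "inv A x" "inv B y"] bij by (simp add: bij_is_surj surj_f_inv_f)
  have 1: "I A * I (inv A) = W\<^sup>2" "I B * I (inv B) = W\<^sup>2"
    using gaussian_integral_linear_inv[OF A bij(1)] gaussian_integral_linear_inv[OF B bij(2)] by (simp_all add: I_def W_def)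
  have 2: "I A * I B \<le> W\<^sup>2" "I (inv A) * I (inv B) \<le> W\<^sup>2"
    using gaussian_integral_dual_le[OF A B AB] gaussian_integral_dual_le[OF lin AB'] by (simp_all add: I_def W_def)
  have "(I A * I B) * (I (inv A) * I (inv B)) = (I A * I (inv A)) * (I B * I (inv B))" by (simp only: mult_ac)
  then have "(I A * I B) * (I (inv A) * I (inv B)) = W\<^sup>2 * W\<^sup>2" unfolding 1 .
  moreover have "(I A * I B) * (I (inv A) * I (inv B)) < W\<^sup>2 * W\<^sup>2" if "I A * I B < W\<^sup>2"
  proof -
    have "0 \<le> I A * I B" by (simp add: I_def)
    then have "(I A * I B) * (I (inv A) * I (inv B)) \<le> (I A * I B) * W\<^sup>2" using 2(2) by (rule mult_left_mono[rotated])
    also have "\<dots> < W\<^sup>2 * W\<^sup>2" using that W by (intro mult_strict_right_mono) auto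
    finally show ?thesis .
  qed
  ultimately have "I A * I B = W\<^sup>2" using 2(1) by fastforce
  then show ?thesis by (simp add: I_def W_def)
qed

text \<open>For \<open>K = T\<close> applied to the unit ball, the gauges of \<open>K\<close> and of
  its polar are the norms of \<open>inv T x\<close> and \<open>adjoint T y\<close>. These two maps
  are dual in the sense of \<open>gaussian_integral_dual_eq\<close>, and the layer-cake constant
  turns Gaussian integrals into volumes.\<close>

lemma ellipsoid_polar:
  fixes K :: "(real ^ 'n) set"
  assumes "origin_symmetric_ellipsoid K"
  shows "origin_symmetric_ellipsoid (polar_body K)"
    and "measure lebesgue K * measure lebesgue (polar_body K) = (measure lebesgue (cball (0 :: real ^ 'n) 1))\<^sup>2"
proof -
  obtain T :: "real ^ 'n \<Rightarrow> real ^ 'n" where T: "linear T" "bij T" "K = T ` cball 0 1"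
    using assms unfolding origin_symmetric_ellipsoid_def by blast
  note P = polar_body_ellipsoid[OF T(1,2), folded T(3)]
  show "origin_symmetric_ellipsoid (polar_body K)"
    unfolding P(1) by (rule origin_symmetric_ellipsoidI[OF P(2,3)])
  have linA: "linear (inv T)" using T by (simp add: bij_is_inj bij_is_surj inj_linear_imp_inv_linear)
  have K: "K = {x. norm (inv T x) \<le> 1}"
  proof (intro equalityI subsetI)
    fix x assume "x \<in> {x. norm (inv T x) \<le> 1}"
    then have "T (inv T x) \<in> K" unfolding T(3) by (intro imageI) simp
    then show "x \<in> K" using T(2) by (simp add: bij_is_surj surj_f_inv_f)
  qed (use T in \<open>auto simp: bij_is_inj\<close>)
  have AB: "inv T x \<bullet> adjoint T y = x \<bullet> y" for x y
    using adjoint_works[OF T(1), of "inv T x" y] T(2) by (simp add: bij_is_surj surj_f_inv_f)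
  define k where "k = gauss_moment (CARD('n) + 1)"
  have k: "0 < k" unfolding k_def by (rule gauss_moment_pos)
  have I: "(LINT x|lborel. exp (- (norm (S x))\<^sup>2 / 2)) = k * measure lebesgue {x. norm (S x) \<le> 1}"
    if "linear S" for S :: "real ^ 'n \<Rightarrow> real ^ 'n"
    unfolding k_def using measurable_linear[OF that]
    by (intro integral_gauge_gaussian) (auto simp: linear_cmul[OF that])
  have "(k * measure lebesgue K) * (k * measure lebesgue (polar_body K)) = (k * measure lebesgue (cball (0 :: real ^ 'n) 1))\<^sup>2"
    using gaussian_integral_dual_eq[OF linA P(2) AB] I[OF linA] I[OF P(2)] by (simp add: K P(1)[symmetric] gauss_total_eq k_def)
  then have "k\<^sup>2 * (measure lebesgue K * measure lebesgue (polar_body K)) = k\<^sup>2 * (measure lebesgue (cball (0 :: real ^ 'n) 1))\<^sup>2"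
    by (simp add: power2_eq_square mult_ac)
  then show "measure lebesgue K * measure lebesgue (polar_body K) = (measure lebesgue (cball (0 :: real ^ 'n) 1))\<^sup>2"
    using k by simp
qed

lemma K_tilde_convex_bodies: "K \<in> K_tilde \<Longrightarrow> K \<in> convex_bodies"
  by (auto simp: K_tilde_def convex_bodies_c_def convex_bodies_s_def)

lemma K_tilde_polar_body: "K \<in> K_tilde \<Longrightarrow> polar_body K \<in> K_tilde"
  by (auto simp: K_tilde_def convex_bodies_s_def convex_bodies_c_def bipolar polar_body_convex_bodies)

text \<open>The volume product does not change when a body is replaced by its polar, and one of the
  two has its centroid at the origin.\<close>

theorem blaschke_santalo:
  fixes K :: "(real ^ 'n) set"
  assumes K: "K \<in> K_tilde"
  shows "measure lebesgue K * measure lebesgue (polar_body K) \<le> (measure lebesgue (cball (0 :: real ^ 'n) 1))\<^sup>2"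
    and "measure lebesgue K * measure lebesgue (polar_body K) = (measure lebesgue (cball (0 :: real ^ 'n) 1))\<^sup>2 \<Longrightarrow>
      origin_symmetric_ellipsoid K"
proof -
  have B: "polar_body (polar_body K) = K" by (rule bipolar[OF K_tilde_convex_bodies[OF K]])
  have *: "K \<in> convex_bodies_c \<or> polar_body K \<in> convex_bodies_c" using K by (auto simp: K_tilde_def convex_bodies_s_def)
  show "measure lebesgue K * measure lebesgue (polar_body K) \<le> (measure lebesgue (cball (0 :: real ^ 'n) 1))\<^sup>2"
    using * blaschke_santalo_centroid(1)[of K] blaschke_santalo_centroid(1)[of "polar_body K"] B
    by (auto simp: mult.commute)
  assume eq: "measure lebesgue K * measure lebesgue (polar_body K) = (measure lebesgue (cball (0 :: real ^ 'n) 1))\<^sup>2"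
  show "origin_symmetric_ellipsoid K"
    using *
  proof
    assume "polar_body K \<in> convex_bodies_c"
    then have "origin_symmetric_ellipsoid (polar_body K)"
      by (rule blaschke_santalo_centroid(2)) (use eq in \<open>simp add: B mult.commute\<close>)
    then show ?thesis using ellipsoid_polar(1) B by metis
  qed (use blaschke_santalo_centroid(2) eq in blast)
qed

section \<open>Dual Orlicz surface areas\<close>

lemma star_body_radial:
  assumes K: "K \<in> star_bodies" and u: "u \<in> sphere 0 1"
  shows "radial K u *\<^sub>R u \<in> K" "r *\<^sub>R u \<in> K \<Longrightarrow> r \<le> radial K u" "0 < radial K u"
proof -
  have cK: "compact K" and K0: "K \<noteq> {}" and seg: "\<And>x. x \<in> K \<Longrightarrow> closed_segment 0 x \<subseteq> K"
    and pos: "0 < radial K u" using K u by (auto simp: star_bodies_def)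
  have "0 \<in> K" using K0 seg by (metis ends_in_segment(1) ex_in_conv subsetD)
  let ?S = "{r. r *\<^sub>R u \<in> K}"
  have "closed ?S"
    using closed_vimage[OF compact_imp_closed[OF cK], of "\<lambda>r. r *\<^sub>R u"] by (simp add: vimage_def continuous_intros)
  moreover obtain R where R: "\<And>x. x \<in> K \<Longrightarrow> norm x \<le> R" using compact_imp_bounded[OF cK] bounded_iff by blast
  have b: "r \<le> R" if "r \<in> ?S" for r
    using R[of "r *\<^sub>R u"] that u by simp
  have bdd: "bdd_above ?S" by (rule bdd_aboveI[of _ R]) (rule b)
  moreover have "?S \<noteq> {}" using \<open>0 \<in> K\<close> by (auto intro!: exI[of _ 0])
  ultimately have "Sup ?S \<in> ?S" using bdd by (intro closed_contains_Sup) auto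
  then show "radial K u *\<^sub>R u \<in> K" by (simp add: radial_def)
  show "r *\<^sub>R u \<in> K \<Longrightarrow> r \<le> radial K u" unfolding radial_def using bdd by (auto intro: cSup_upper)
  show "0 < radial K u" by fact
qed

text \<open>The origin is a separate case because \<open>sgn 0 = 0\<close>, and
  \<open>radial K 0\<close> is the supremum of all reals, an unspecified number.\<close>

lemma mem_star_body_iff:
  assumes K: "K \<in> star_bodies"
  shows "x \<in> K \<longleftrightarrow> x = 0 \<or> norm x \<le> radial K (sgn x)"
proof (cases "x = 0")
  case True
  have "K \<noteq> {}" "\<And>x. x \<in> K \<Longrightarrow> closed_segment 0 x \<subseteq> K" using K by (auto simp: star_bodies_def)
  then have "0 \<in> K" by (metis ends_in_segment(1) ex_in_conv subsetD)
  then show ?thesis using True by simp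
next
  case False
  then have u: "sgn x \<in> sphere 0 1" by (simp add: norm_sgn)
  have x: "x = norm x *\<^sub>R sgn x" using False by (simp add: sgn_div_norm)
  note R = star_body_radial[OF K u]
  show ?thesis
  proof
    assume "x \<in> K"
    then show "x = 0 \<or> norm x \<le> radial K (sgn x)" using R(2)[of "norm x"] x by simp
  next
    assume "x = 0 \<or> norm x \<le> radial K (sgn x)"
    then have "norm x \<le> radial K (sgn x)" using False by simp
    then have "x = (1 - norm x / radial K (sgn x)) *\<^sub>R 0 + (norm x / radial K (sgn x)) *\<^sub>R (radial K (sgn x) *\<^sub>R sgn x)"
      "0 \<le> norm x / radial K (sgn x)" "norm x / radial K (sgn x) \<le> 1"
      using R(3) x by simp_all
    then have "x \<in> closed_segment 0 (radial K (sgn x) *\<^sub>R sgn x)" unfolding closed_segment_def by blast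
    then show "x \<in> K" using K R(1) by (auto simp: star_bodies_def)
  qed
qed

section \<open>Integration over the sphere and Jensen's inequality\<close>

lemma nn_integral_spherical:
  fixes h :: "real ^ 'n \<Rightarrow> ennreal"
  assumes h: "h \<in> borel_measurable spherical_measure"
  shows "(\<integral>\<^sup>+u. h u \<partial>spherical_measure) =
    ennreal (CARD('n)) * (\<integral>\<^sup>+x. h (sgn x) * indicator (cball 0 1 - {0}) x \<partial>lborel)"
proof -
  have h': "h \<in> borel_measurable (restrict_space borel (sphere 0 1))"
    using h by (simp cong: measurable_cong_sets add: sets_spherical_measure measurable_cong_sets[OF sets_spherical_measure refl])
  show ?thesis
    unfolding spherical_measure_def
    by (subst nn_integral_scale_measure)
      (use h' in \<open>auto simp: nn_integral_distr[OF measurable_sgn_sphere] nn_integral_restrict_space ennreal_of_nat_eq_real_of_nat\<close>)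
qed

lemma spherical_integrable:
  fixes h :: "real ^ 'n \<Rightarrow> real"
  assumes h: "continuous_on (sphere 0 1) h"
  shows "integrable spherical_measure h"
proof -
  have meas: "h \<in> borel_measurable spherical_measure"
    using borel_measurable_continuous_on_restrict[OF h] by (simp add: measurable_cong_sets[OF sets_spherical_measure refl])
  obtain B where B: "\<And>u. u \<in> sphere 0 1 \<Longrightarrow> norm (h u) \<le> B"
    using compact_imp_bounded[OF compact_continuous_image[OF h compact_sphere]] by (metis bounded_iff image_eqI)
  have "emeasure spherical_measure (space spherical_measure :: (real ^ 'n) set) = (\<integral>\<^sup>+u. 1 \<partial>(spherical_measure :: (real ^ 'n) measure))"
    by simp
  also have "\<dots> = ennreal (CARD('n)) * emeasure lborel (cball 0 1 - {0 :: real ^ 'n})"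
    by (subst nn_integral_spherical) auto
  also have "\<dots> < \<infinity>"
    using emeasure_bounded_finite[of "cball 0 1 - {0 :: real ^ 'n}"] bounded_subset[OF bounded_cball]
    by (auto simp: ennreal_mult_less_top)
  finally interpret finite_measure "spherical_measure :: (real ^ 'n) measure"
    by (intro finite_measureI) auto
  show ?thesis
    by (rule integrable_const_bound[where B=B]) (use B meas in \<open>auto intro!: AE_I2 simp: space_spherical_measure\<close>)
qed

text \<open>The spherical measure is defined by projecting the unit ball, so the integral is one
  over the ball of a power of \<open>norm x / p x\<close>, with \<open>p\<close> the gauge of
  \<open>K\<close>; the polar coordinate formula evaluates it.\<close>

lemma integral_radial_power:
  fixes K :: "(real ^ 'n) set"
  assumes K: "K \<in> star_bodies"
  shows "(LINT u|spherical_measure. radial K u ^ CARD('n)) = real CARD('n) * measure lebesgue K"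
proof -
  define p where "p x = norm x / radial K (sgn x)" for x
  have cont: "continuous_on (sphere 0 1) (radial K)" using K by (simp add: star_bodies_def)
  have pos: "0 < radial K (sgn x)" if "x \<noteq> 0" for x
    using star_body_radial(3)[OF K, of "sgn x"] that by (simp add: norm_sgn)
  have "continuous_on (- {0}) (\<lambda>x :: real ^ 'n. x /\<^sub>R norm x)"
    by (intro continuous_intros) auto
  then have "continuous_on (- {0}) (\<lambda>x :: real ^ 'n. sgn x)" by (simp add: sgn_div_norm)
  then have "continuous_on (- {0}) (\<lambda>x. radial K (sgn x))"
    by (rule continuous_on_compose2[OF cont]) (auto simp: norm_sgn split: if_splits)
  then have "continuous_on (- {0}) p"
    unfolding p_def[abs_def] by (intro continuous_intros) (use pos in \<open>auto simp: less_imp_neq[symmetric]\<close>)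
  then have "(\<lambda>x. indicator (- {0}) x *\<^sub>R p x) \<in> borel_measurable borel"
    by (intro borel_measurable_continuous_on_indicator) auto
  \<comment> \<open>The indicator changes nothing: \<open>p 0 = 0\<close> whatever value
    \<open>radial K 0\<close> has.\<close>
  moreover have "(\<lambda>x. indicator (- {0}) x *\<^sub>R p x) = p" by (auto simp: p_def indicator_def)
  ultimately have pm: "p \<in> borel_measurable borel" by simp
  have p0: "0 < p x" if "x \<noteq> 0" for x using pos[OF that] that by (simp add: p_def)
  have pt: "p (t *\<^sub>R x) = t * p x" if "0 < t" for t x using that by (simp add: p_def sgn_scaleR)
  have Kp: "{x. p x \<le> 1} = K"
  proof -
    have "p x \<le> 1 \<longleftrightarrow> x \<in> K" for x
      using pos[of x] by (cases "x = 0") (auto simp: mem_star_body_iff[OF K] p_def)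
    then show ?thesis by blast
  qed
  have meas: "(\<lambda>u. ennreal (radial K u ^ CARD('n))) \<in> borel_measurable spherical_measure"
    using borel_measurable_continuous_on_restrict[OF cont] by (simp add: measurable_cong_sets[OF sets_spherical_measure refl])
  have "(\<integral>\<^sup>+u. ennreal (radial K u ^ CARD('n)) \<partial>spherical_measure) =
      ennreal (CARD('n)) * (\<integral>\<^sup>+x. ennreal (radial K (sgn x) ^ CARD('n)) * indicator (cball 0 1 - {0}) x \<partial>lborel)"
    by (rule nn_integral_spherical[OF meas])
  also have "(\<integral>\<^sup>+x. ennreal (radial K (sgn x) ^ CARD('n)) * indicator (cball 0 1 - {0}) x \<partial>lborel) =
      (\<integral>\<^sup>+x. ennreal ((norm x / p x) ^ DIM(real ^ 'n)) * indicator (cball 0 1 - {0}) x \<partial>lborel)"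
    by (intro nn_integral_cong) (auto simp: p_def indicator_def)
  also have "\<dots> = emeasure lborel K" using nn_integral_polar[OF pm p0 pt] by (simp add: Kp)
  finally have *: "(\<integral>\<^sup>+u. ennreal (radial K u ^ CARD('n)) \<partial>spherical_measure) = ennreal (CARD('n)) * emeasure lborel K" .
  have "compact K" using K by (simp add: star_bodies_def)
  then have "measure lborel K = measure lebesgue K" by (simp add: measure_completion borel_compact)
  moreover have "(LINT u|spherical_measure. radial K u ^ CARD('n)) = enn2real (\<integral>\<^sup>+u. ennreal (radial K u ^ CARD('n)) \<partial>spherical_measure)"
  proof (rule integral_eq_nn_integral)
    show "(\<lambda>u. radial K u ^ CARD('n)) \<in> borel_measurable spherical_measure"
      using borel_measurable_continuous_on_restrict[OF cont] by (simp add: measurable_cong_sets[OF sets_spherical_measure refl])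
    show "AE u in spherical_measure. 0 \<le> radial K u ^ CARD('n)"
      using star_body_radial(3)[OF K] by (intro AE_I2) (auto simp: space_spherical_measure less_imp_le)
  qed
  ultimately show ?thesis unfolding * by (simp add: enn2real_mult measure_def)
qed

lemma star_bodies_measure_pos:
  fixes K :: "(real ^ 'n) set"
  assumes K: "K \<in> star_bodies"
  shows "0 < measure lebesgue K"
proof -
  have cont: "continuous_on (sphere 0 1) (radial K)" using K by (simp add: star_bodies_def)
  obtain u :: "real ^ 'n" where u: "u \<in> sphere 0 1" "\<And>v. v \<in> sphere 0 1 \<Longrightarrow> radial K u \<le> radial K v"
    using continuous_attains_inf[OF compact_sphere _ cont] by (metis sphere_eq_empty not_one_less_zero)
  define e where "e = radial K u"
  have e: "0 < e" unfolding e_def by (rule star_body_radial(3)[OF K u(1)])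
  have "cball 0 e \<subseteq> K"
  proof
    fix x :: "real ^ 'n" assume x: "x \<in> cball 0 e"
    then show "x \<in> K" using u(2)[of "sgn x"] by (cases "x = 0") (auto simp: mem_star_body_iff[OF K] norm_sgn e_def)
  qed
  then have "measure lebesgue (cball (0 :: real ^ 'n) e) \<le> measure lebesgue K"
    by (rule measure_mono_fmeasurable) (use K in \<open>auto simp: star_bodies_def lmeasurable_compact fmeasurableD\<close>)
  moreover have "0 < measure lebesgue (cball (0 :: real ^ 'n) e)"
    using e by (intro convex_bodies_measure_pos) (auto simp: convex_bodies_def)
  ultimately show ?thesis by (rule less_le_trans[rotated])
qed

lemma radial_scale:
  assumes L: "L \<in> star_bodies" and c: "0 < c" and u: "u \<in> sphere 0 1"
  shows "radial ((*\<^sub>R) c ` L) u = c * radial L u"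
  unfolding radial_def[of "(*\<^sub>R) c ` L"]
proof (rule cSup_eq_maximum)
  note R = star_body_radial[OF L u]
  have "(c * radial L u) *\<^sub>R u = c *\<^sub>R (radial L u *\<^sub>R u)" by simp
  then show "c * radial L u \<in> {r. r *\<^sub>R u \<in> (*\<^sub>R) c ` L}" using R(1) by blast
  fix r assume "r \<in> {r. r *\<^sub>R u \<in> (*\<^sub>R) c ` L}"
  then obtain l where l: "l \<in> L" "r *\<^sub>R u = c *\<^sub>R l" by auto
  then have "(r / c) *\<^sub>R u = l" using c by (metis divideR_right divide_inverse_commute less_irrefl scaleR_scaleR)
  then show "r \<le> c * radial L u" using R(2)[of "r / c"] l c by (simp add: field_simps)
qed

lemma surface_functional_eq:
  fixes K L :: "(real ^ 'n) set"
  assumes L: "L \<in> star_bodies" and c: "0 < vrad (polar_body L)"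
  shows "surface_functional \<phi> K L =
    (LINT u|spherical_measure. \<phi> (vrad (polar_body L) * radial L u / radial K u) * radial K u ^ CARD('n))"
  unfolding surface_functional_def dual_mixed_volume_def
  by (simp, intro Bochner_Integration.integral_cong) (auto simp: space_spherical_measure radial_scale[OF L c])

text \<open>Jensen's inequality for the weight \<open>radial K u ^ n\<close>, where n is the
  dimension. The mean of \<open>(c * radial L u / radial K u) ^ n\<close> is the argument of
  \<open>G\<close> on the left. A supporting line of \<open>G\<close> at this mean is integrated,
  and its linear term cancels.\<close>

lemma jensen_radial:
  fixes K L :: "(real ^ 'n) set" and G :: "real \<Rightarrow> real"
  assumes K: "K \<in> star_bodies" and L: "L \<in> star_bodies" and c: "0 < c"
    and G: "convex_on {0<..} G" "continuous_on {0<..} G"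
  shows "real CARD('n) * measure lebesgue K * G (c ^ CARD('n) * measure lebesgue L / measure lebesgue K) \<le>
    (LINT u|spherical_measure. G ((c * radial L u / radial K u) ^ CARD('n)) * radial K u ^ CARD('n))"
proof -
  let ?n = "CARD('n)"
  define t where "t = c ^ ?n * measure lebesgue L / measure lebesgue K"
  have mK: "0 < measure lebesgue K" and mL: "0 < measure lebesgue L" using star_bodies_measure_pos K L by auto
  then have t: "0 < t" using c by (simp add: t_def)
  have contK: "continuous_on (sphere 0 1) (radial K)" and contL: "continuous_on (sphere 0 1) (radial L)"
    using K L by (auto simp: star_bodies_def)
  \<comment> \<open>The right derivative of \<open>G\<close> at \<open>t\<close>, written as an
    infimum of difference quotients; it is the slope of a supporting line.\<close>
  define a where "a = Inf ((\<lambda>s. (G t - G s) / (t - s)) ` ({t<..} \<inter> {0<..}))"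
  have line: "G t + a * (s - t) \<le> G s" if "0 < s" for s
    using convex_le_Inf_differential[OF G(1), of t s] t that by (simp add: a_def interior_open)
  have "(LINT u|spherical_measure. G t * radial K u ^ ?n + a * (c ^ ?n * radial L u ^ ?n - t * radial K u ^ ?n)) \<le>
    (LINT u|spherical_measure. G ((c * radial L u / radial K u) ^ ?n) * radial K u ^ ?n)"
  proof (rule integral_mono)
    show "integrable spherical_measure (\<lambda>u. G t * radial K u ^ ?n + a * (c ^ ?n * radial L u ^ ?n - t * radial K u ^ ?n))"
      by (intro spherical_integrable continuous_intros contK contL)
    show "integrable spherical_measure (\<lambda>u. G ((c * radial L u / radial K u) ^ ?n) * radial K u ^ ?n)"
      by (intro spherical_integrable continuous_intros contK contL continuous_on_compose2[OF G(2)])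
        (use star_body_radial(3)[OF K] star_body_radial(3)[OF L] c in \<open>force+\<close>)
    fix u :: "real ^ 'n" assume "u \<in> space spherical_measure"
    then have u: "0 < radial K u" "0 < radial L u"
      using star_body_radial(3) K L by (auto simp: space_spherical_measure)
    have "G t + a * ((c * radial L u / radial K u) ^ ?n - t) \<le> G ((c * radial L u / radial K u) ^ ?n)"
      using u c by (intro line) simp
    then have "(G t + a * ((c * radial L u / radial K u) ^ ?n - t)) * radial K u ^ ?n \<le> G ((c * radial L u / radial K u) ^ ?n) * radial K u ^ ?n"
      using u by (intro mult_right_mono) auto
    moreover have "(c * radial L u / radial K u) ^ ?n * radial K u ^ ?n = c ^ ?n * radial L u ^ ?n"
      using u by (simp add: power_mult_distrib[symmetric])
    ultimately show "G t * radial K u ^ ?n + a * (c ^ ?n * radial L u ^ ?n - t * radial K u ^ ?n) \<le>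
        G ((c * radial L u / radial K u) ^ ?n) * radial K u ^ ?n"
      by (simp add: algebra_simps)
  qed
  also have "(LINT u|spherical_measure. G t * radial K u ^ ?n + a * (c ^ ?n * radial L u ^ ?n - t * radial K u ^ ?n)) =
      G t * (real ?n * measure lebesgue K) + a * (c ^ ?n * (real ?n * measure lebesgue L) - t * (real ?n * measure lebesgue K))"
    using spherical_integrable[OF continuous_on_power[OF contK]] spherical_integrable[OF continuous_on_power[OF contL]]
    by (simp add: integral_radial_power K L)
  also have "c ^ ?n * (real ?n * measure lebesgue L) - t * (real ?n * measure lebesgue K) = 0"
    using mK by (simp add: t_def)
  finally show ?thesis unfolding t_def[symmetric] by (simp add: mult.commute)
qed

text \<open>The radial function is the reciprocal of the gauge, which is continuous and positive
  away from the origin.\<close>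

lemma convex_bodies_star_bodies:
  fixes K :: "(real ^ 'n) set"
  assumes K: "K \<in> convex_bodies"
  shows "K \<in> star_bodies"
proof -
  note P = polar_body_convex_bodies[OF K]
  have Kp: "K = {x. support_fun (polar_body K) x \<le> 1}" using support_fun_unit_ball[OF P] bipolar[OF K] by simp
  have K0: "0 \<in> K" and cK: "compact K" "convex K" using K interior_subset by (auto simp: convex_bodies_def)
  have pos: "0 < support_fun (polar_body K) u" if "u \<in> sphere 0 1" for u
    using that by (intro support_fun_pos[OF P]) auto
  have rad: "radial K u = 1 / support_fun (polar_body K) u" if "u \<in> sphere 0 1" for u
    unfolding radial_def
  proof (rule cSup_eq_maximum)
    note p = pos[OF that]
    have mem: "r *\<^sub>R u \<in> K \<longleftrightarrow> r \<le> 1 / support_fun (polar_body K) u" if "0 < r" for r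
      using that p by (subst Kp) (simp add: support_fun_scale[OF P] pos_le_divide_eq)
    then show "1 / support_fun (polar_body K) u \<in> {r. r *\<^sub>R u \<in> K}" using p by simp
    show "r \<le> 1 / support_fun (polar_body K) u" if "r \<in> {r. r *\<^sub>R u \<in> K}" for r
      using that mem[of r] p by (cases "0 < r") (auto intro: order_trans[of r 0])
  qed
  have "continuous_on (sphere 0 1) (\<lambda>u. 1 / support_fun (polar_body K) u)"
    using pos by (intro continuous_intros continuous_on_support_fun[OF P]) (auto simp: less_imp_neq[symmetric])
  then have "continuous_on (sphere 0 1) (radial K)" using rad by (simp cong: continuous_on_cong_simp)
  moreover have "0 < radial K u" if "u \<in> sphere 0 1" for u using rad[OF that] pos[OF that] by simp
  moreover have "closed_segment 0 x \<subseteq> K" if "x \<in> K" for x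
    by (rule closed_segment_subset[OF K0 that cK(2)])
  ultimately show ?thesis using K0 cK unfolding star_bodies_def by blast
qed

lemma K_tilde_subset_S_tilde: "K_tilde \<subseteq> S_tilde"
  using K_tilde_convex_bodies K_tilde_polar_body convex_bodies_star_bodies by (auto simp: S_tilde_def)

lemma subset_bipolar: "L \<subseteq> polar_body (polar_body L)"
  by (auto simp: polar_body_def inner_commute)

text \<open>\<open>L\<close> lies in its bipolar \<open>C\<close>, which has the same polar, so
  enlarging \<open>L\<close> to \<open>C\<close> can only increase the volume product, and the
  inequality for the body \<open>polar_body L\<close> applies. In the equality case
  \<open>C - L\<close> is null.\<close>

theorem blaschke_santalo_star:
  fixes L :: "(real ^ 'n) set"
  assumes L: "L \<in> S_tilde"
  shows "measure lebesgue L * measure lebesgue (polar_body L) \<le> (measure lebesgue (cball (0 :: real ^ 'n) 1))\<^sup>2"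
    and "measure lebesgue L * measure lebesgue (polar_body L) = (measure lebesgue (cball (0 :: real ^ 'n) 1))\<^sup>2 \<Longrightarrow>
      origin_symmetric_ellipsoid L"
proof -
  define C where "C = polar_body (polar_body L)"
  have PL: "polar_body L \<in> K_tilde" and sL: "L \<in> star_bodies" using L by (auto simp: S_tilde_def)
  have PLc: "polar_body L \<in> convex_bodies" by (rule K_tilde_convex_bodies[OF PL])
  have C: "C \<in> convex_bodies" unfolding C_def by (rule polar_body_convex_bodies[OF PLc])
  have LC: "L \<subseteq> C" unfolding C_def by (rule subset_bipolar)
  have cL: "compact L" using sL by (simp add: star_bodies_def)
  have mL: "L \<in> lmeasurable" and mC: "C \<in> lmeasurable"
    using cL C by (auto simp: convex_bodies_def lmeasurable_compact)
  have le: "measure lebesgue L \<le> measure lebesgue C"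
    using LC mL mC by (intro measure_mono_fmeasurable) (auto simp: fmeasurableD)
  have pos: "0 < measure lebesgue (polar_body L)" by (rule convex_bodies_measure_pos[OF PLc])
  have le': "measure lebesgue L * measure lebesgue (polar_body L) \<le> measure lebesgue (polar_body L) * measure lebesgue C"
    using mult_right_mono[OF le less_imp_le[OF pos]] by (simp add: mult.commute)
  note BS = blaschke_santalo[OF PL, folded C_def]
  show "measure lebesgue L * measure lebesgue (polar_body L) \<le> (measure lebesgue (cball (0 :: real ^ 'n) 1))\<^sup>2"
    using le' BS(1) by linarith
  assume eq: "measure lebesgue L * measure lebesgue (polar_body L) = (measure lebesgue (cball (0 :: real ^ 'n) 1))\<^sup>2"
  then have eq': "measure lebesgue (polar_body L) * measure lebesgue C = (measure lebesgue (cball (0 :: real ^ 'n) 1))\<^sup>2"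
    using le' BS(1) by linarith
  have ell: "origin_symmetric_ellipsoid C"
    unfolding C_def using BS(2)[OF eq'] by (rule ellipsoid_polar(1))
  have "measure lebesgue (polar_body L) * measure lebesgue L = measure lebesgue (polar_body L) * measure lebesgue C"
    using eq eq' by (simp add: mult.commute)
  then have mm: "measure lebesgue L = measure lebesgue C" using pos by simp
  have "measure lebesgue (C - L) = 0"
    using measurable_measure_Diff[OF mC fmeasurableD[OF mL] LC] mm by simp
  then have "negligible (C - L)"
    using mC mL by (simp add: negligible_iff_measure fmeasurable_Diff fmeasurableD)
  then have "negligible (interior C - L)"
    by (rule negligible_subset) (use interior_subset in blast)
  moreover have "open (interior C - L)" using compact_imp_closed[OF cL] by (simp add: open_Diff)
  ultimately have "interior C \<subseteq> L" using open_not_negligible by blast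
  then have "closure (interior C) \<subseteq> L" using compact_imp_closed[OF cL] by (simp add: closure_minimal)
  moreover have "closure (interior C) = C"
    using C convex_closure_interior[of C] by (auto simp: convex_bodies_def closure_closed compact_imp_closed)
  ultimately have "L = C" using LC by auto
  then show "origin_symmetric_ellipsoid L" using ell by simp
qed

section \<open>Balls and the bounds for the surface functional\<close>

lemma vrad_power:
  fixes K :: "(real ^ 'n) set"
  shows "vrad K ^ CARD('n) = measure lebesgue K / measure lebesgue (cball (0 :: real ^ 'n) 1)"
  unfolding vrad_def by (rule real_root_pow_pos2) auto

lemma cball_convex_bodies: "0 < r \<Longrightarrow> cball (0 :: real ^ 'n) r \<in> convex_bodies"
  by (auto simp: convex_bodies_def)

lemma cball_K_tilde: "0 < r \<Longrightarrow> cball (0 :: real ^ 'n) r \<in> K_tilde"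
proof -
  assume r: "0 < r"
  let ?B = "cball (0 :: real ^ 'n) r"
  have int: "integrable lborel (\<lambda>x. indicator ?B x *\<^sub>R x)"
    by (intro borel_integrable_compact compact_cball continuous_intros)
  have "(LINT x:?B|lebesgue. x) = (LINT x|lborel. indicator ?B x *\<^sub>R x)"
    unfolding set_lebesgue_integral_def using int by (intro integral_completion) (auto dest: borel_measurable_integrable)
  also have "\<dots> = 0"
  proof -
    have "(LINT x|lborel. indicator ?B x *\<^sub>R x) = (LINT x|distr lborel borel uminus. indicator ?B x *\<^sub>R x)"
      by (simp add: lborel_uminus)
    also have "\<dots> = (LINT x|lborel. indicator ?B (- x) *\<^sub>R (- x))"
      using int by (intro integral_distr) (auto dest: borel_measurable_integrable)
    also have "\<dots> = (LINT x|lborel. - (indicator ?B x *\<^sub>R x))"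
      by (intro Bochner_Integration.integral_cong) (auto simp: indicator_def)
    also have "\<dots> = - (LINT x|lborel. indicator ?B x *\<^sub>R x)" by simp
    finally have *: "(LINT x|lborel. indicator ?B x *\<^sub>R x) = - (LINT x|lborel. indicator ?B x *\<^sub>R x)" .
    have "w = 0" if "w = - w" for w :: "real ^ 'n" using that by (simp add: vec_eq_iff)
    then show ?thesis using * by blast
  qed
  finally have "centroid ?B = 0" by (simp add: centroid_def)
  then show "?B \<in> K_tilde" using cball_convex_bodies[where 'n='n, OF r] by (simp add: K_tilde_def convex_bodies_c_def)
qed

lemma scaled_unit_cball:
  assumes "0 < r"
  shows "(*\<^sub>R) r ` cball 0 1 = cball (0 :: 'a::real_normed_vector) r"
proof (intro equalityI subsetI)
  fix x :: 'a assume "x \<in> cball 0 r"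
  then have "x = r *\<^sub>R ((1 / r) *\<^sub>R x)" "(1 / r) *\<^sub>R x \<in> cball 0 1" using assms by (auto simp: field_simps)
  then show "x \<in> (*\<^sub>R) r ` cball 0 1" by blast
qed (use assms in \<open>auto simp: mult_le_cancel_left1\<close>)

lemma radial_cball:
  assumes "0 < r" "u \<in> sphere 0 1"
  shows "radial (cball 0 r) u = r"
  unfolding radial_def using assms by (intro cSup_eq_maximum) auto

lemma measure_cball_scale:
  assumes r: "0 < r"
  shows "measure lebesgue (cball (0 :: real ^ 'n) r) = r ^ CARD('n) * measure lebesgue (cball (0 :: real ^ 'n) 1)"
proof -
  have "real CARD('n) * measure lebesgue (cball (0 :: real ^ 'n) r) = (LINT u|spherical_measure. radial (cball (0 :: real ^ 'n) r) u ^ CARD('n))"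
    by (rule integral_radial_power[symmetric, OF convex_bodies_star_bodies[OF cball_convex_bodies[OF r]]])
  also have "\<dots> = (LINT u::real ^ 'n|spherical_measure. r ^ CARD('n) * radial (cball (0 :: real ^ 'n) 1) u ^ CARD('n))"
    using r by (intro Bochner_Integration.integral_cong) (auto simp: space_spherical_measure radial_cball)
  also have "\<dots> = r ^ CARD('n) * (real CARD('n) * measure lebesgue (cball (0 :: real ^ 'n) 1))"
    by (simp add: integral_radial_power[OF convex_bodies_star_bodies[OF cball_convex_bodies]])
  finally show ?thesis by simp
qed

text \<open>The common value of the surface areas at a ball of volume \<open>V\<close>.\<close>

definition ball_value :: "'n::finite itself \<Rightarrow> (real \<Rightarrow> real) \<Rightarrow> real \<Rightarrow> real" where
  "ball_value _ \<phi> V = real CARD('n) * V * F_of CARD('n) \<phi> (measure lebesgue (cball (0 :: real ^ 'n) 1) / V)"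

lemma F_of_power: "0 < t \<Longrightarrow> F_of CARD('n::finite) \<phi> (t ^ CARD('n)) = \<phi> t"
  by (simp add: F_of_def real_root_power_cancel)

lemma continuous_on_F_of:
  assumes "admissible \<phi>" "0 < n"
  shows "continuous_on {0<..} (F_of n \<phi>)"
proof -
  have "continuous_on {0<..} \<phi>" using assms by (simp add: admissible_def)
  then show ?thesis unfolding F_of_def[abs_def]
    by (rule continuous_on_compose2) (use assms(2) in \<open>auto intro!: continuous_intros simp: real_root_gt_zero\<close>)
qed

lemma convex_on_if_strictly_convex_on: "strictly_convex_on S f \<Longrightarrow> convex_on S f"
proof (rule convex_onI)
  fix t x y :: real assume *: "strictly_convex_on S f" "0 < t" "t < 1" "x \<in> S" "y \<in> S"
  show "f ((1 - t) *\<^sub>R x + t *\<^sub>R y) \<le> (1 - t) * f x + t * f y"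
  proof (cases "x = y")
    case False
    then have "f ((1 - t) * x + t * y) < (1 - t) * f x + t * f y"
      using * unfolding strictly_convex_on_def by blast
    then show ?thesis by simp
  qed (simp add: algebra_simps)
qed (simp add: strictly_convex_on_def)

lemma convex_on_if_constant_on: "convex S \<Longrightarrow> f constant_on S \<Longrightarrow> convex_on S f" for f :: "real \<Rightarrow> real"
proof (rule convex_onI)
  fix t x y :: real assume *: "convex S" "f constant_on S" "0 < t" "t < 1" "x \<in> S" "y \<in> S"
  then have "(1 - t) *\<^sub>R x + t *\<^sub>R y \<in> S" by (intro convexD) auto
  then show "f ((1 - t) *\<^sub>R x + t *\<^sub>R y) \<le> (1 - t) * f x + t * f y"
    using * by (auto simp: constant_on_def algebra_simps)
qed

text \<open>The constant and the strictly convex alternative share what the estimate rests on: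
  convexity for Jensen's inequality, monotonicity for the Santalo inequality.\<close>

lemma Phi_tilde_1_D:
  assumes "\<phi> \<in> Phi_tilde_1 n"
  shows "admissible \<phi>" "convex_on {0<..} (F_of n \<phi>)" "0 < s \<Longrightarrow> s \<le> t \<Longrightarrow> F_of n \<phi> t \<le> F_of n \<phi> s"
proof -
  show "admissible \<phi>" using assms by (simp add: Phi_tilde_1_def Phi_tilde_def)
  have *: "F_of n \<phi> constant_on {0<..} \<or> antimono_on {0<..} (F_of n \<phi>) \<and> strictly_convex_on {0<..} (F_of n \<phi>)"
    using assms by (simp add: Phi_tilde_1_def)
  then show "convex_on {0<..} (F_of n \<phi>)"
    using convex_on_if_strictly_convex_on convex_on_if_constant_on convex_real_interval by blast
  show "0 < s \<Longrightarrow> s \<le> t \<Longrightarrow> F_of n \<phi> t \<le> F_of n \<phi> s"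
    using * by (auto simp: constant_on_def monotone_on_def)
qed

lemma Psi_tilde_D:
  assumes "\<phi> \<in> Psi_tilde n"
  shows "admissible \<phi>" "convex_on {0<..} (\<lambda>t. - F_of n \<phi> t)" "0 < s \<Longrightarrow> s \<le> t \<Longrightarrow> F_of n \<phi> s \<le> F_of n \<phi> t"
proof -
  show "admissible \<phi>" using assms by (simp add: Psi_tilde_def)
  have *: "F_of n \<phi> constant_on {0<..} \<or> mono_on {0<..} (F_of n \<phi>) \<and> strictly_concave_on {0<..} (F_of n \<phi>)"
    using assms by (simp add: Psi_tilde_def)
  have "(\<lambda>t. - F_of n \<phi> t) constant_on {0<..}" if "F_of n \<phi> constant_on {0<..}"
    using that by (auto simp: constant_on_def)
  then show "convex_on {0<..} (\<lambda>t. - F_of n \<phi> t)"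
    using * convex_on_if_strictly_convex_on convex_on_if_constant_on convex_real_interval
    unfolding strictly_concave_on_def by blast
  show "0 < s \<Longrightarrow> s \<le> t \<Longrightarrow> F_of n \<phi> s \<le> F_of n \<phi> t"
    using * by (auto simp: constant_on_def monotone_on_def)
qed

lemma unit_cball_measure_pos: "0 < measure lebesgue (cball (0 :: real ^ 'n) 1)"
  by (rule convex_bodies_measure_pos[OF cball_convex_bodies]) simp

lemma vrad_pos:
  fixes K :: "(real ^ 'n) set"
  shows "0 < measure lebesgue K \<Longrightarrow> 0 < vrad K"
  unfolding vrad_def using unit_cball_measure_pos by (simp add: real_root_gt_zero)

lemma S_tilde_D:
  fixes L :: "(real ^ 'n) set"
  assumes L: "L \<in> S_tilde"
  shows "L \<in> star_bodies" "0 < vrad (polar_body L)"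
proof -
  show "L \<in> star_bodies" using L by (simp add: S_tilde_def)
  have "polar_body L \<in> convex_bodies" using L by (auto simp: S_tilde_def intro: K_tilde_convex_bodies)
  then show "0 < vrad (polar_body L)" by (intro vrad_pos convex_bodies_measure_pos)
qed

lemma surface_functional_F_of:
  fixes K L :: "(real ^ 'n) set"
  assumes K: "K \<in> star_bodies" and L: "L \<in> S_tilde"
  shows "surface_functional \<phi> K L = (LINT u|spherical_measure.
    F_of CARD('n) \<phi> ((vrad (polar_body L) * radial L u / radial K u) ^ CARD('n)) * radial K u ^ CARD('n))"
  unfolding surface_functional_eq[OF S_tilde_D[OF L]]
proof (intro Bochner_Integration.integral_cong refl)
  fix u :: "real ^ 'n" assume "u \<in> space spherical_measure"
  then have u: "u \<in> sphere 0 1" by (simp add: space_spherical_measure)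
  then show "\<phi> (vrad (polar_body L) * radial L u / radial K u) * radial K u ^ CARD('n) =
    F_of CARD('n) \<phi> ((vrad (polar_body L) * radial L u / radial K u) ^ CARD('n)) * radial K u ^ CARD('n)"
    using star_body_radial(3)[OF K u] star_body_radial(3)[OF S_tilde_D(1)[OF L] u] S_tilde_D(2)[OF L]
    by (subst F_of_power) auto
qed

text \<open>The Santalo inequality in terms of the volume radius. The left-hand side is the mean at
  which Jensen's inequality evaluates \<open>F\<close>; the right-hand side is the argument of
  \<open>F\<close> in \<open>ball_value\<close>.\<close>

lemma santalo_argument_le:
  fixes K L :: "(real ^ 'n) set"
  assumes K: "K \<in> star_bodies" and L: "L \<in> S_tilde"
  shows "vrad (polar_body L) ^ CARD('n) * measure lebesgue L / measure lebesgue K \<le> measure lebesgue (cball (0 :: real ^ 'n) 1) / measure lebesgue K"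
    and "0 < vrad (polar_body L) ^ CARD('n) * measure lebesgue L / measure lebesgue K"
proof -
  note w = unit_cball_measure_pos[where 'n='n]
  have "vrad (polar_body L) ^ CARD('n) * measure lebesgue L \<le> measure lebesgue (cball (0 :: real ^ 'n) 1)"
    unfolding vrad_power using blaschke_santalo_star(1)[OF L] w
    by (simp add: divide_le_eq power2_eq_square mult.commute)
  then show "vrad (polar_body L) ^ CARD('n) * measure lebesgue L / measure lebesgue K \<le> measure lebesgue (cball (0 :: real ^ 'n) 1) / measure lebesgue K"
    using star_bodies_measure_pos[OF K] by (intro divide_right_mono) auto
  show "0 < vrad (polar_body L) ^ CARD('n) * measure lebesgue L / measure lebesgue K"
    using star_bodies_measure_pos[OF K] star_bodies_measure_pos[OF S_tilde_D(1)[OF L]] S_tilde_D(2)[OF L] by simp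
qed

text \<open>Convexity bounds the functional below by \<open>F\<close> at the mean, and since
  \<open>F\<close> is nonincreasing, raising the mean to its largest value allowed by the Santalo
  inequality lowers the bound further.\<close>

lemma ball_value_le_surface_functional:
  fixes K L :: "(real ^ 'n) set"
  assumes phi: "\<phi> \<in> Phi_tilde_1 CARD('n)" and K: "K \<in> star_bodies" and L: "L \<in> S_tilde"
  shows "ball_value TYPE('n) \<phi> (measure lebesgue K) \<le> surface_functional \<phi> K L"
proof -
  note P = Phi_tilde_1_D[OF phi]
  have "ball_value TYPE('n) \<phi> (measure lebesgue K) \<le> real CARD('n) * measure lebesgue K *
      F_of CARD('n) \<phi> (vrad (polar_body L) ^ CARD('n) * measure lebesgue L / measure lebesgue K)"
    unfolding ball_value_def using P(3)[OF santalo_argument_le(2,1)[OF K L]] by (intro mult_left_mono) auto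
  also have "\<dots> \<le> surface_functional \<phi> K L"
    unfolding surface_functional_F_of[OF K L]
    by (rule jensen_radial[OF K S_tilde_D[OF L] P(2) continuous_on_F_of[OF P(1)]]) simp
  finally show ?thesis .
qed

text \<open>Jensen's inequality is applied to \<open>- F\<close>, and now \<open>F\<close> is
  nondecreasing, so both estimates are reversed together.\<close>

lemma surface_functional_le_ball_value:
  fixes K L :: "(real ^ 'n) set"
  assumes phi: "\<phi> \<in> Psi_tilde CARD('n)" and K: "K \<in> star_bodies" and L: "L \<in> S_tilde"
  shows "surface_functional \<phi> K L \<le> ball_value TYPE('n) \<phi> (measure lebesgue K)"
proof -
  note P = Psi_tilde_D[OF phi]
  have "continuous_on {0<..} (\<lambda>t. - F_of CARD('n) \<phi> t)"
    by (intro continuous_intros continuous_on_F_of P) simp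
  from jensen_radial[OF K S_tilde_D[OF L] P(2) this]
  have "surface_functional \<phi> K L \<le> real CARD('n) * measure lebesgue K *
      F_of CARD('n) \<phi> (vrad (polar_body L) ^ CARD('n) * measure lebesgue L / measure lebesgue K)"
    unfolding surface_functional_F_of[OF K L] by simp
  also have "\<dots> \<le> ball_value TYPE('n) \<phi> (measure lebesgue K)"
    unfolding ball_value_def using P(3)[OF santalo_argument_le(2,1)[OF K L]] by (intro mult_left_mono) auto
  finally show ?thesis .
qed

text \<open>For \<open>L = K\<close> the ratio of the radial functions is constant. This test body
  is the source of the upper bounds in terms of the polar body.\<close>

lemma surface_functional_self:
  fixes K :: "(real ^ 'n) set"
  assumes K: "K \<in> S_tilde"
  shows "surface_functional \<phi> K K = \<phi> (vrad (polar_body K)) * (real CARD('n) * measure lebesgue K)"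
proof -
  have "surface_functional \<phi> K K = (LINT u|spherical_measure. \<phi> (vrad (polar_body K)) * radial K u ^ CARD('n))"
    unfolding surface_functional_eq[OF S_tilde_D[OF K]]
  proof (intro Bochner_Integration.integral_cong refl)
    fix u :: "real ^ 'n" assume "u \<in> space spherical_measure"
    then have "0 < radial K u" using star_body_radial(3)[OF S_tilde_D(1)[OF K]] by (simp add: space_spherical_measure)
    then show "\<phi> (vrad (polar_body K) * radial K u / radial K u) * radial K u ^ CARD('n) = \<phi> (vrad (polar_body K)) * radial K u ^ CARD('n)"
      by simp
  qed
  then show ?thesis by (simp add: integral_radial_power[OF S_tilde_D(1)[OF K]])
qed

lemma vrad_cball:
  assumes "0 < r"
  shows "vrad (cball (0 :: real ^ 'n) r) = r"
  unfolding vrad_def measure_cball_scale[OF assms]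
  using assms unit_cball_measure_pos[where 'n='n] by (simp add: real_root_power_cancel)

lemma ball_value_cball:
  assumes "0 < r"
  shows "ball_value TYPE('n) \<phi> (measure lebesgue (cball (0 :: real ^ 'n) r)) = \<phi> (1 / r) * (real CARD('n) * measure lebesgue (cball (0 :: real ^ 'n) r))"
proof -
  have "measure lebesgue (cball (0 :: real ^ 'n) 1) / measure lebesgue (cball (0 :: real ^ 'n) r) = (1 / r) ^ CARD('n)"
    unfolding measure_cball_scale[OF assms] using assms unit_cball_measure_pos[where 'n='n] by (simp add: power_divide)
  then show ?thesis unfolding ball_value_def using assms by (simp add: F_of_power)
qed

lemma surface_functional_cball:
  assumes r: "0 < r"
  shows "surface_functional \<phi> (cball (0 :: real ^ 'n) r) (cball 0 r) = ball_value TYPE('n) \<phi> (measure lebesgue (cball (0 :: real ^ 'n) r))"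
proof -
  have "cball (0 :: real ^ 'n) r \<in> S_tilde" using cball_K_tilde[OF r] K_tilde_subset_S_tilde by blast
  from surface_functional_self[OF this]
  show ?thesis
    by (simp only: ball_value_cball[OF r] polar_body_cball[OF r] vrad_cball[OF divide_pos_pos[OF zero_less_one r]])
qed

text \<open>A ball is its own minimizer: it belongs to both classes, and testing with it attains the
  general lower bound.\<close>

lemma inf_surface_area_cball:
  assumes phi: "\<phi> \<in> Phi_tilde_1 CARD('n)" and r: "0 < r"
  shows "Omega_inf \<phi> (cball (0 :: real ^ 'n) r) = ball_value TYPE('n) \<phi> (measure lebesgue (cball (0 :: real ^ 'n) r))"
    and "G_inf \<phi> (cball (0 :: real ^ 'n) r) = ball_value TYPE('n) \<phi> (measure lebesgue (cball (0 :: real ^ 'n) r))"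
proof -
  let ?B = "cball (0 :: real ^ 'n) r"
  have B: "?B \<in> K_tilde" "?B \<in> S_tilde" "?B \<in> star_bodies"
    using cball_K_tilde[OF r] K_tilde_subset_S_tilde S_tilde_D(1) by blast+
  have lower: "ereal (ball_value TYPE('n) \<phi> (measure lebesgue ?B)) \<le> ereal (surface_functional \<phi> ?B L)" if "L \<in> S_tilde" for L
    using ball_value_le_surface_functional[OF phi B(3) that] by simp
  show "Omega_inf \<phi> ?B = ball_value TYPE('n) \<phi> (measure lebesgue ?B)"
    unfolding Omega_inf_def
    by (rule antisym) (use lower B surface_functional_cball[where 'n='n, OF r, of \<phi>] in \<open>auto intro!: INF_greatest INF_lower2[of ?B]\<close>)
  show "G_inf \<phi> ?B = ball_value TYPE('n) \<phi> (measure lebesgue ?B)"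
    unfolding G_inf_def
    by (rule antisym) (use lower B K_tilde_subset_S_tilde surface_functional_cball[where 'n='n, OF r, of \<phi>] in \<open>auto intro!: INF_greatest INF_lower2[of ?B]\<close>)
qed

lemma sup_surface_area_cball:
  assumes phi: "\<phi> \<in> Psi_tilde CARD('n)" and r: "0 < r"
  shows "Omega_sup \<phi> (cball (0 :: real ^ 'n) r) = ball_value TYPE('n) \<phi> (measure lebesgue (cball (0 :: real ^ 'n) r))"
    and "G_sup \<phi> (cball (0 :: real ^ 'n) r) = ball_value TYPE('n) \<phi> (measure lebesgue (cball (0 :: real ^ 'n) r))"
proof -
  let ?B = "cball (0 :: real ^ 'n) r"
  have B: "?B \<in> K_tilde" "?B \<in> S_tilde" "?B \<in> star_bodies"
    using cball_K_tilde[OF r] K_tilde_subset_S_tilde S_tilde_D(1) by blast+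
  have upper: "ereal (surface_functional \<phi> ?B L) \<le> ereal (ball_value TYPE('n) \<phi> (measure lebesgue ?B))" if "L \<in> S_tilde" for L
    using surface_functional_le_ball_value[OF phi B(3) that] by simp
  show "Omega_sup \<phi> ?B = ball_value TYPE('n) \<phi> (measure lebesgue ?B)"
    unfolding Omega_sup_def
    by (rule antisym) (use upper B surface_functional_cball[where 'n='n, OF r, of \<phi>] in \<open>auto intro!: SUP_least SUP_upper2[of ?B]\<close>)
  show "G_sup \<phi> ?B = ball_value TYPE('n) \<phi> (measure lebesgue ?B)"
    unfolding G_sup_def
    by (rule antisym) (use upper B K_tilde_subset_S_tilde surface_functional_cball[where 'n='n, OF r, of \<phi>] in \<open>auto intro!: SUP_least SUP_upper2[of ?B]\<close>)
qed

lemma ball_vrad_eq_cball: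
  fixes K :: "(real ^ 'n) set"
  assumes "0 < measure lebesgue K"
  shows "ball_vrad K = cball 0 (vrad K)" "measure lebesgue (ball_vrad K) = measure lebesgue K"
proof -
  show *: "ball_vrad K = cball 0 (vrad K)"
    unfolding ball_vrad_def by (rule scaled_unit_cball[OF vrad_pos[OF assms]])
  show "measure lebesgue (ball_vrad K) = measure lebesgue K"
    unfolding * measure_cball_scale[OF vrad_pos[OF assms]] vrad_power
    using unit_cball_measure_pos[where 'n='n] by simp
qed

section \<open>The inequalities for the affine and geominimal surface areas\<close>

theorem theorem4p1:
  fixes K :: "(real ^ 'n) set" and \<phi> :: "real \<Rightarrow> real"
  assumes "K \<in> star_bodies"
  shows
    "(\<phi> \<in> Phi_tilde_1 CARD('n) \<longrightarrow>
        G_inf \<phi> K \<ge> Omega_inf \<phi> K \<and>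
        Omega_inf \<phi> K \<ge> Omega_inf \<phi> (ball_vrad K) \<and>
        Omega_inf \<phi> (ball_vrad K) = G_inf \<phi> (ball_vrad K))
   \<and> (\<phi> \<in> Psi_tilde CARD('n) \<longrightarrow>
        G_sup \<phi> K \<le> Omega_sup \<phi> K \<and>
        Omega_sup \<phi> K \<le> Omega_sup \<phi> (ball_vrad K) \<and>
        Omega_sup \<phi> (ball_vrad K) = G_sup \<phi> (ball_vrad K))
   \<and> (\<phi> \<in> Phi_tilde_1 CARD('n) \<longrightarrow> K \<in> S_tilde \<longrightarrow>
        Omega_inf \<phi> K \<le> Omega_inf \<phi> (polar_body (ball_vrad (polar_body K))) \<and>
        (Omega_inf \<phi> K = Omega_inf \<phi> (polar_body (ball_vrad (polar_body K)))
           \<longleftrightarrow> origin_symmetric_ellipsoid K))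
   \<and> (\<phi> \<in> Phi_tilde_1 CARD('n) \<longrightarrow> K \<in> K_tilde \<longrightarrow>
        Omega_inf \<phi> K \<le> G_inf \<phi> K \<and>
        G_inf \<phi> K \<le> G_inf \<phi> (polar_body (ball_vrad (polar_body K))) \<and>
        (G_inf \<phi> K = G_inf \<phi> (polar_body (ball_vrad (polar_body K)))
           \<longleftrightarrow> origin_symmetric_ellipsoid K))"
proof -
  let ?w = "measure lebesgue (cball (0 :: real ^ 'n) 1)" and ?V = "measure lebesgue K"
  note mK = star_bodies_measure_pos[OF assms]
  note BK = ball_vrad_eq_cball[OF mK]
  have r: "0 < vrad K" by (rule vrad_pos[OF mK])
  have inf_mono: "Omega_inf \<phi> K \<le> G_inf \<phi> K"
    unfolding Omega_inf_def G_inf_def by (rule INF_superset_mono[OF K_tilde_subset_S_tilde]) simp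
  have sup_mono: "G_sup \<phi> K \<le> Omega_sup \<phi> K"
    unfolding Omega_sup_def G_sup_def by (rule SUP_subset_mono[OF K_tilde_subset_S_tilde]) simp
  have lower: "ereal (ball_value TYPE('n) \<phi> ?V) \<le> Omega_inf \<phi> K" if "\<phi> \<in> Phi_tilde_1 CARD('n)"
    unfolding Omega_inf_def using ball_value_le_surface_functional[OF that assms] by (auto intro!: INF_greatest)
  have upper: "Omega_sup \<phi> K \<le> ereal (ball_value TYPE('n) \<phi> ?V)" if "\<phi> \<in> Psi_tilde CARD('n)"
    unfolding Omega_sup_def using surface_functional_le_ball_value[OF that assms] by (auto intro!: SUP_least)
  \<comment> \<open>\<open>X\<close> stands for either surface area of \<open>K\<close>. All that
    the argument takes from it is that it lies between the ball value of \<open>K\<close> and the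
    functional tested with \<open>K\<close> itself.\<close>
  have key: "X \<le> Omega_inf \<phi> (polar_body (ball_vrad (polar_body K))) \<and>
      G_inf \<phi> (polar_body (ball_vrad (polar_body K))) = Omega_inf \<phi> (polar_body (ball_vrad (polar_body K))) \<and>
      (X = Omega_inf \<phi> (polar_body (ball_vrad (polar_body K))) \<longleftrightarrow> origin_symmetric_ellipsoid K)"
    if phi: "\<phi> \<in> Phi_tilde_1 CARD('n)" and K: "K \<in> S_tilde"
      and X: "ereal (ball_value TYPE('n) \<phi> ?V) \<le> X" "X \<le> ereal (surface_functional \<phi> K K)" for X :: ereal
  proof -
    define c where "c = vrad (polar_body K)"
    have mP: "0 < measure lebesgue (polar_body K)"
      using K by (intro convex_bodies_measure_pos K_tilde_convex_bodies) (simp add: S_tilde_def)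
    have c: "0 < c" unfolding c_def by (rule vrad_pos[OF mP])
    have eq: "polar_body (ball_vrad (polar_body K)) = cball 0 (1 / c)"
      using ball_vrad_eq_cball(1)[OF mP] polar_body_cball[OF c] by (simp add: c_def)
    \<comment> \<open>The volume of \<open>polar_body (ball_vrad (polar_body K))\<close>. Since it
      equals \<open>?w\<^sup>2\<close> divided by the volume of the polar of \<open>K\<close>, the
      inequality \<open>?V \<le> U\<close> is the Santalo inequality, with the same equality
      case.\<close>
    define U where "U = measure lebesgue (cball (0 :: real ^ 'n) (1 / c))"
    have U: "U = ?w\<^sup>2 / measure lebesgue (polar_body K)"
      using measure_cball_scale[of "1 / c", where 'n='n] c vrad_power[of "polar_body K"]
      by (simp add: U_def c_def power_divide power2_eq_square)
    have phic: "0 < \<phi> c" using Phi_tilde_1_D(1)[OF phi] c by (simp add: admissible_def)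
    have val: "ball_value TYPE('n) \<phi> U = \<phi> c * (real CARD('n) * U)"
      using ball_value_cball[of "1 / c" \<phi>, where 'n='n] c by (simp add: U_def)
    have inf: "Omega_inf \<phi> (cball (0 :: real ^ 'n) (1 / c)) = ereal (\<phi> c * (real CARD('n) * U))"
      "G_inf \<phi> (cball (0 :: real ^ 'n) (1 / c)) = ereal (\<phi> c * (real CARD('n) * U))"
      using inf_surface_area_cball[OF phi, of "1 / c"] c val by (simp_all add: U_def)
    have self: "surface_functional \<phi> K K = \<phi> c * (real CARD('n) * ?V)"
      unfolding c_def by (rule surface_functional_self[OF K])
    have VU: "?V \<le> U" using blaschke_santalo_star(1)[OF K] mP by (simp add: U pos_le_divide_eq)
    have le: "\<phi> c * (real CARD('n) * ?V) \<le> \<phi> c * (real CARD('n) * U)"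
      using VU phic by (intro mult_left_mono) auto
    have "X = ereal (\<phi> c * (real CARD('n) * U)) \<longleftrightarrow> origin_symmetric_ellipsoid K"
    proof
      assume "X = ereal (\<phi> c * (real CARD('n) * U))"
      then have "\<phi> c * (real CARD('n) * U) \<le> \<phi> c * (real CARD('n) * ?V)" using X(2) self by simp
      \<comment> \<open>Positivity of \<open>\<phi>\<close> allows the factor
        \<open>\<phi> c\<close> to be cancelled; this turns equality of surface areas into equality
        in the Santalo inequality.\<close>
      then have "U \<le> ?V" using phic by simp
      then have "?V * measure lebesgue (polar_body K) = ?w\<^sup>2" using VU mP by (simp add: U field_simps)
      then show "origin_symmetric_ellipsoid K" by (rule blaschke_santalo_star(2)[OF K])
    next
      assume "origin_symmetric_ellipsoid K"
      then have "?V * measure lebesgue (polar_body K) = ?w\<^sup>2" by (rule ellipsoid_polar(2))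
      \<comment> \<open>For an ellipsoid the two volumes agree, so the lower bound
        \<open>ball_value\<close> at \<open>?V\<close> and the upper bound from \<open>L = K\<close>
        coincide and determine \<open>X\<close>.\<close>
      then have "?V = U" using mP by (simp add: U field_simps)
      then show "X = ereal (\<phi> c * (real CARD('n) * U))"
        using X self val by (intro antisym) auto
    qed
    moreover have "X \<le> ereal (\<phi> c * (real CARD('n) * U))"
      using order_trans[OF X(2)] le self by simp
    ultimately show ?thesis unfolding eq inf by simp
  qed
  show ?thesis
  proof (intro conjI impI)
    assume phi: "\<phi> \<in> Phi_tilde_1 CARD('n)"
    note B = inf_surface_area_cball[OF phi r, folded BK(1), unfolded BK(2)]
    show "Omega_inf \<phi> (ball_vrad K) \<le> Omega_inf \<phi> K" using lower[OF phi] by (simp add: B)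
    show "Omega_inf \<phi> (ball_vrad K) = G_inf \<phi> (ball_vrad K)" by (simp add: B)
  next
    assume phi: "\<phi> \<in> Psi_tilde CARD('n)"
    note B = sup_surface_area_cball[OF phi r, folded BK(1), unfolded BK(2)]
    show "Omega_sup \<phi> K \<le> Omega_sup \<phi> (ball_vrad K)" using upper[OF phi] by (simp add: B)
    show "Omega_sup \<phi> (ball_vrad K) = G_sup \<phi> (ball_vrad K)" by (simp add: B)
  next
    assume phi: "\<phi> \<in> Phi_tilde_1 CARD('n)" and K: "K \<in> S_tilde"
    have "Omega_inf \<phi> K \<le> ereal (surface_functional \<phi> K K)" unfolding Omega_inf_def by (rule INF_lower[OF K])
    note k = key[OF phi K lower[OF phi] this]
    show "Omega_inf \<phi> K \<le> Omega_inf \<phi> (polar_body (ball_vrad (polar_body K)))" using k by blast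
    show "Omega_inf \<phi> K = Omega_inf \<phi> (polar_body (ball_vrad (polar_body K))) \<longleftrightarrow> origin_symmetric_ellipsoid K" using k by blast
  next
    assume phi: "\<phi> \<in> Phi_tilde_1 CARD('n)" and K: "K \<in> K_tilde"
    then have KS: "K \<in> S_tilde" using K_tilde_subset_S_tilde by blast
    have "G_inf \<phi> K \<le> ereal (surface_functional \<phi> K K)" unfolding G_inf_def by (rule INF_lower[OF K])
    note k = key[OF phi KS order_trans[OF lower[OF phi] inf_mono] this]
    show "G_inf \<phi> K \<le> G_inf \<phi> (polar_body (ball_vrad (polar_body K)))" using k by simp
    show "G_inf \<phi> K = G_inf \<phi> (polar_body (ball_vrad (polar_body K))) \<longleftrightarrow> origin_symmetric_ellipsoid K" using k by simp
  qed (rule inf_mono sup_mono)+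
qed

end
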